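(* For all $z$ in the upper half plane, with $q=e^{2\pi i z}$, the following identities hold (equivalently, as identities of formal power series in $q$): (i) $\overline{f}(-q) = -16\,\mathcal{H}(q) - \frac13\,\Theta^3(z)$; (ii) $\overline{f}_2(q) = -8\,\mathcal{H}(q) + \frac13\,\Theta^3(z)$.
   Context: An overpartition of $n$ is a partition of $n$ in which the first occurrence of each number may be overlined (e.g. there are 14 overpartitions of 4). The rank of an overpartition is its largest part minus its number of parts. For an overpartition $\lambda$, let $\ell(\lambda)$ be its largest part (size), $n(\lambda)$ its number of parts, $\lambda_o$ the subpartition consisting of the odd non-overlined parts of $\lambda$, and $\chi(\lambda)=1$ if the largest part of $\lambda$ is odd and non-overlined, $\chi(\lambda)=0$ otherwise; here, if the largest part occurs several times, it counts as overlined when its first occurrence is overlined. The $M2$-rank of $\lambda$ is $$\lceil \ell(\lambda)/2\rceil - n(\lambda) + n(\lambda_o) - \chi(\lambda).$$ The empty overpartition (of $0$) has rank and $M2$-rank $0$. Let $\overline{p}_e(n)$, $\overline{p}_o(n)$, $M2_e(n)$, $M2_o(n)$ be the number of overpartitions of $n$ with even rank, odd rank, even $M2$-rank, odd $M2$-rank, respectively. Put $\overline{\alpha}(n)=\overline{p}_e(n)-\overline{p}_o(n)$, $\overline{\alpha}_2(n)=M2_e(n)-M2_o(n)$, and $$\overline{f}(q)=\sum_{n\ge 0}\overline{\alpha}(n)q^n = 1+2q-4q^2+8q^3-10q^4+\cdots,\qquad \overline{f}_2(q)=\sum_{n\ge 0}\overline{\alpha}_2(n)q^n=1+2q+4q^2-2q^4+8q^5+\cdots.$$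 For $n\ge1$, $H(n)$ is the Hurwitz class number: the number of $SL_2(\mathbb{Z})$-classes of (not necessarily primitive) positive definite integral binary quadratic forms of discriminant $-n$, where the classes of forms $a(x^2+y^2)$ are counted with weight $1/2$ and those of $a(x^2+xy+y^2)$ with weight $1/3$. Put $$\mathcal{H}(q)=-\frac1{12}+\sum_{n\ge1,\ n\equiv 0,3\ (\mathrm{mod}\ 4)}H(n)q^n=-\frac1{12}+\frac13q^3+\frac12q^4+q^7+\cdots,\qquad \Theta(z)=\sum_{n=-\infty}^{\infty}q^{n^2}.$$ *)

theory Defs
  imports "HOL-Analysis.Analysis" "HOL-Library.Multiset"
begin

section \<open>Overpartitions and their ranks\<close>

text \<open>
  An overpartition is a pair \<open>(M, S)\<close>: \<open>M\<close> is the multiset of all parts, and \<open>S\<close> is the set of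
  those sizes whose first occurrence is overlined.
\<close>

type_synonym overpartition = "nat multiset \<times> nat set"

definition overpartitions :: "nat \<Rightarrow> overpartition set" where
  "overpartitions n = {(M, S). 0 \<notin># M \<and> \<Sum>\<^sub># M = n \<and> S \<subseteq> set_mset M}"

definition largest_part :: "overpartition \<Rightarrow> nat" where
  "largest_part p = (if fst p = {#} then 0 else Max (set_mset (fst p)))"

definition num_parts :: "overpartition \<Rightarrow> nat" where
  "num_parts p = size (fst p)"

definition op_rank :: "overpartition \<Rightarrow> int" where
  "op_rank p = int (largest_part p) - int (num_parts p)"

text \<open>
  Only one occurrence of each size in \<open>S\<close> is overlined, so a part of such a size
  may still have non-overlined copies.
\<close>

definition nonoverlined_parts :: "overpartition \<Rightarrow> nat multiset" where
  "nonoverlined_parts p = fst p - mset_set (snd p)"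

definition odd_nonoverlined_parts :: "overpartition \<Rightarrow> nat multiset" where
  "odd_nonoverlined_parts p = filter_mset odd (nonoverlined_parts p)"

text \<open>
  A repeated largest part counts as overlined as soon as its first occurrence is, so the condition
  here is about \<open>S\<close> and not about \<^const>\<open>nonoverlined_parts\<close>. For the empty overpartition the
  value is \<open>0\<close>, because its \<^const>\<open>largest_part\<close> is \<open>0\<close>.
\<close>

definition op_chi :: "overpartition \<Rightarrow> nat" where
  "op_chi p = (if odd (largest_part p) \<and> largest_part p \<notin> snd p then 1 else 0)"

definition M2_rank :: "overpartition \<Rightarrow> int" where
  "M2_rank p = \<lceil>real (largest_part p) / 2\<rceil> - int (num_parts p)
     + int (size (odd_nonoverlined_parts p)) - int (op_chi p)"

definition p_even :: "nat \<Rightarrow> nat" where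
  "p_even n = card {p \<in> overpartitions n. even (op_rank p)}"

definition p_odd :: "nat \<Rightarrow> nat" where
  "p_odd n = card {p \<in> overpartitions n. odd (op_rank p)}"

definition M2_even :: "nat \<Rightarrow> nat" where
  "M2_even n = card {p \<in> overpartitions n. even (M2_rank p)}"

definition M2_odd :: "nat \<Rightarrow> nat" where
  "M2_odd n = card {p \<in> overpartitions n. odd (M2_rank p)}"

definition alpha_bar :: "nat \<Rightarrow> int" where
  "alpha_bar n = int (p_even n) - int (p_odd n)"

definition alpha2_bar :: "nat \<Rightarrow> int" where
  "alpha2_bar n = int (M2_even n) - int (M2_odd n)"

definition f_bar :: "complex \<Rightarrow> complex" where
  "f_bar q = (\<Sum>n. of_int (alpha_bar n) * q ^ n)"

definition f2_bar :: "complex \<Rightarrow> complex" where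
  "f2_bar q = (\<Sum>n. of_int (alpha2_bar n) * q ^ n)"


section \<open>Hurwitz class numbers\<close>

text \<open>The triple \<open>(a, b, c)\<close> stands for the form \<open>a x^2 + b x y + c y^2\<close>.\<close>

type_synonym bqf = "int \<times> int \<times> int"

fun bqf_eval :: "bqf \<Rightarrow> int \<Rightarrow> int \<Rightarrow> int" where
  "bqf_eval (a, b, c) x y = a * x\<^sup>2 + b * x * y + c * y\<^sup>2"

fun bqf_disc :: "bqf \<Rightarrow> int" where
  "bqf_disc (a, b, c) = b\<^sup>2 - 4 * a * c"

definition bqf_pos_def :: "bqf \<Rightarrow> bool" where
  "bqf_pos_def Q \<longleftrightarrow> (\<forall>x y. (x, y) \<noteq> (0, 0) \<longrightarrow> bqf_eval Q x y > 0)"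

definition bqf_SL2_equiv :: "bqf \<Rightarrow> bqf \<Rightarrow> bool" where
  "bqf_SL2_equiv Q Q' \<longleftrightarrow>
     (\<exists>r s t u. r * u - s * t = 1 \<and>
        (\<forall>x y. bqf_eval Q' x y = bqf_eval Q (r * x + s * y) (t * x + u * y)))"

definition pos_def_forms :: "nat \<Rightarrow> bqf set" where
  "pos_def_forms n = {Q. bqf_pos_def Q \<and> bqf_disc Q = - int n}"

definition form_classes :: "nat \<Rightarrow> bqf set set" where
  "form_classes n = pos_def_forms n //
     {(Q, Q'). Q \<in> pos_def_forms n \<and> Q' \<in> pos_def_forms n \<and> bqf_SL2_equiv Q Q'}"

definition class_weight :: "bqf set \<Rightarrow> real" where
  "class_weight C =
     (if \<exists>a. (a, 0, a) \<in> C then 1 / 2 else if \<exists>a. (a, a, a) \<in> C then 1 / 3 else 1)"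

definition hurwitz_class_number :: "nat \<Rightarrow> real" where
  "hurwitz_class_number n = (\<Sum>C\<in>form_classes n. class_weight C)"

definition hurwitz_gf :: "complex \<Rightarrow> complex" where
  "hurwitz_gf q = - (1 / 12) +
     (\<Sum>n. if n \<ge> 1 \<and> n mod 4 \<in> {0, 3} then of_real (hurwitz_class_number n) * q ^ n else 0)"


section \<open>The theta function\<close>

definition theta :: "complex \<Rightarrow> complex" where
  "theta z = (\<Sum>\<^sub>\<infinity>n\<in>(UNIV :: int set). exp (2 * of_real pi * \<i> * z) powi (n\<^sup>2))"

end

theory Submission
  imports Defs "HOL-Computational_Algebra.Formal_Laurent_Series"
begin

text \<open>
  Summing over the largest part and expanding in a Newton series turns both generating functions
  into Eulerian series
  \<open>\<Sum>n. (-1; Q)\<^sub>n (u + Q) \<cdots> (u + Q\<^sup>n) / (-Q; Q)\<^sub>n\<^sup>2\<close>, with \<open>(Q, u) = (q, 0)\<close> for the rank and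
  \<open>(Q, u) = (q\<^sup>2, q)\<close> for the \<open>M2\<close>-rank. By Bailey pairs, the products of these series with
  \<open>\<theta>(-q) = \<Sum>l. (-1)\<^sup>l q^(l\<^sup>2)\<close> are single sums over \<open>l\<close>.

  Let \<open>T\<^sub>\<epsilon>\<close> be the sum of \<open>\<epsilon>(x, y, z) q^(x y + y z + z x)\<close> over the triples of natural numbers
  with at most one zero, triples with a zero counting half, and let \<open>T\<^sub>0, T\<^sub>1, T\<^sub>2\<close> belong to
  \<open>\<epsilon> = 1, (-1)^(x + y), (-1)^y\<close>. Their products with \<open>\<theta>(-q)\<close> are again single sums over \<open>l\<close>, and a
  comparison gives \<open>f = 1 - 4 T\<^sub>2\<close>, \<open>f\<^sub>2 = 1 - 4 T\<^sub>1\<close> and \<open>\<Theta>\<^sup>3 = 1 + 2 T\<^sub>0 - 6 T\<^sub>1\<close>.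

  The triples with three entries of the same parity are the Selling parameters of positive definite
  binary forms; each class arises from three of them, counted with weights, whence
  \<open>12 \<H> = -1 + T\<^sub>0 + 3 T\<^sub>1\<close>. Averaging over cyclic rotations gives \<open>T\<^sub>2(-q) = (T\<^sub>0 + T\<^sub>1) / 2\<close>. Both
  identities follow by eliminating the \<open>T\<^sub>i\<close>.
\<close>

text \<open>All series identities are proved in formal Laurent series, where convergence and every
  exchange of sums is a valuation bound; negative powers occur because the sums over l are
  two-sided. The factor theta(-q) is forced: the unit Bailey pair shows that the value
  \<open>bS 0\<close> of the conjugate sequence is its inverse. It also fits the ternary sums. Put q
  = e^-t and fix m = x + min(y, z). Then theta(-q) times the inner sum over x is half the sum of
  (-1)^l q^(l^2) tanh((m + l) t), with coth instead of tanh, up to a correction, when the inner sum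
  alternates; addition theorems then make the sum over m computable. The obstacle is the pole of
  coth: it leaves terms in the product with T2 that disappear only through an identity between
  Lambert series. The combination 1 + 2 T0 - 6 T1 is the one in which the sums with 1/cosh^2 cancel,
  so that theta(q)^2 times theta(q) theta(-q) remains.\<close>

unbundle fps_syntax

section \<open>Formal sums of Laurent series\<close>

text \<open>Valuation at least n. Unlike \<open>fls_subdegree\<close>, which is 0 at the zero
  series, this holds for 0 with every n, so that cancellation in sums needs no case split.\<close>

definition vge :: "'a::field fls \<Rightarrow> int \<Rightarrow> bool" where
  "vge f n \<longleftrightarrow> (\<forall>i<n. f $$ i = 0)"

lemma vge_iff: "vge f n \<longleftrightarrow> f = 0 \<or> n \<le> fls_subdegree f"
proof
  assume "vge f n"
  then show "f = 0 \<or> n \<le> fls_subdegree f"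
    by (metis fls_subdegree_geI vge_def)
next
  assume "f = 0 \<or> n \<le> fls_subdegree f"
  then show "vge f n"
    unfolding vge_def using fls_eq0_below_subdegree by force
qed

lemma vge_0 [simp]: "vge 0 n"
  by (simp add: vge_def)

lemma vge_mono: "vge f n \<Longrightarrow> m \<le> n \<Longrightarrow> vge f m"
  by (auto simp: vge_def)

lemma vge_add: "vge f n \<Longrightarrow> vge g n \<Longrightarrow> vge (f + g) n"
  by (auto simp: vge_def)

lemma vge_diff: "vge f n \<Longrightarrow> vge g n \<Longrightarrow> vge (f - g) n"
  by (auto simp: vge_def)

lemma vge_uminus [simp]: "vge (- f) n \<longleftrightarrow> vge f n"
  by (auto simp: vge_def)

lemma vge_sum: "(\<And>i. i \<in> A \<Longrightarrow> vge (f i) n) \<Longrightarrow> vge (sum f A) n"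
  by (induction A rule: infinite_finite_induct) (auto intro: vge_add)

lemma vge_mult: "vge f m \<Longrightarrow> vge g n \<Longrightarrow> vge (f * g) (m + n)"
  by (cases "f = 0 \<or> g = 0") (auto simp: vge_iff)

lemma vge_mult': "vge f m \<Longrightarrow> vge g n \<Longrightarrow> k \<le> m + n \<Longrightarrow> vge (f * g) k"
  using vge_mult vge_mono by blast

lemma vge_power: "vge f m \<Longrightarrow> vge (f ^ k) (int k * m)"
proof (induction k)
  case (Suc k)
  then have "vge (f * f ^ k) (m + int k * m)"
    by (intro vge_mult) auto
  then show ?case by (simp add: algebra_simps)
qed (simp add: vge_def)

lemma vge_1 [simp]: "vge 1 n \<longleftrightarrow> n \<le> 0"
  by (auto simp: vge_iff)

lemma vge_const: "n \<le> 0 \<Longrightarrow> vge (fls_const c) n"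
  by (simp add: vge_def)

lemma vge_of_int: "n \<le> 0 \<Longrightarrow> vge (of_int k) n"
  by (simp add: fls_of_int vge_const)

lemma vge_of_nat: "n \<le> 0 \<Longrightarrow> vge (of_nat k) n"
  by (simp add: fls_of_nat vge_const)

lemma vge_numeral: "n \<le> 0 \<Longrightarrow> vge (numeral k) n"
  using vge_of_nat[of n "numeral k"] by simp

lemma vge_exists: "\<exists>B. vge f B"
  by (auto simp: vge_iff)

text \<open>The q-adic topology is separated: an identity follows once the difference of its sides
  has arbitrarily high order.\<close>

lemma vge_all_zero: "(\<And>n. vge f n) \<Longrightarrow> f = 0"
  by (metis linorder_not_le vge_iff zle_add1_eq_le)

lemma vge_inverse_one_plus:
  assumes "vge f 1"
  shows "1 + f \<noteq> 0" "vge (inverse (1 + f)) 0"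
proof -
  have 1: "(1 + f) $$ 0 = 1"
    using assms by (simp add: vge_def)
  show nz: "1 + f \<noteq> 0"
  proof
    assume "1 + f = 0"
    then have "(1 + f) $$ 0 = 0" by simp
    with 1 show False by simp
  qed
  have "vge (1 + f) 0"
    by (rule vge_add) (auto intro: vge_mono[OF assms])
  then have "fls_subdegree (1 + f) = 0"
    using nz 1 by (metis fls_subdegree_leI order_antisym vge_iff zero_neq_one)
  then show "vge (inverse (1 + f)) 0"
    using nz by (auto simp: vge_iff fls_inverse_subdegree)
qed

section \<open>Families that converge in the q-adic topology\<close>

definition fsummable :: "('i \<Rightarrow> 'a::field fls) \<Rightarrow> 'i set \<Rightarrow> bool" where
  "fsummable f A \<longleftrightarrow> (\<forall>N. finite {i\<in>A. \<not> vge (f i) N})"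

text \<open>Coefficientwise sum. The value is meaningful under \<open>fsummable\<close>, which makes
  each index set here finite and bounds the exponents below; otherwise a coefficient may default to
  0 and \<open>Abs_fls\<close> may be unspecified.\<close>

definition fsum :: "('i \<Rightarrow> 'a::field fls) \<Rightarrow> 'i set \<Rightarrow> 'a fls" where
  "fsum f A = Abs_fls (\<lambda>n. \<Sum>i\<in>{i\<in>A. f i $$ n \<noteq> 0}. f i $$ n)"

text \<open>All but finitely many terms have no negative exponents, and each of the others has some
  lower bound. A common bound is what lets \<open>Abs_fls\<close> in \<open>fsum\<close> return the
  intended coefficients.\<close>

lemma fsummable_uniform_bound:
  assumes "fsummable f A"
  shows "\<exists>B. \<forall>i\<in>A. vge (f i) B"
proof -
  let ?F = "{i\<in>A. \<not> vge (f i) 0}"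
  have fin: "finite ?F" using assms by (auto simp: fsummable_def)
  have "\<exists>B. \<forall>i\<in>F. vge (f i) B" if "finite F" for F
    using that
  proof (induction F rule: finite_induct)
    case (insert x F)
    then obtain B where "\<forall>i\<in>F. vge (f i) B" by blast
    moreover obtain C where "vge (f x) C" using vge_exists by blast
    ultimately have "\<forall>i\<in>insert x F. vge (f i) (min B C)"
      by (auto intro: vge_mono)
    then show ?case by blast
  qed auto
  from this[OF fin] obtain B where B: "\<forall>i\<in>?F. vge (f i) B" by blast
  have "\<forall>i\<in>A. vge (f i) (min B 0)"
  proof
    fix i assume "i \<in> A"
    then show "vge (f i) (min B 0)"
      using B vge_mono[of "f i" B "min B 0"] vge_mono[of "f i" 0 "min B 0"] by auto
  qed
  then show ?thesis by blast
qed

lemma fsum_nth0: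
  assumes "fsummable f A"
  shows "fsum f A $$ n = (\<Sum>i\<in>{i\<in>A. f i $$ n \<noteq> 0}. f i $$ n)"
proof -
  obtain B where B: "\<forall>i\<in>A. vge (f i) B"
    using fsummable_uniform_bound[OF assms] by blast
  have "\<forall>n<B. (\<Sum>i\<in>{i\<in>A. f i $$ n \<noteq> 0}. f i $$ n) = 0"
    using B by (auto simp: vge_def intro!: sum.neutral)
  then show ?thesis
    unfolding fsum_def by (intro nth_Abs_fls_lower_bound)
qed

lemma fsum_nth:
  assumes "fsummable f A" "finite F" "F \<subseteq> A" "\<And>i. i \<in> A - F \<Longrightarrow> f i $$ n = 0"
  shows "fsum f A $$ n = (\<Sum>i\<in>F. f i $$ n)"
  unfolding fsum_nth0[OF assms(1)]
  by (rule sum.mono_neutral_left) (use assms in auto)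

lemma fls_nth_sum: "(sum f A) $$ n = (\<Sum>i\<in>A. f i $$ n)"
  by (induction A rule: infinite_finite_induct) auto

lemma fsum_approx:
  assumes "fsummable f A" "finite F" "F \<subseteq> A" "\<And>i. i \<in> A - F \<Longrightarrow> vge (f i) N"
  shows "vge (fsum f A - sum f F) N"
  unfolding vge_def
proof (intro allI impI)
  fix n assume "n < N"
  have "fsum f A $$ n = (\<Sum>i\<in>F. f i $$ n)"
    by (rule fsum_nth) (use assms \<open>n < N\<close> in \<open>auto simp: vge_def\<close>)
  then show "(fsum f A - sum f F) $$ n = 0"
    by (simp add: fls_nth_sum)
qed

text \<open>Modulo q^N a finite partial sum containing every term of order below N decides. The
  rules for addition, scaling, unions, iterated sums and telescoping all come down to exhibiting
  such a finite set.\<close>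

lemma fsum_unique:
  assumes "fsummable f A"
    and "\<And>N. \<exists>F. finite F \<and> F \<subseteq> A \<and> (\<forall>i\<in>A-F. vge (f i) N) \<and> vge (S - sum f F) N"
  shows "fsum f A = S"
proof -
  have "vge (fsum f A - S) N" for N
  proof -
    obtain F where F: "finite F" "F \<subseteq> A" "\<forall>i\<in>A-F. vge (f i) N" "vge (S - sum f F) N"
      using assms(2) by blast
    have "vge ((fsum f A - sum f F) - (S - sum f F)) N"
      by (intro vge_diff fsum_approx assms F) (use F in auto)
    then show ?thesis by simp
  qed
  then have "fsum f A - S = 0" by (rule vge_all_zero)
  then show ?thesis by simp
qed

lemma fsummableI:
  assumes "\<And>i. i \<in> A \<Longrightarrow> vge (f i) (e i)" "\<And>N. finite {i\<in>A. e i < N}"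
  shows "fsummable f A"
  unfolding fsummable_def
proof
  fix N
  have "{i\<in>A. \<not> vge (f i) N} \<subseteq> {i\<in>A. e i < N}"
    using assms(1) vge_mono[of _ _ N] by (auto simp: not_less[symmetric] simp del: not_less)
  then show "finite {i\<in>A. \<not> vge (f i) N}"
    using assms(2) finite_subset by blast
qed

lemma fsummable_finite: "finite A \<Longrightarrow> fsummable f A"
  by (simp add: fsummable_def)

lemma fsum_finite: "finite A \<Longrightarrow> fsum f A = sum f A"
  by (rule fsum_unique[OF fsummable_finite], assumption, rule exI[of _ A]) simp

lemma fsum_vge:
  assumes "fsummable f A" "\<And>i. i \<in> A \<Longrightarrow> vge (f i) N"
  shows "vge (fsum f A) N"
  using fsum_approx[OF assms(1), of "{}" N] assms(2) by simp

lemma fsummable_cong: "(\<And>i. i \<in> A \<Longrightarrow> f i = g i) \<Longrightarrow> fsummable f A \<longleftrightarrow> fsummable g A"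
  unfolding fsummable_def by (simp cong: conj_cong)

lemma fsum_cong: "(\<And>i. i \<in> A \<Longrightarrow> f i = g i) \<Longrightarrow> fsum f A = fsum g A"
  unfolding fsum_def by (simp cong: conj_cong)

lemma fsummable_subset: "fsummable f A \<Longrightarrow> B \<subseteq> A \<Longrightarrow> fsummable f B"
proof -
  assume f: "fsummable f A" and AB: "B \<subseteq> A"
  show "fsummable f B"
    unfolding fsummable_def
  proof
    fix N
    have "{i\<in>B. \<not> vge (f i) N} \<subseteq> {i\<in>A. \<not> vge (f i) N}" using AB by blast
    then show "finite {i\<in>B. \<not> vge (f i) N}"
      using f finite_subset unfolding fsummable_def by blast
  qed
qed

lemma fsummable_add:
  assumes "fsummable f A" "fsummable g A"
  shows "fsummable (\<lambda>i. f i + g i) A"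
  unfolding fsummable_def
proof
  fix N
  have "{i\<in>A. \<not> vge (f i + g i) N} \<subseteq> {i\<in>A. \<not> vge (f i) N} \<union> {i\<in>A. \<not> vge (g i) N}"
    using vge_add by blast
  then show "finite {i\<in>A. \<not> vge (f i + g i) N}"
    using assms unfolding fsummable_def by (meson finite_UnI finite_subset)
qed

lemma fsum_add:
  assumes "fsummable f A" "fsummable g A"
  shows "fsum (\<lambda>i. f i + g i) A = fsum f A + fsum g A"
proof (rule fsum_unique[OF fsummable_add[OF assms]])
  fix N
  let ?F = "{i\<in>A. \<not> vge (f i) N} \<union> {i\<in>A. \<not> vge (g i) N}"
  have fin: "finite ?F" using assms by (auto simp: fsummable_def)
  have "vge ((fsum f A - sum f ?F) + (fsum g A - sum g ?F)) N"
    by (intro vge_add fsum_approx assms fin) auto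
  then show "\<exists>F. finite F \<and> F \<subseteq> A \<and> (\<forall>i\<in>A-F. vge (f i + g i) N) \<and>
      vge (fsum f A + fsum g A - (\<Sum>i\<in>F. f i + g i)) N"
    by (intro exI[of _ ?F]) (use fin in \<open>auto simp: sum.distrib algebra_simps intro: vge_add\<close>)
qed

lemma fsummable_cmult:
  assumes "fsummable f A"
  shows "fsummable (\<lambda>i. c * f i) A"
  unfolding fsummable_def
proof
  fix N
  obtain B where B: "vge c B" using vge_exists by blast
  have "{i\<in>A. \<not> vge (c * f i) N} \<subseteq> {i\<in>A. \<not> vge (f i) (N - B)}"
    using vge_mult[OF B, of _ "N - B"] by auto
  then show "finite {i\<in>A. \<not> vge (c * f i) N}"
    using assms finite_subset unfolding fsummable_def by blast
qed

lemma fsum_cmult: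
  assumes "fsummable f A"
  shows "fsum (\<lambda>i. c * f i) A = c * fsum f A"
proof (rule fsum_unique[OF fsummable_cmult[OF assms]])
  fix N
  \<comment> \<open>Multiplication by c shifts orders by at least B, so precision N - B in f
    suffices for precision N.\<close>
  obtain B where B: "vge c B" using vge_exists by blast
  let ?F = "{i\<in>A. \<not> vge (f i) (N - B)}"
  have fin: "finite ?F" using assms by (auto simp: fsummable_def)
  have "vge (c * (fsum f A - sum f ?F)) (B + (N - B))"
    by (intro vge_mult B fsum_approx assms fin) auto
  moreover have "\<forall>i\<in>A - ?F. vge (c * f i) N"
    using vge_mult[OF B, of _ "N - B"] by auto
  ultimately show "\<exists>F. finite F \<and> F \<subseteq> A \<and> (\<forall>i\<in>A-F. vge (c * f i) N) \<and>
      vge (c * fsum f A - (\<Sum>i\<in>F. c * f i)) N"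
    by (intro exI[of _ ?F]) (use fin in \<open>auto simp: sum_distrib_left algebra_simps\<close>)
qed

lemma fsummable_uminus: "fsummable f A \<Longrightarrow> fsummable (\<lambda>i. - f i) A"
  by (simp add: fsummable_def)

lemma fsum_uminus: "fsummable f A \<Longrightarrow> fsum (\<lambda>i. - f i) A = - fsum f A"
  using fsum_cmult[of f A "-1"] by simp

lemma fsummable_diff: "fsummable f A \<Longrightarrow> fsummable g A \<Longrightarrow> fsummable (\<lambda>i. f i - g i) A"
  using fsummable_add[of f A "\<lambda>i. - g i"] fsummable_uminus by auto

lemma fsum_diff:
  "fsummable f A \<Longrightarrow> fsummable g A \<Longrightarrow> fsum (\<lambda>i. f i - g i) A = fsum f A - fsum g A"
  using fsum_add[of f A "\<lambda>i. - g i"] fsummable_uminus[of g A] fsum_uminus[of g A] by simp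

lemma fsummable_reindex:
  assumes "bij_betw h A B"
  shows "fsummable (\<lambda>i. f (h i)) A \<longleftrightarrow> fsummable f B"
proof -
  have "finite {i\<in>A. \<not> vge (f (h i)) N} \<longleftrightarrow> finite {j\<in>B. \<not> vge (f j) N}" for N
  proof (rule bij_betw_finite)
    show "bij_betw h {i\<in>A. \<not> vge (f (h i)) N} {j\<in>B. \<not> vge (f j) N}"
      using assms by (auto simp: bij_betw_def inj_on_def)
  qed
  then show ?thesis by (simp add: fsummable_def)
qed

lemma fsum_reindex:
  assumes "bij_betw h A B"
  shows "fsum (\<lambda>i. f (h i)) A = fsum f B"
proof -
  have "(\<Sum>i\<in>{i\<in>A. f (h i) $$ n \<noteq> 0}. f (h i) $$ n) = (\<Sum>j\<in>{j\<in>B. f j $$ n \<noteq> 0}. f j $$ n)" for n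
  proof (rule sum.reindex_bij_betw)
    show "bij_betw h {i\<in>A. f (h i) $$ n \<noteq> 0} {j\<in>B. f j $$ n \<noteq> 0}"
      using assms by (auto simp: bij_betw_def inj_on_def)
  qed
  then show ?thesis by (simp add: fsum_def)
qed

lemma fsum_mono_neutral:
  assumes "A \<subseteq> B" "\<And>i. i \<in> B - A \<Longrightarrow> f i = 0"
  shows "fsum f A = fsum f B"
proof -
  have "{i\<in>A. f i $$ n \<noteq> 0} = {i\<in>B. f i $$ n \<noteq> 0}" for n
    using assms by fastforce
  then show ?thesis by (simp add: fsum_def)
qed

lemma fsummable_mono_neutral:
  assumes "A \<subseteq> B" "\<And>i. i \<in> B - A \<Longrightarrow> f i = 0"
  shows "fsummable f A \<longleftrightarrow> fsummable f B"
proof -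
  have "{i\<in>A. \<not> vge (f i) n} = {i\<in>B. \<not> vge (f i) n}" for n
  proof -
    have "vge (f i) n" if "i \<in> B" "i \<notin> A" for i
      using that assms(2) by simp
    then show ?thesis using assms(1) by blast
  qed
  then show ?thesis by (simp add: fsummable_def)
qed

lemma fsummable_Un:
  assumes "fsummable f A" "fsummable f B"
  shows "fsummable f (A \<union> B)"
proof -
  have "{i\<in>A \<union> B. \<not> vge (f i) N} = {i\<in>A. \<not> vge (f i) N} \<union> {i\<in>B. \<not> vge (f i) N}" for N
    by auto
  then show ?thesis using assms by (simp add: fsummable_def)
qed

lemma fsum_Un:
  assumes "fsummable f A" "fsummable f B" "A \<inter> B = {}"
  shows "fsum f (A \<union> B) = fsum f A + fsum f B"
proof (rule fsum_unique[OF fsummable_Un[OF assms(1,2)]])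
  fix N
  let ?F = "{i\<in>A. \<not> vge (f i) N}" and ?G = "{i\<in>B. \<not> vge (f i) N}"
  have fin: "finite ?F" "finite ?G" using assms by (auto simp: fsummable_def)
  have "vge ((fsum f A - sum f ?F) + (fsum f B - sum f ?G)) N"
    by (intro vge_add fsum_approx assms fin) auto
  moreover have "sum f (?F \<union> ?G) = sum f ?F + sum f ?G"
    by (rule sum.union_disjoint) (use fin assms(3) in auto)
  ultimately show "\<exists>F. finite F \<and> F \<subseteq> A \<union> B \<and> (\<forall>i\<in>A \<union> B-F. vge (f i) N) \<and>
      vge (fsum f A + fsum f B - sum f F) N"
    by (intro exI[of _ "?F \<union> ?G"]) (use fin in \<open>auto simp: algebra_simps\<close>)
qed

text \<open>Only the finite set \<open>P N\<close> of index pairs carries terms of order below N.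
  Its projection F and its slices J are finite, and both the double and the iterated sum agree with
  the sum over \<open>P N\<close> modulo q^N.\<close>

lemma fsum_Sigma:
  fixes f :: "'i \<Rightarrow> 'j \<Rightarrow> 'a::field fls"
  assumes "fsummable (\<lambda>(i,j). f i j) (Sigma A B)"
  shows "\<And>i. i \<in> A \<Longrightarrow> fsummable (f i) (B i)"
    and "fsummable (\<lambda>i. fsum (f i) (B i)) A"
    and "fsum (\<lambda>(i,j). f i j) (Sigma A B) = fsum (\<lambda>i. fsum (f i) (B i)) A"
proof -
  define P where "P N = {p \<in> Sigma A B. \<not> vge (case p of (i,j) \<Rightarrow> f i j) N}" for N
  have finP: "finite (P N)" for N
    using assms unfolding fsummable_def P_def by blast
  have sub: "{j \<in> B i. \<not> vge (f i j) N} \<subseteq> snd ` P N" if "i \<in> A" for i N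
    using that by (force simp: P_def)
  show inner: "fsummable (f i) (B i)" if "i \<in> A" for i
    unfolding fsummable_def using sub[OF that] finP finite_subset by blast
  have out: "vge (fsum (f i) (B i)) N" if "i \<in> A - fst ` P N" for i N
    using that by (intro fsum_vge inner) (force simp: P_def)+
  show outer: "fsummable (\<lambda>i. fsum (f i) (B i)) A"
    unfolding fsummable_def
  proof
    fix N
    have "{i \<in> A. \<not> vge (fsum (f i) (B i)) N} \<subseteq> fst ` P N"
      using out by blast
    then show "finite {i \<in> A. \<not> vge (fsum (f i) (B i)) N}"
      using finP finite_subset by blast
  qed
  show "fsum (\<lambda>(i,j). f i j) (Sigma A B) = fsum (\<lambda>i. fsum (f i) (B i)) A"
  proof (rule sym, rule fsum_unique[OF outer])
    fix N
    define F where "F = fst ` P N"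
    define J where "J i = {j \<in> B i. \<not> vge (f i j) N}" for i
    have finF: "finite F" by (simp add: F_def finP)
    have FA: "F \<subseteq> A" by (auto simp: F_def P_def)
    have finJ: "finite (J i)" if "i \<in> A" for i
      using inner[OF that] by (auto simp: J_def fsummable_def)
    have PS: "P N = Sigma F J"
      by (force simp: P_def F_def J_def)
    have a: "vge (fsum (\<lambda>(i,j). f i j) (Sigma A B) - (\<Sum>(i,j)\<in>P N. f i j)) N"
      by (rule fsum_approx[OF assms finP]) (auto simp: P_def)
    have "vge (\<Sum>i\<in>F. (fsum (f i) (B i) - sum (f i) (J i))) N"
      by (intro vge_sum fsum_approx inner finJ) (use FA in \<open>auto simp: J_def\<close>)
    moreover have "(\<Sum>(i,j)\<in>P N. f i j) = (\<Sum>i\<in>F. sum (f i) (J i))"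
      unfolding PS by (rule sum.Sigma[symmetric]) (use finF finJ FA in auto)
    ultimately have b: "vge ((\<Sum>i\<in>F. fsum (f i) (B i)) - (\<Sum>(i,j)\<in>P N. f i j)) N"
      by (simp add: sum_subtractf)
    from vge_diff[OF a b]
    have "vge (fsum (\<lambda>(i,j). f i j) (Sigma A B) - (\<Sum>i\<in>F. fsum (f i) (B i))) N"
      by simp
    moreover have "\<forall>i\<in>A-F. vge (fsum (f i) (B i)) N"
      using out by (auto simp: F_def)
    ultimately show "\<exists>F. finite F \<and> F \<subseteq> A \<and> (\<forall>i\<in>A-F. vge (fsum (f i) (B i)) N) \<and>
        vge (fsum (\<lambda>(i,j). f i j) (Sigma A B) - (\<Sum>i\<in>F. fsum (f i) (B i))) N"
      using finF FA by blast
  qed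
qed

lemma fsum_swap:
  fixes f :: "'i \<Rightarrow> 'j \<Rightarrow> 'a::field fls"
  assumes "fsummable (\<lambda>(i,j). f i j) (A \<times> B)"
  shows "fsum (\<lambda>i. fsum (f i) B) A = fsum (\<lambda>j. fsum (\<lambda>i. f i j) A) B"
proof -
  have bij: "bij_betw prod.swap (B \<times> A) (A \<times> B)"
    by (auto simp: bij_betw_def inj_on_def product_swap)
  have eq: "(\<lambda>p. case prod.swap p of (i,j) \<Rightarrow> f i j) = (\<lambda>(j,i). f i j)"
    by (auto simp: fun_eq_iff)
  have s: "fsummable (\<lambda>(j,i). f i j) (B \<times> A)"
    using fsummable_reindex[OF bij, of "\<lambda>(i,j). f i j"] assms by (simp add: eq)
  have "fsum (\<lambda>(j,i). f i j) (B \<times> A) = fsum (\<lambda>(i,j). f i j) (A \<times> B)"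
    using fsum_reindex[OF bij, of "\<lambda>(i,j). f i j"] by (simp add: eq)
  then show ?thesis
    using fsum_Sigma(3)[OF assms] fsum_Sigma(3)[OF s] by simp
qed

text \<open>The hypothesis says that g tends to L; the partial sums collapse to
  \<open>g k - g M\<close>.\<close>

lemma fsum_telescope:
  fixes g :: "nat \<Rightarrow> 'a::field fls"
  assumes "\<And>N. \<exists>M. \<forall>m\<ge>M. vge (g m - L) N"
  shows "fsummable (\<lambda>m. g m - g (Suc m)) {k..}"
    and "fsum (\<lambda>m. g m - g (Suc m)) {k..} = g k - L"
proof -
  have *: "\<exists>M\<ge>k. \<forall>m\<ge>M. vge (g m - L) N \<and> vge (g m - g (Suc m)) N" for N
  proof -
    obtain M where M: "\<forall>m\<ge>M. vge (g m - L) N" using assms by blast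
    have "vge (g m - g (Suc m)) N" if "m \<ge> M" for m
    proof -
      have "vge ((g m - L) - (g (Suc m) - L)) N"
        by (rule vge_diff) (use M that in auto)
      then show ?thesis by simp
    qed
    with M show ?thesis by (intro exI[of _ "max k M"]) auto
  qed
  show s: "fsummable (\<lambda>m. g m - g (Suc m)) {k..}"
    unfolding fsummable_def
  proof
    fix N
    obtain M where "\<forall>m\<ge>M. vge (g m - g (Suc m)) N" using * by blast
    then have "{m\<in>{k..}. \<not> vge (g m - g (Suc m)) N} \<subseteq> {..<M}"
      by (auto simp: not_less[symmetric])
    then show "finite {m\<in>{k..}. \<not> vge (g m - g (Suc m)) N}"
      using finite_subset by blast
  qed
  show "fsum (\<lambda>m. g m - g (Suc m)) {k..} = g k - L"
  proof (rule fsum_unique[OF s])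
    fix N
    obtain M where M: "M \<ge> k" "\<forall>m\<ge>M. vge (g m - L) N \<and> vge (g m - g (Suc m)) N"
      using * by blast
    have "(\<Sum>m\<in>{k..<M}. g m - g (Suc m)) = g k - g M"
      using M(1) by (induction M rule: dec_induct) auto
    then have "vge (g k - L - (\<Sum>m\<in>{k..<M}. g m - g (Suc m))) N"
      using M by simp
    then show "\<exists>F. finite F \<and> F \<subseteq> {k..} \<and> (\<forall>i\<in>{k..} - F. vge (g i - g (Suc i)) N) \<and>
        vge (g k - L - (\<Sum>m\<in>F. g m - g (Suc m))) N"
      using M by (intro exI[of _ "{k..<M}"]) auto
  qed
qed

section \<open>Sums over the integers\<close>

lemma bij_betw_int_pos: "bij_betw int {1..} {1..}"
proof (rule bij_betwI[where g = nat])
qed auto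

lemma bij_betw_int_neg: "bij_betw (\<lambda>n. - int n) {1..} {..-1}"
proof (rule bij_betwI[where g = "\<lambda>i. nat (- i)"])
qed auto

lemma int_UNIV_split: "(UNIV::int set) = ({0} \<union> {1..}) \<union> {..-1}"
  by auto

lemma fsum_int_split:
  fixes f :: "int \<Rightarrow> 'a::field fls"
  assumes "fsummable f UNIV"
  shows "fsummable (\<lambda>n. f (int n)) {1..}" "fsummable (\<lambda>n. f (- int n)) {1..}"
    and "fsum f UNIV = f 0 + fsum (\<lambda>n. f (int n)) {1..} + fsum (\<lambda>n. f (- int n)) {1..}"
proof -
  have s: "fsummable f B" for B using fsummable_subset[OF assms] by auto
  show "fsummable (\<lambda>n. f (int n)) {1..}" "fsummable (\<lambda>n. f (- int n)) {1..}"
    using fsummable_reindex[OF bij_betw_int_pos, of f] fsummable_reindex[OF bij_betw_int_neg, of f] s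
    by auto
  have "fsum f UNIV = fsum f {0} + fsum f {1..} + fsum f {..-1}"
    unfolding int_UNIV_split by (subst fsum_Un[OF s s], force, subst fsum_Un[OF s s]) auto
  then show "fsum f UNIV = f 0 + fsum (\<lambda>n. f (int n)) {1..} + fsum (\<lambda>n. f (- int n)) {1..}"
    using fsum_reindex[OF bij_betw_int_pos, of f] fsum_reindex[OF bij_betw_int_neg, of f]
    by (simp add: fsum_finite)
qed

lemma fsummable_int_split:
  fixes f :: "int \<Rightarrow> 'a::field fls"
  assumes "fsummable (\<lambda>n. f (int n)) {1..}" "fsummable (\<lambda>n. f (- int n)) {1..}"
  shows "fsummable f UNIV"
  using assms fsummable_reindex[OF bij_betw_int_pos, of f] fsummable_reindex[OF bij_betw_int_neg, of f]
  unfolding int_UNIV_split by (intro fsummable_Un; simp add: fsummable_finite)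

lemma fsum_int_minus:
  fixes f :: "int \<Rightarrow> 'a::field fls"
  shows "fsum (\<lambda>l. f (- l)) UNIV = fsum f UNIV"
    and "fsummable (\<lambda>l. f (- l)) UNIV \<longleftrightarrow> fsummable f UNIV"
  using fsum_reindex[of uminus UNIV UNIV f] fsummable_reindex[of uminus UNIV UNIV f]
  by (simp_all add: bij_uminus)

lemma fsum_int_shift:
  fixes f :: "int \<Rightarrow> 'a::field fls"
  shows "fsum (\<lambda>l. f (l + k)) UNIV = fsum f UNIV"
    and "fsummable (\<lambda>l. f (l + k)) UNIV \<longleftrightarrow> fsummable f UNIV"
proof -
  have "bij (\<lambda>l::int. l + k)" by (rule bij_betwI[where g = "\<lambda>l. l - k"]) auto
  from fsum_reindex[OF this, of f] fsummable_reindex[OF this, of f]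
  show "fsum (\<lambda>l. f (l + k)) UNIV = fsum f UNIV"
    "fsummable (\<lambda>l. f (l + k)) UNIV \<longleftrightarrow> fsummable f UNIV" by simp_all
qed

lemma fsum_int_odd:
  fixes f :: "int \<Rightarrow> 'a::field_char_0 fls"
  assumes "fsummable f UNIV" "\<And>l. f (- l) = - f l"
  shows "fsum f UNIV = 0"
proof -
  have "fsum f UNIV = - fsum f UNIV"
    using fsum_int_minus(1)[of f] fsum_uminus[OF assms(1)] assms(2) by simp
  then show ?thesis by (simp add: eq_neg_iff_add_eq_0 flip: mult_2)
qed

section \<open>Bailey pairs over the nome \<open>Q\<close>\<close>

lemma minus_one_powi_minus: "(-1 :: 'a::field) powi (- k) = (-1) powi k"
  by (simp add: power_int_minus flip: power_int_inverse)

lemma minus_one_powi_Suc: "(-1 :: 'a::field) powi (k + 1) = - ((-1) powi k)"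
  by (simp add: power_int_add)

lemma minus_one_powi_sq [simp]: "(-1 :: 'a::field) powi k * (-1) powi k = 1"
  by (simp flip: power_int_mult_distrib)

lemma vge_minus_one_powi: "n \<le> 0 \<Longrightarrow> vge ((-1) powi k) n"
proof -
  assume "n \<le> 0"
  moreover have "(-1 :: 'a fls) powi k = 1 \<or> (-1 :: 'a fls) powi k = -1"
    by (metis minus_one_powi_sq square_eq_1_iff)
  ultimately show ?thesis by (metis vge_1 vge_uminus)
qed

text \<open>The interval from -n to n - 1 is stable under k -> -1 - k, the reflection that fixes the
  shifted kernel \<open>bd\<close>.\<close>

lemma sum_antisym_zero:
  fixes h :: "int \<Rightarrow> 'a::field_char_0"
  assumes "\<And>k. h (-1 - k) = - h k"
  shows "(\<Sum>k=-int n..int n - 1. h k) = 0"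
proof -
  have "(\<Sum>k=-int n..int n - 1. h k) = (\<Sum>k=-int n..int n - 1. h (-1 - k))"
    by (rule sum.reindex_bij_witness[of _ "\<lambda>k. -1 - k" "\<lambda>k. -1 - k"]) auto
  also have "\<dots> = - (\<Sum>k=-int n..int n - 1. h k)"
    by (simp add: assms sum_negf)
  finally show ?thesis by (simp add: eq_neg_iff_add_eq_0 flip: mult_2)
qed

lemma sum_int_sym:
  fixes h :: "int \<Rightarrow> 'a::comm_monoid_add"
  shows "(\<Sum>k=-int n..int n. h (- k)) = (\<Sum>k=-int n..int n. h k)"
  by (rule sum.reindex_bij_witness[of _ uminus uminus]) auto

lemma mult_inverse_cancel:
  fixes a a' b d :: "'a::field"
  shows "a = a' * d \<Longrightarrow> a \<noteq> 0 \<Longrightarrow> d * inverse (a * b) = inverse (a' * b)"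
  by (cases "b = 0") (auto simp: field_simps)

text \<open>One development serves the nomes q, q^2 and -q. The valuation bound makes 1 - Q^n and 1
  + Q^n invertible for n > 0, and characteristic 0 covers 1 + Q^0 = 2.\<close>

locale nome =
  fixes Q :: "'a::field_char_0 fls"
  assumes vge_Q: "vge Q 1" and Q_nonzero: "Q \<noteq> 0"
begin

lemma vge_Q_power: "vge (Q ^ n) (int n)"
  using vge_power[OF vge_Q, of n] by simp

lemma vge_Q_powi: "k \<ge> 0 \<Longrightarrow> vge (Q powi k) k"
  using vge_Q_power[of "nat k"] by (simp add: power_int_def)

lemma Q_powi_add: "Q powi (i + j) = Q powi i * Q powi j"
  using Q_nonzero by (simp add: power_int_add)

lemma one_minus_Q_power: "n > 0 \<Longrightarrow> 1 - Q ^ n \<noteq> 0" "n > 0 \<Longrightarrow> vge (inverse (1 - Q ^ n)) 0"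
  using vge_inverse_one_plus[of "- (Q ^ n)"] vge_mono[OF vge_Q_power, of 1 n] by auto

lemma one_plus_Q_power: "1 + Q ^ n \<noteq> 0" "vge (inverse (1 + Q ^ n)) 0"
proof -
  have "1 + Q ^ n \<noteq> 0 \<and> vge (inverse (1 + Q ^ n)) 0"
  proof (cases "n = 0")
    case True
    have "inverse (2 :: 'a fls) = fls_const (1/2)"
      by (intro inverse_unique) (simp only: mult_2, simp add: fls_plus_const)
    then have "vge (inverse (1 + Q ^ 0)) 0"
      unfolding power_0 one_add_one by (simp only: vge_const)
    then show ?thesis unfolding True by simp
  next
    case False
    then show ?thesis
      using vge_inverse_one_plus[of "Q ^ n"] vge_mono[OF vge_Q_power, of 1 n] by auto
  qed
  then show "1 + Q ^ n \<noteq> 0" "vge (inverse (1 + Q ^ n)) 0" by auto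
qed

lemma one_plus_Q_powi: "1 + Q powi k \<noteq> 0"
proof (cases "k \<ge> 0")
  case True
  then show ?thesis using one_plus_Q_power(1)[of "nat k"] by (simp add: power_int_def)
next
  case False
  then have "1 + Q powi k = (1 + Q ^ nat (- k)) / Q ^ nat (- k)"
    using Q_nonzero by (simp add: power_int_def field_simps)
  then show ?thesis using one_plus_Q_power(1)[of "nat (- k)"] Q_nonzero by simp
qed

text \<open>The q-Pochhammer product (Q; Q)_n; \<open>qm\<close> is (-Q; Q)_n.\<close>

definition qp :: "nat \<Rightarrow> 'a fls" where "qp n = (\<Prod>i=1..n. 1 - Q ^ i)"

definition qm :: "nat \<Rightarrow> 'a fls" where "qm n = (\<Prod>i=1..n. 1 + Q ^ i)"

lemma qp_0 [simp]: "qp 0 = 1" and qm_0 [simp]: "qm 0 = 1"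
  by (simp_all add: qp_def qm_def)

lemma qp_Suc: "qp (Suc n) = qp n * (1 - Q ^ Suc n)" and qm_Suc: "qm (Suc n) = qm n * (1 + Q ^ Suc n)"
  by (simp_all add: qp_def qm_def)

lemma qp_nonzero: "qp n \<noteq> 0" and qm_nonzero: "qm n \<noteq> 0"
  using one_minus_Q_power(1) one_plus_Q_power(1) by (auto simp: qp_def qm_def)

lemma vge_inverse_qp: "vge (inverse (qp n)) 0"
proof (induction n)
  case (Suc n)
  have "vge (inverse (qp n) * inverse (1 - Q ^ Suc n)) (0 + 0)"
    by (intro vge_mult Suc one_minus_Q_power(2)) simp
  then show ?case by (simp add: qp_Suc)
qed simp

lemma vge_inverse_qm: "vge (inverse (qm n)) 0"
proof (induction n)
  case (Suc n)
  have "vge (inverse (qm n) * inverse (1 + Q ^ Suc n)) (0 + 0)"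
    by (intro vge_mult Suc one_plus_Q_power(2))
  then show ?case by (simp add: qm_Suc)
qed simp

lemma vge_qp: "vge (qp n) 0"
proof (induction n)
  case (Suc n)
  have "vge (qp n * (1 - Q ^ Suc n)) (0 + 0)"
    by (intro vge_mult Suc vge_diff vge_mono[OF vge_Q_power]) auto
  then show ?case by (simp add: qp_Suc)
qed simp

text \<open>Every further factor changes the product by a multiple of Q^(b+1): this is the speed at
  which (Q; Q)_n converges.\<close>

lemma vge_qp_diff: "vge (qp (b + k) - qp b) (int b + 1)"
proof (induction k)
  case (Suc k)
  have "vge (qp (b + k) * Q ^ Suc (b + k)) (0 + int (Suc (b + k)))"
    by (intro vge_mult vge_qp vge_Q_power)
  then have "vge (qp (b + k) * Q ^ Suc (b + k)) (int b + 1)"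
    by (rule vge_mono) simp
  then have "vge ((qp (b + k) - qp b) - qp (b + k) * Q ^ Suc (b + k)) (int b + 1)"
    by (intro vge_diff Suc)
  then show ?case by (simp add: qp_Suc algebra_simps)
qed simp

text \<open>Bailey's kernel at a = 1, extended from k >= 0 to all integers so that the symmetry
  under k -> -k can be exploited.\<close>

definition bc :: "nat \<Rightarrow> int \<Rightarrow> 'a fls" where
  "bc n k = (if \<bar>k\<bar> \<le> int n then inverse (qp (nat (int n - k)) * qp (nat (int n + k))) else 0)"

text \<open>The kernel \<open>bc\<close> with one factor less on one side. It is symmetric about k =
  -1/2, and this shifted symmetry is what makes the antisymmetric sums below vanish.\<close>

definition bd :: "nat \<Rightarrow> int \<Rightarrow> 'a fls" where
  "bd n k = (if - int n \<le> k \<and> k < int n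
     then inverse (qp (nat (int n - k - 1)) * qp (nat (int n + k))) else 0)"

lemma bc_minus [simp]: "bc n (- k) = bc n k"
  by (simp add: bc_def mult.commute)

lemma bd_reflect: "bd n (-1 - k) = bd n k"
  by (auto simp: bd_def mult.commute algebra_simps)

lemma qp_nat_step:
  assumes "k > 0"
  shows "qp (nat k) = qp (nat (k - 1)) * (1 - Q powi k)"
proof -
  have "nat k = Suc (nat (k - 1))" using assms by simp
  then show ?thesis using assms qp_Suc[of "nat (k-1)"] by (simp add: power_int_def)
qed

lemma bc_eq_bd:
  assumes "\<bar>k\<bar> \<le> int n"
  shows "(1 - Q powi (int n - k)) * bc n k = bd n k"
proof (cases "k = int n")
  case False
  then have "0 < int n - k" using assms by simp
  moreover have "- int n \<le> k" using assms by simp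
  ultimately show ?thesis
    using mult_inverse_cancel[OF qp_nat_step qp_nonzero, of "int n - k"] assms
    by (simp add: bc_def bd_def)
qed (simp add: bd_def)

lemma bc_eq_bd':
  assumes "\<bar>k\<bar> \<le> int n"
  shows "(1 - Q powi (int n + k)) * bc n k = bd n (k - 1)"
  using bc_eq_bd[of "- k" n] bd_reflect[of n "k - 1"] assms by (simp add: algebra_simps)

text \<open>Passing from n + 1 to n strips the last factor from each of the two Pochhammer products.
  At k = n + 1 and k = -(n + 1) one factor on the left is 0, in accordance with the default 0 of
  \<open>bc n k\<close>.\<close>

lemma bc_step:
  assumes "\<bar>k\<bar> \<le> int (Suc n)"
  shows "(1 - Q powi (int (Suc n) - k)) * (1 - Q powi (int (Suc n) + k)) * bc (Suc n) k = bc n k"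
proof -
  have "(1 - Q powi (int (Suc n) - k)) * bd (Suc n) (k - 1) = bc n k"
  proof (cases "- int n \<le> k \<and> k \<le> int n")
    case True
    then have "0 < int (Suc n) - k" by simp
    moreover have "bd (Suc n) (k - 1) = inverse (qp (nat (int (Suc n) - k)) * qp (nat (int n + k)))"
    proof -
      have "int (Suc n) - (k - 1) - 1 = int (Suc n) - k" "int (Suc n) + (k - 1) = int n + k"
        by simp_all
      moreover have "- int (Suc n) \<le> k - 1 \<and> k - 1 < int (Suc n)" using True by simp
      ultimately show ?thesis by (simp only: bd_def if_True simp_thms)
    qed
    moreover have "bc n k = inverse (qp (nat (int (Suc n) - k - 1)) * qp (nat (int n + k)))"
    proof -
      have "int (Suc n) - k - 1 = int n - k" by simp
      moreover have "\<bar>k\<bar> \<le> int n" using True by linarith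
      ultimately show ?thesis by (simp only: bc_def if_True)
    qed
    ultimately show ?thesis
      by (simp only: mult_inverse_cancel[OF qp_nat_step qp_nonzero])
  next
    case False
    with assms have "k = int (Suc n) \<or> k = - int (Suc n)" by auto
    then show ?thesis by (auto simp: bd_def bc_def)
  qed
  then show ?thesis unfolding mult.assoc bc_eq_bd'[OF assms] .
qed

lemma sum_bc_step:
  "(\<Sum>k=-int (Suc n)..int (Suc n). \<alpha> k * ((1 - Q powi (int (Suc n) - k)) * (1 - Q powi (int (Suc n) + k)) * bc (Suc n) k))
    = (\<Sum>k=-int n..int n. \<alpha> k * bc n k)"
proof -
  have "(\<Sum>k=-int (Suc n)..int (Suc n). \<alpha> k * ((1 - Q powi (int (Suc n) - k)) * (1 - Q powi (int (Suc n) + k)) * bc (Suc n) k))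
    = (\<Sum>k=-int (Suc n)..int (Suc n). \<alpha> k * bc n k)"
    by (intro sum.cong refl arg_cong2[of _ _ _ _ "(*)"] bc_step) auto
  also have "\<dots> = (\<Sum>k=-int n..int n. \<alpha> k * bc n k)"
    by (rule sum.mono_neutral_right) (auto simp: bc_def)
  finally show ?thesis .
qed

section \<open>Three Bailey pairs relative to a = 1\<close>

definition ue :: "int \<Rightarrow> 'a fls" where
  "ue k = (-1) powi k * Q powi (k * (k - 1) div 2)"

text \<open>Two-sided form: since k and -k contribute equally, the usual one-sided sequence is
  \<open>bpair 0 = 1\<close> followed by \<open>2 * bpair k\<close> for k > 0.\<close>

definition bpair :: "int \<Rightarrow> 'a fls" where
  "bpair k = 2 * (-1) powi k * Q powi (k * (k + 1) div 2) / (1 + Q powi k)"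

definition theta_term :: "int \<Rightarrow> 'a fls" where
  "theta_term k = (-1) powi k * Q powi (k\<^sup>2)"

lemma tri_shift: "k * (k - 1) div 2 + k = k * (k + 1) div (2::int)"
proof -
  have "k * (k + 1) = k * (k - 1) + k * 2" by (simp add: algebra_simps)
  then show ?thesis by simp
qed

lemma ue_shift: "ue k * Q powi k = - ue (k + 1)"
proof -
  have "Q powi (k * (k - 1) div 2) * Q powi k = Q powi (k * (k + 1) div 2)"
    using Q_nonzero tri_shift[of k] by (simp flip: power_int_add)
  then show ?thesis by (simp add: ue_def minus_one_powi_Suc mult_ac)
qed

lemma ue_minus: "ue (- k) = ue k * Q powi k"
proof -
  have "Q powi (k * (k - 1) div 2) * Q powi k = Q powi (k * (k + 1) div 2)"
    using Q_nonzero tri_shift[of k] by (simp flip: power_int_add)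
  moreover have "- k * (- k - 1) = k * (k + 1)" by (simp add: algebra_simps)
  ultimately show ?thesis by (simp add: ue_def minus_one_powi_minus mult.assoc)
qed

text \<open>Multiplication by 1 - Q^(2n) = (1 - Q^(n+k)) + Q^(n+k) (1 - Q^(n-k)) trades
  \<open>bc\<close> for \<open>bd\<close>. Both resulting sums equal that of
  \<open>ue (k + 1) * bd n k\<close>, which the reflection k -> -1 - k negates; for n > 0 the factor
  1 - Q^(2n) can be cancelled.\<close>

lemma unit_bailey_pair: "(\<Sum>k=-int n..int n. ue k * bc n k) = (if n = 0 then 1 else 0)"
proof (cases "n = 0")
  case False
  let ?I = "{-int n..int n}" and ?N = "int n"
  have split: "(1 - Q powi (2 * ?N)) * (ue k * bc n k)
      = ue k * bd n (k - 1) - Q powi ?N * (ue (k + 1) * bd n k)" if "k \<in> ?I" for k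
  proof -
    have "Q powi (2 * ?N) = Q powi (?N + k) * Q powi (?N - k)"
      using Q_nonzero by (simp flip: power_int_add)
    then have "(1 - Q powi (2 * ?N)) * (ue k * bc n k)
      = ue k * ((1 - Q powi (?N + k)) * bc n k) + ue k * Q powi (?N + k) * ((1 - Q powi (?N - k)) * bc n k)"
      by (simp add: algebra_simps)
    also have "\<dots> = ue k * bd n (k - 1) + (ue k * Q powi k) * Q powi ?N * bd n k"
    proof -
      have k: "\<bar>k\<bar> \<le> ?N" using that by auto
      have "Q powi (?N + k) = Q powi k * Q powi ?N"
        using Q_nonzero by (subst power_int_add[symmetric]) (auto simp: add.commute)
      then show ?thesis unfolding bc_eq_bd[OF k] bc_eq_bd'[OF k] by (simp only: mult_ac)
    qed
    also have "\<dots> = ue k * bd n (k - 1) - Q powi ?N * (ue (k + 1) * bd n k)"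
      unfolding ue_shift by (simp only: mult_ac mult_minus_left mult_minus_right diff_conv_add_uminus)
    finally show ?thesis .
  qed
  have "(1 - Q powi (2 * ?N)) * (\<Sum>k\<in>?I. ue k * bc n k)
      = (\<Sum>k\<in>?I. ue k * bd n (k - 1)) - Q powi ?N * (\<Sum>k\<in>?I. ue (k + 1) * bd n k)"
    unfolding sum_distrib_left sum_subtractf[symmetric] by (intro sum.cong refl split)
  moreover have "(\<Sum>k\<in>?I. ue k * bd n (k - 1)) = (\<Sum>k=-int n..int n - 1. ue (k + 1) * bd n k)"
  proof -
    have "(\<Sum>k\<in>?I. ue k * bd n (k - 1)) = (\<Sum>k=-int n + 1..int n. ue k * bd n (k - 1))"
      by (rule sum.mono_neutral_right) (auto simp: bd_def)
    also have "\<dots> = (\<Sum>k=-int n..int n - 1. ue (k + 1) * bd n k)"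
      by (rule sum.reindex_bij_witness[of _ "\<lambda>k. k + 1" "\<lambda>k. k - 1"]) auto
    finally show ?thesis .
  qed
  moreover have "(\<Sum>k\<in>?I. ue (k + 1) * bd n k) = (\<Sum>k=-int n..int n - 1. ue (k + 1) * bd n k)"
    by (rule sum.mono_neutral_right) (auto simp: bd_def)
  moreover have "(\<Sum>k=-int n..int n - 1. ue (k + 1) * bd n k) = 0"
  proof (rule sum_antisym_zero)
    fix k
    show "ue (- 1 - k + 1) * bd n (- 1 - k) = - (ue (k + 1) * bd n k)"
      using ue_minus[of k] ue_shift[of k] by (simp add: bd_reflect)
  qed
  ultimately have "(1 - Q powi (2 * ?N)) * (\<Sum>k\<in>?I. ue k * bc n k) = 0" by simp
  moreover have "Q powi (2 * ?N) = Q ^ (2 * n)"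
    by (simp add: power_int_def nat_mult_distrib)
  ultimately show ?thesis
    using one_minus_Q_power(1)[of "2 * n"] False by simp
qed (simp add: ue_def bc_def)

text \<open>Put N = Q^(n+1) and A = Q^k. In the recurrence from n to n + 1 the factor (1 + N)^2 - (1
  - N/A) (1 - N A) = N (1 + A)^2 / A cancels the denominator of \<open>bpair\<close> and leaves two
  copies of the unit pair at n + 1, which sum to 0.\<close>

lemma bpair_sum: "(\<Sum>k=-int n..int n. bpair k * bc n k) * (qm n)\<^sup>2 = 1"
proof (induction n)
  case 0
  then show ?case by (simp add: bpair_def bc_def)
next
  case (Suc n)
  let ?I = "{-int (Suc n)..int (Suc n)}" and ?N = "int (Suc n)"
  have key: "(1 + Q ^ Suc n)\<^sup>2 * (bpair k * bc (Suc n) k)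
      - bpair k * ((1 - Q powi (?N - k)) * (1 - Q powi (?N + k)) * bc (Suc n) k)
      = 2 * Q ^ Suc n * (ue k * bc (Suc n) k + ue (- k) * bc (Suc n) (- k))" for k
  proof -
    define A where "A = Q powi k"
    define N where "N = Q powi ?N"
    have A0: "A \<noteq> 0" "1 + A \<noteq> 0" using Q_nonzero one_plus_Q_powi by (simp_all add: A_def)
    have NQ: "N = Q ^ Suc n" unfolding N_def by (rule power_int_of_nat)
    have b: "bpair k = 2 * (ue k * A) / (1 + A)"
    proof -
      have "ue k * A = (-1) powi k * Q powi (k * (k + 1) div 2)"
        using Q_nonzero tri_shift[of k] by (simp add: ue_def A_def mult.assoc flip: power_int_add)
      then show ?thesis by (simp add: bpair_def A_def mult.assoc)
    qed
    have e: "Q powi (?N - k) = N / A" "Q powi (?N + k) = N * A"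
      using Q_nonzero
      by (simp_all add: A_def N_def power_int_diff power_int_add del: power_int_of_nat of_nat_Suc)
    have "(1 + N)\<^sup>2 - (1 - N / A) * (1 - N * A) = N * (1 + A)\<^sup>2 / A"
      using A0 by (simp add: field_simps power2_eq_square)
    moreover have "(1 + N)\<^sup>2 * (bpair k * bc (Suc n) k)
      - bpair k * ((1 - N / A) * (1 - N * A) * bc (Suc n) k) =
      bpair k * bc (Suc n) k * ((1 + N)\<^sup>2 - (1 - N / A) * (1 - N * A))"
      by (simp add: algebra_simps)
    ultimately have "(1 + N)\<^sup>2 * (bpair k * bc (Suc n) k)
      - bpair k * ((1 - N / A) * (1 - N * A) * bc (Suc n) k) =
      2 * (ue k * A) / (1 + A) * bc (Suc n) k * (N * (1 + A)\<^sup>2 / A)"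
      by (simp add: b)
    also have "\<dots> = 2 * N * (ue k * bc (Suc n) k * (1 + A))"
    proof -
      have "2 * (x * A) / D * y * (N * D\<^sup>2 / A) = 2 * N * (x * y * D)"
        if "D \<noteq> 0" for x y D
        using that A0 by (simp add: field_simps power2_eq_square)
      from this[OF A0(2)] show ?thesis .
    qed
    also have "\<dots> = 2 * N * (ue k * bc (Suc n) k + (ue k * A) * bc (Suc n) k)"
      by (simp add: algebra_simps)
    finally show ?thesis
      by (simp only: NQ e ue_minus bc_minus A_def)
  qed
  have "(1 + Q ^ Suc n)\<^sup>2 * (\<Sum>k\<in>?I. bpair k * bc (Suc n) k) - (\<Sum>k=-int n..int n. bpair k * bc n k)
      = 2 * Q ^ Suc n * ((\<Sum>k\<in>?I. ue k * bc (Suc n) k) + (\<Sum>k\<in>?I. ue (- k) * bc (Suc n) (- k)))"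
    unfolding sum_bc_step[where \<alpha> = bpair and n = n, symmetric] sum_distrib_left sum_subtractf[symmetric] sum.distrib[symmetric]
    by (intro sum.cong refl key)
  also have "\<dots> = 0"
    unfolding sum_int_sym[of "\<lambda>k. ue k * bc (Suc n) k"] unit_bailey_pair by simp
  finally show ?case
    using Suc by (simp add: qm_Suc power_mult_distrib mult_ac)
qed

text \<open>The defect of the recurrence is a sum over \<open>h k + h (- k)\<close>. It vanishes
  because h changes sign under k -> -1 - k: the exponent k^2 + k is invariant and (-1)^k
  flips.\<close>

lemma theta_pair_sum: "(\<Sum>k=-int n..int n. theta_term k * bc n k) * (qp n * qm n) = 1"
proof (induction n)
  case 0
  then show ?case by (simp add: theta_term_def bc_def)
next
  case (Suc n)
  let ?I = "{-int (Suc n)..int (Suc n)}" and ?N = "int (Suc n)"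
  define h where "h k = theta_term k * Q powi k * bd (Suc n) k" for k
  have key: "(1 - (Q ^ Suc n)\<^sup>2) * (theta_term k * bc (Suc n) k)
      - theta_term k * ((1 - Q powi (?N - k)) * (1 - Q powi (?N + k)) * bc (Suc n) k)
      = Q ^ Suc n * (h k + h (- k))" if "k \<in> ?I" for k
  proof -
    define A where "A = Q powi k"
    define N where "N = Q powi ?N"
    have A0: "A \<noteq> 0" using Q_nonzero by (simp_all add: A_def)
    have NQ: "N = Q ^ Suc n" unfolding N_def by (rule power_int_of_nat)
    have e: "Q powi (?N - k) = N / A" "Q powi (?N + k) = N * A" "Q powi (- k) = 1 / A"
      using Q_nonzero
      by (simp_all add: A_def N_def power_int_diff power_int_add power_int_minus_divide
          del: power_int_of_nat of_nat_Suc)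
    have h1: "h k = theta_term k * A * ((1 - N / A) * bc (Suc n) k)"
    proof -
      have "\<bar>k\<bar> \<le> ?N" using that by auto
      from bc_eq_bd[OF this] show ?thesis
        by (simp only: h_def A_def[symmetric] flip: e)
    qed
    have "h (- k) = theta_term (- k) * Q powi (- k) * ((1 - Q powi (?N - - k)) * bc (Suc n) (- k))"
    proof -
      have "\<bar>- k\<bar> \<le> ?N" using that by auto
      from bc_eq_bd[OF this] show ?thesis by (simp only: h_def)
    qed
    also have "\<dots> = theta_term k / A * ((1 - N * A) * bc (Suc n) k)"
      by (simp add: e theta_term_def minus_one_powi_minus del: of_nat_Suc)
    finally have h2: "h (- k) = theta_term k / A * ((1 - N * A) * bc (Suc n) k)" .
    have "(1 - N\<^sup>2) * (theta_term k * bc (Suc n) k)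
      - theta_term k * ((1 - N / A) * (1 - N * A) * bc (Suc n) k) = N * (h k + h (- k))"
      unfolding h1 h2 using A0 by (simp add: field_simps power2_eq_square)
    then show ?thesis by (simp only: NQ e)
  qed
  have "(1 - (Q ^ Suc n)\<^sup>2) * (\<Sum>k\<in>?I. theta_term k * bc (Suc n) k) - (\<Sum>k=-int n..int n. theta_term k * bc n k)
      = Q ^ Suc n * ((\<Sum>k\<in>?I. h k) + (\<Sum>k\<in>?I. h (- k)))"
    unfolding sum_bc_step[where \<alpha> = theta_term and n = n, symmetric] sum_distrib_left sum_subtractf[symmetric] sum.distrib[symmetric]
    by (intro sum.cong refl key)
  also have "\<dots> = 0"
  proof -
    have "(\<Sum>k\<in>?I. h k) = (\<Sum>k=-?N..?N - 1. h k)"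
      by (rule sum.mono_neutral_right) (auto simp: h_def bd_def)
    also have "\<dots> = 0"
    proof (rule sum_antisym_zero)
      fix k :: int
      have "(-1 - k)\<^sup>2 + (-1 - k) = k\<^sup>2 + k" by (simp add: power2_eq_square algebra_simps)
      then have "Q powi ((-1 - k)\<^sup>2) * Q powi (-1 - k) = Q powi (k\<^sup>2) * Q powi k"
        by (simp only: Q_powi_add[symmetric])
      moreover have "(-1 :: 'a fls) powi (-1 - k) = - ((-1) powi k)"
        using minus_one_powi_minus[of "k + 1", where ?'a = "'a fls"]
          minus_one_powi_Suc[of k, where ?'a = "'a fls"] by (simp add: algebra_simps)
      ultimately show "h (-1 - k) = - h k"
        by (simp add: h_def theta_term_def bd_reflect mult.assoc)
    qed
    finally show ?thesis unfolding sum_int_sym[of h] by simp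
  qed
  finally have "(1 - (Q ^ Suc n)\<^sup>2) * (\<Sum>k\<in>?I. theta_term k * bc (Suc n) k)
      = (\<Sum>k=-int n..int n. theta_term k * bc n k)" by simp
  moreover have "qp (Suc n) * qm (Suc n) = qp n * qm n * (1 - (Q ^ Suc n)\<^sup>2)"
    by (simp add: qp_Suc qm_Suc algebra_simps power2_eq_square)
  ultimately show ?case using Suc by (simp add: mult_ac)
qed

end

section \<open>Limits of Bailey pairs\<close>

context nome
begin

lemma one_plus_Q_powi_pos: "k \<ge> 0 \<Longrightarrow> vge (inverse (1 + Q powi k)) 0"
  using one_plus_Q_power(2)[of "nat k"] by (simp add: power_int_def)

lemma one_plus_Q_powi_neg: "inverse (1 + Q powi (- k)) = Q powi k * inverse (1 + Q powi k)"
proof -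
  have "(1 + Q powi (- k)) * (Q powi k) = 1 + Q powi k"
    using Q_nonzero by (simp add: power_int_minus algebra_simps)
  then show ?thesis
    using one_plus_Q_powi[of k] one_plus_Q_powi[of "- k"] Q_nonzero by (simp add: field_simps)
qed

lemma int_le_tri: "k \<ge> 0 \<Longrightarrow> k \<le> k * (k + 1) div (2::int)"
proof -
  assume "k \<ge> 0"
  then have "k * 2 \<le> k * (k + 1)"
    by (cases "k = 0") (auto intro!: mult_left_mono)
  then show ?thesis using zdiv_mono1[of "k * 2" "k * (k + 1)" 2] by simp
qed

lemma bpair_minus: "bpair (- k) = bpair k"
proof -
  have "- k * (- k + 1) = k * (k - 1)" by (simp add: algebra_simps)
  then have "bpair (- k) = 2 * (-1) powi k * (Q powi (k * (k - 1) div 2) * Q powi k) * inverse (1 + Q powi k)"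
    unfolding bpair_def divide_inverse one_plus_Q_powi_neg minus_one_powi_minus by (simp add: mult_ac)
  then show ?thesis
    unfolding Q_powi_add[symmetric] tri_shift by (simp add: bpair_def divide_inverse)
qed

lemma vge_bpair: "vge (bpair k) \<bar>k\<bar>"
proof -
  have pos: "vge (bpair k) k" if "k \<ge> 0" for k
  proof -
    have "vge (2 * (-1) powi k * (Q powi (k * (k + 1) div 2)) * inverse (1 + Q powi k))
       (0 + 0 + k + 0)"
      by (intro vge_mult vge_numeral vge_minus_one_powi one_plus_Q_powi_pos
          vge_mono[OF vge_Q_powi] int_le_tri) (use that int_le_tri[OF that] in auto)
    then show ?thesis by (simp add: bpair_def divide_inverse)
  qed
  show ?thesis
    using pos[of k] pos[of "- k"] by (cases "k \<ge> 0") (auto simp: bpair_minus)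
qed

lemma abs_le_square_int: "\<bar>k\<bar> \<le> (k::int)\<^sup>2"
  by (metis abs_ge_zero abs_mult_self_eq abs_zero linorder_not_le mult_le_cancel_left1
      nle_le power2_eq_square zero_less_abs_iff zless_add1_eq add_0 zle_add1_eq_le)

lemma vge_theta_term: "vge (theta_term k) (k\<^sup>2)"
proof -
  have "vge ((-1) powi k * Q powi (k\<^sup>2)) (0 + k\<^sup>2)"
    by (intro vge_mult vge_minus_one_powi vge_Q_powi) auto
  then show ?thesis by (simp add: theta_term_def)
qed

lemma fsummable_abs:
  fixes f :: "int \<Rightarrow> 'a fls"
  assumes "\<And>k. vge (f k) \<bar>k\<bar>"
  shows "fsummable f UNIV"
proof (rule fsummableI[where e = abs])
  fix N :: int
  have "{i \<in> UNIV. \<bar>i\<bar> < N} \<subseteq> {-N..N}" by (auto simp: abs_less_iff)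
  then show "finite {i \<in> UNIV. \<bar>i\<bar> < N}" using finite_subset by blast
qed (use assms in auto)

lemma vge_bc: "vge (bc n k) 0"
proof -
  have "vge (inverse (qp a) * inverse (qp b)) (0 + 0)" for a b
    by (intro vge_mult vge_inverse_qp)
  then show ?thesis by (simp add: bc_def)
qed

text \<open>Of the two denominators the shorter product (Q; Q)_(n-|k|) converges more slowly and
  determines the error.\<close>

lemma vge_qp_bc:
  assumes "\<bar>k\<bar> \<le> int n"
  shows "vge ((qp n)\<^sup>2 * bc n k - 1) (int n - \<bar>k\<bar> + 1)"
proof -
  have *: "vge ((qp n)\<^sup>2 * bc n (int j) - 1) (int n - int j + 1)" if "j \<le> n" for j
  proof -
    let ?b = "qp (n - j)" and ?c = "qp (n + j)"
    have bc: "bc n (int j) = inverse ?b * inverse ?c"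
      using that by (simp add: bc_def nat_diff_distrib nat_add_distrib of_nat_diff flip: of_nat_add)
    have "qp n = qp (n - j + j)" using that by simp
    then have 1: "vge (qp n - ?b) (int n - int j + 1)"
      using vge_qp_diff[of "n - j" j] that by (simp add: of_nat_diff)
    have 2: "vge (?c - qp n) (int n - int j + 1)"
      using vge_mono[OF vge_qp_diff[of n j]] by simp
    have "(qp n)\<^sup>2 * bc n (int j) - 1
        = (qp n - ?b) * (qp n * inverse ?b * inverse ?c) - (?c - qp n) * inverse ?c"
      using qp_nonzero[of "n - j"] qp_nonzero[of "n + j"]
      by (simp add: bc field_simps power2_eq_square)
    moreover have "vge ((qp n - ?b) * (qp n * inverse ?b * inverse ?c)) ((int n - int j + 1) + (0 + 0 + 0))"
      by (intro vge_mult 1 vge_qp vge_inverse_qp)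
    moreover have "vge ((?c - qp n) * inverse ?c) ((int n - int j + 1) + 0)"
      by (intro vge_mult 2 vge_inverse_qp)
    ultimately show ?thesis by (simp add: vge_diff)
  qed
  show ?thesis
    using *[of "nat \<bar>k\<bar>"] assms by (cases "k \<ge> 0") auto
qed

text \<open>The decay |k| of \<alpha> makes up for the loss of |k| in \<open>vge_qp_bc\<close>, so
  the precision n + 1 is uniform in k; the terms with |k| > n are of that order by
  themselves.\<close>

lemma bailey_limit:
  assumes \<alpha>: "\<And>k. vge (\<alpha> k) \<bar>k\<bar>"
  shows "vge (fsum \<alpha> UNIV - (qp n)\<^sup>2 * (\<Sum>k=-int n..int n. \<alpha> k * bc n k)) (int n + 1)"
proof -
  let ?I = "{-int n..int n}"
  have "vge (fsum \<alpha> UNIV - sum \<alpha> ?I) (int n + 1)"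
    by (rule fsum_approx[OF fsummable_abs[OF \<alpha>]]) (auto intro: vge_mono[OF \<alpha>])
  moreover have "vge (\<Sum>k\<in>?I. \<alpha> k * ((qp n)\<^sup>2 * bc n k - 1)) (int n + 1)"
  proof (rule vge_sum)
    fix k assume "k \<in> ?I"
    then have "\<bar>k\<bar> \<le> int n" by auto
    from vge_mult[OF \<alpha>[of k] vge_qp_bc[OF this]]
    show "vge (\<alpha> k * ((qp n)\<^sup>2 * bc n k - 1)) (int n + 1)" by simp
  qed
  moreover have "fsum \<alpha> UNIV - (qp n)\<^sup>2 * (\<Sum>k\<in>?I. \<alpha> k * bc n k)
      = (fsum \<alpha> UNIV - sum \<alpha> ?I) - (\<Sum>k\<in>?I. \<alpha> k * ((qp n)\<^sup>2 * bc n k - 1))"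
    by (simp add: algebra_simps sum_subtractf sum_distrib_left)
  ultimately show ?thesis by (simp only: vge_diff)
qed

definition theta_Q :: "'a fls" where "theta_Q = fsum theta_term UNIV"

lemma vge_theta_term_abs: "vge (theta_term k) \<bar>k\<bar>"
  by (rule vge_mono[OF vge_theta_term abs_le_square_int])

lemmas fsummable_theta = fsummable_abs[OF vge_theta_term_abs]

lemma vge_theta_Q: "vge theta_Q 0"
  unfolding theta_Q_def
  by (rule fsum_vge[OF fsummable_theta]) (rule vge_mono[OF vge_theta_term], simp)

text \<open>Letting \<open>n\<close> tend to infinity in the two Bailey pairs gives a square on the right because
  the product side of the first is the square of that of the second.\<close>

lemma theta_Q_squared: "fsum bpair UNIV = theta_Q\<^sup>2"
proof -
  have "vge (fsum bpair UNIV - theta_Q\<^sup>2) N" for N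
  proof (rule vge_mono)
    define n where "n = nat N"
    define x where "x = qp n / qm n"
    have "(qp n)\<^sup>2 * (\<Sum>k=-int n..int n. bpair k * bc n k) = x\<^sup>2"
      using bpair_sum[of n] qm_nonzero[of n] by (simp add: x_def field_simps power2_eq_square)
    then have 1: "vge (fsum bpair UNIV - x\<^sup>2) (int n + 1)"
      using bailey_limit[OF vge_bpair, of n] by simp
    have "(qp n)\<^sup>2 * (\<Sum>k=-int n..int n. theta_term k * bc n k) = x"
      using theta_pair_sum[of n] qm_nonzero[of n] qp_nonzero[of n]
      by (simp add: x_def field_simps power2_eq_square)
    then have 2: "vge (theta_Q - x) (int n + 1)"
      using bailey_limit[OF vge_theta_term_abs, of n] by (simp add: theta_Q_def)
    have "vge (qp n * inverse (qm n)) (0 + 0)"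
      by (intro vge_mult vge_qp vge_inverse_qm)
    then have "vge (theta_Q + x) 0"
      by (simp add: vge_add vge_theta_Q x_def divide_inverse)
    from vge_mult[OF 2 this] have "vge (theta_Q\<^sup>2 - x\<^sup>2) (int n + 1)"
      by (simp add: algebra_simps power2_eq_square)
    from vge_diff[OF 1 this] show "vge (fsum bpair UNIV - theta_Q\<^sup>2) (int n + 1)"
      by simp
    show "N \<le> int n + 1" by (simp add: n_def)
  qed
  then have "fsum bpair UNIV - theta_Q\<^sup>2 = 0" by (rule vge_all_zero)
  then show ?thesis by simp
qed

end

section \<open>Conjugate Bailey sequences with a free parameter\<close>

locale nome2 = nome Q for Q :: "'a::field_char_0 fls" +
  fixes u :: "'a fls"
  assumes vge_u: "vge u 1"
begin

definition wq :: "nat \<Rightarrow> 'a fls" where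
  "wq n = (\<Prod>i<n. (1 + Q ^ i) * (u + Q ^ Suc i))"

definition ws :: "nat \<Rightarrow> 'a fls" where
  "ws n = (\<Prod>i<n. u + Q ^ Suc i)"

lemma vge_ws: "vge (ws n) (int n)"
proof (induction n)
  case (Suc n)
  have "vge (ws n * (u + Q ^ Suc n)) (int n + 1)"
    by (intro vge_mult Suc vge_add vge_u vge_mono[OF vge_Q_power]) auto
  then show ?case by (simp add: ws_def algebra_simps)
qed (simp add: ws_def)

lemma vge_wq: "vge (wq n) (int n)"
proof (induction n)
  case (Suc n)
  have "vge (wq n * ((1 + Q ^ n) * (u + Q ^ Suc n))) (int n + (0 + 1))"
    by (intro vge_mult Suc vge_add vge_u vge_mono[OF vge_Q_power]) auto
  then show ?case by (simp add: wq_def algebra_simps)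
qed (simp add: wq_def)

text \<open>The conjugate sequence in Bailey's transform for the weights \<open>wq\<close>; it is a
  q-Gauss sum.\<close>

definition bS :: "int \<Rightarrow> 'a fls" where
  "bS k = fsum (\<lambda>n. wq n * bc n k) UNIV"

lemma fsummable_wq:
  assumes "\<And>n. vge (g n) 0"
  shows "fsummable (\<lambda>n. wq n * g n) UNIV"
proof (rule fsummableI[where e = int])
  show "vge (wq n * g n) (int n)" for n
    using vge_mult[OF vge_wq[of n] assms[of n]] by simp
  fix N
  have "{i \<in> UNIV. int i < N} \<subseteq> {..nat N}" by auto
  then show "finite {i \<in> UNIV. int i < N}" using finite_subset by blast
qed

lemma bS_minus: "bS (- k) = bS k"
  by (simp add: bS_def)

text \<open>Creative telescoping in n: the combination of the two summands is
  \<open>G n - G (Suc n)\<close>, where G vanishes at 0 and tends to 0. Working with the ratio of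
  consecutive values avoids the infinite products that the q-Gauss sum would bring in.\<close>

lemma bS_recurrence:
  "(1 + Q ^ Suc k) * (1 + u * Q ^ k) * bS (int (Suc k)) = (1 + Q ^ k) * (u + Q ^ Suc k) * bS (int k)"
proof -
  define f where "f n = (if n \<le> k then 0 else inverse (qp (n - Suc k) * qp (n + k)))" for n
  define G where "G n = (1 - Q ^ Suc (2 * k)) * (wq n * f n)" for n
  define L where "L = (1 + Q ^ Suc k) * (1 + u * Q ^ k)"
  define M where "M = (1 + Q ^ k) * (u + Q ^ Suc k)"
  have tm: "L * (wq n * bc n (int (Suc k))) - M * (wq n * bc n (int k)) = G n - G (Suc n)" for n
  proof (cases "n \<ge> k")
    case False
    then show ?thesis by (simp add: G_def f_def bc_def)
  next
    case True
    define E where "E = f (Suc n)"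
    \<comment> \<open>With Z = Q^(n-k) and K = Q^k all terms become polynomials in Q, u, K, Z times
      \<open>wq n * E\<close>, and the telescoping claim becomes a ring identity.\<close>
    define Z where "Z = Q ^ (n - k)"
    define K where "K = Q ^ k"
    have pw: "Q ^ n = K * Z" "Q ^ (n + k) = K * K * Z"
      using True by (simp_all add: K_def Z_def add.commute flip: power_add)
    have pwS: "Q ^ Suc (n + k) = Q * (K * K * Z)" by (simp add: pw)
    have E: "E = inverse (qp (n - k) * qp (Suc (n + k)))"
      using True by (simp add: E_def f_def)
    have nz: "n - k > 0 \<Longrightarrow> 1 - Z \<noteq> 0" "1 - Q * (K * K * Z) \<noteq> 0"
      using one_minus_Q_power(1)[of "n - k"] one_minus_Q_power(1)[of "Suc (n + k)"] pw
      by (simp_all add: Z_def)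
    have c1: "bc n (int k) = (1 - Q * (K * K * Z)) * E"
    proof -
      have "bc n (int k) = inverse (qp (n - k) * qp (n + k))"
        using True by (simp add: bc_def nat_diff_distrib nat_add_distrib flip: of_nat_add of_nat_diff)
      then show ?thesis
        using mult_inverse_cancel[OF qp_Suc[of "n + k"] qp_nonzero, of "qp (n - k)"]
        by (simp only: E pwS mult.commute[of "qp (n - k)"])
    qed
    have c2: "bc n (int (Suc k)) = (1 - Z) * E"
    proof (cases "n = k")
      case True
      then show ?thesis by (simp add: bc_def Z_def)
    next
      case False
      then obtain d where d: "n - k = Suc d" using True by (metis Suc_diff_le le_neq_implies_less Suc_leI diff_Suc_Suc Suc_diff_Suc)
      have "bc n (int (Suc k)) = inverse (qp d * qp (Suc (n + k)))"
      proof -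
        have "nat (int n - int (Suc k)) = d" "nat (int n + int (Suc k)) = Suc (n + k)"
          "\<bar>int (Suc k)\<bar> \<le> int n" using d True by auto
        then show ?thesis by (simp only: bc_def if_True)
      qed
      then show ?thesis
        using mult_inverse_cancel[OF qp_Suc[of d] qp_nonzero, of "qp (Suc (n + k))"]
        by (simp only: E Z_def d)
    qed
    have f: "f n = (1 - Z) * (1 - Q * (K * K * Z)) * E"
    proof (cases "n = k")
      case True
      then show ?thesis by (simp add: f_def Z_def)
    next
      case False
      then obtain d where d: "n - k = Suc d" using True by (metis Suc_diff_le le_neq_implies_less Suc_leI diff_Suc_Suc Suc_diff_Suc)
      then have "f n = inverse (qp d * qp (n + k))"
        using True False by (simp add: f_def diff_Suc split: nat.splits)
      also have "\<dots> = (1 - Z) * bc n (int k)"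
      proof -
        have "bc n (int k) = inverse (qp (Suc d) * qp (n + k))"
          using True d by (simp add: bc_def nat_diff_distrib nat_add_distrib flip: of_nat_add of_nat_diff)
        then show ?thesis
          using mult_inverse_cancel[OF qp_Suc[of d] qp_nonzero, of "qp (n + k)"]
          by (simp only: Z_def d)
      qed
      finally show ?thesis by (simp only: c1 mult.assoc)
    qed
    have w: "wq (Suc n) = wq n * ((1 + K * Z) * (u + Q * (K * Z)))"
      by (simp add: wq_def pw)
    have K2: "Q ^ Suc (2 * k) = Q * (K * K)"
      by (simp add: K_def mult_2 power_add)
    show ?thesis
      unfolding G_def K2
      unfolding w c1 c2 f E_def[symmetric] L_def M_def power_Suc K_def[symmetric]
      by (simp add: algebra_simps)
  qed
  have vf: "vge (f n) 0" for n
  proof -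
    have "vge (inverse (qp a) * inverse (qp b)) (0 + 0)" for a b
      by (intro vge_mult vge_inverse_qp)
    then show ?thesis by (simp add: f_def)
  qed
  have vG: "vge (G n) (int n)" for n
  proof -
    have "vge ((1 - Q ^ Suc (2 * k)) * (wq n * f n)) (0 + (int n + 0))"
      by (intro vge_mult vge_diff vge_wq vf vge_mono[OF vge_Q_power]) auto
    then show ?thesis by (simp add: G_def)
  qed
  have "fsum (\<lambda>n. G n - G (Suc n)) {0..} = G 0 - 0"
  proof (rule fsum_telescope(2))
    fix N
    show "\<exists>M. \<forall>m\<ge>M. vge (G m - 0) N"
      by (rule exI[of _ "nat N"]) (auto intro: vge_mono[OF vG])
  qed
  also have "G 0 = 0" by (simp add: G_def f_def)
  finally have "fsum (\<lambda>n. L * (wq n * bc n (int (Suc k))) - M * (wq n * bc n (int k))) UNIV = 0"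
    by (simp only: tm atLeast_0 diff_zero)
  moreover have "fsum (\<lambda>n. L * (wq n * bc n (int (Suc k))) - M * (wq n * bc n (int k))) UNIV
      = L * bS (int (Suc k)) - M * bS (int k)"
    unfolding bS_def
    by (simp only: fsum_diff fsum_cmult fsummable_cmult fsummable_wq vge_bc)
  ultimately show ?thesis by (simp add: L_def M_def)
qed

text \<open>Exchange of the sums over k and n in the region |k| <= n: since \<open>wq n\<close> has
  order n, each order involves finitely many n and hence finitely many k.\<close>

lemma bailey_transform:
  assumes \<alpha>: "\<And>k. vge (\<alpha> k) 0"
  shows "fsummable (\<lambda>k. \<alpha> k * bS k) UNIV"
    and "fsum (\<lambda>k. \<alpha> k * bS k) UNIV = fsum (\<lambda>n. wq n * (\<Sum>k=-int n..int n. \<alpha> k * bc n k)) UNIV"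
proof -
  define h where "h k n = \<alpha> k * (wq n * bc n k)" for k n
  let ?D = "{(k, n). \<bar>k\<bar> \<le> int n}"
  have "fsummable (\<lambda>(k, n). h k n) ?D"
  proof (rule fsummableI[where e = "\<lambda>(k, n). int n"])
    fix p assume "p \<in> ?D"
    obtain k n where p: "p = (k, n)" by fastforce
    have "vge (\<alpha> k * (wq n * bc n k)) (0 + (int n + 0))"
      by (intro vge_mult \<alpha> vge_wq vge_bc)
    then show "vge (case p of (k, n) \<Rightarrow> h k n) (case p of (k, n) \<Rightarrow> int n)"
      by (simp add: p h_def)
  next
    fix N
    have "{p \<in> ?D. (case p of (k, n) \<Rightarrow> int n) < N} \<subseteq> {-N..N} \<times> {..nat N}" by auto
    then show "finite {p \<in> ?D. (case p of (k, n) \<Rightarrow> int n) < N}"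
      using finite_subset by blast
  qed
  moreover have "fsummable (\<lambda>(k, n). h k n) ?D \<longleftrightarrow> fsummable (\<lambda>(k, n). h k n) (UNIV \<times> UNIV)"
    by (rule fsummable_mono_neutral) (auto simp: h_def bc_def)
  ultimately have s: "fsummable (\<lambda>(k, n). h k n) (UNIV \<times> UNIV)" by simp
  have inner: "fsum (h k) UNIV = \<alpha> k * bS k" for k
    unfolding h_def bS_def by (intro fsum_cmult fsummable_wq vge_bc)
  have inner2: "fsum (\<lambda>k. h k n) UNIV = wq n * (\<Sum>k=-int n..int n. \<alpha> k * bc n k)" for n
  proof -
    have "fsum (\<lambda>k. h k n) {-int n..int n} = fsum (\<lambda>k. h k n) UNIV"
      by (rule fsum_mono_neutral) (auto simp: h_def bc_def)
    then show ?thesis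
      by (simp add: fsum_finite h_def sum_distrib_left mult_ac)
  qed
  show "fsummable (\<lambda>k. \<alpha> k * bS k) UNIV"
    using fsum_Sigma(2)[OF s] by (simp add: inner)
  show "fsum (\<lambda>k. \<alpha> k * bS k) UNIV = fsum (\<lambda>n. wq n * (\<Sum>k=-int n..int n. \<alpha> k * bc n k)) UNIV"
    using fsum_swap[OF s] by (simp only: inner inner2)
qed

lemma vge_ue: "vge (ue k) 0"
proof -
  have "0 \<le> k * (k - 1)" by (cases "k \<ge> 1") (auto simp: mult_nonneg_nonneg mult_nonpos_nonpos)
  then have "vge ((-1) powi k * Q powi (k * (k - 1) div 2)) (0 + 0)"
    by (intro vge_mult vge_minus_one_powi vge_mono[OF vge_Q_powi]) auto
  then show ?thesis by (simp add: ue_def)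
qed

lemma ue_bS_sum: "fsum (\<lambda>k. ue k * bS k) UNIV = 1"
proof -
  have "fsum (\<lambda>k. ue k * bS k) UNIV = fsum (\<lambda>n. wq n * (if n = 0 then 1 else 0)) UNIV"
    using bailey_transform(2)[OF vge_ue] by (simp only: unit_bailey_pair)
  also have "\<dots> = fsum (\<lambda>n. wq n * (if n = 0 then 1 else 0)) {0}"
    by (rule fsum_mono_neutral[symmetric]) auto
  finally show ?thesis by (simp add: fsum_finite wq_def)
qed

definition eulerian :: "'a fls" where
  "eulerian = fsum (\<lambda>n. wq n / (qm n)\<^sup>2) UNIV"

lemma bpair_bS_sum: "fsum (\<lambda>k. bpair k * bS k) UNIV = eulerian"
proof -
  have "(\<Sum>k=-int n..int n. bpair k * bc n k) = 1 / (qm n)\<^sup>2" for n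
    using bpair_sum[of n] qm_nonzero[of n] by (simp add: field_simps)
  then show ?thesis
    using bailey_transform(2)[of bpair] vge_mono[OF vge_bpair] by (simp add: eulerian_def)
qed

text \<open>If \<open>\<gamma>\<close> solves the recurrence of \<^const>\<open>bS\<close> with \<open>\<gamma> 0 = 1\<close>, then \<open>bS k = \<gamma> k * bS 0\<close>, and
  the unit Bailey pair identifies \<open>bS 0\<close> as the inverse of a theta series.\<close>

lemma eulerian_times:
  assumes \<gamma>: "\<And>k. bS k = \<gamma> k * bS 0" and v: "\<And>k. vge (\<gamma> k) 0"
    and s: "fsummable (\<lambda>k. ue k * \<gamma> k) UNIV" "fsummable (\<lambda>k. bpair k * \<gamma> k) UNIV"
  shows "fsum (\<lambda>k. ue k * \<gamma> k) UNIV * eulerian = fsum (\<lambda>k. bpair k * \<gamma> k) UNIV"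
proof -
  have 1: "bS 0 * fsum (\<lambda>k. ue k * \<gamma> k) UNIV = 1"
  proof -
    have "bS 0 * fsum (\<lambda>k. ue k * \<gamma> k) UNIV = fsum (\<lambda>k. ue k * bS k) UNIV"
      unfolding fsum_cmult[OF s(1), symmetric] by (rule fsum_cong) (subst \<gamma>, simp only: mult_ac)
    then show ?thesis by (simp only: ue_bS_sum)
  qed
  have "bS 0 * fsum (\<lambda>k. bpair k * \<gamma> k) UNIV = eulerian"
  proof -
    have "bS 0 * fsum (\<lambda>k. bpair k * \<gamma> k) UNIV = fsum (\<lambda>k. bpair k * bS k) UNIV"
      unfolding fsum_cmult[OF s(2), symmetric] by (rule fsum_cong) (subst \<gamma>, simp only: mult_ac)
    then show ?thesis by (simp only: bpair_bS_sum)
  qed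
  then have "fsum (\<lambda>k. ue k * \<gamma> k) UNIV * eulerian
      = bS 0 * fsum (\<lambda>k. ue k * \<gamma> k) UNIV * fsum (\<lambda>k. bpair k * \<gamma> k) UNIV"
    by (simp add: mult_ac)
  then show ?thesis using 1 by simp
qed

end

section \<open>Geometric series, products and symmetrization\<close>

lemma fsum_nat_Suc:
  fixes f :: "nat \<Rightarrow> 'a::field fls"
  assumes "fsummable f UNIV"
  shows "fsummable (\<lambda>n. f (Suc n)) UNIV" "fsum f UNIV = f 0 + fsum (\<lambda>n. f (Suc n)) UNIV"
proof -
  have bij: "bij_betw Suc UNIV {1..}"
    by (rule bij_betwI[where g = "\<lambda>n. n - 1"]) auto
  have U: "(UNIV :: nat set) = {0} \<union> {1..}" by auto
  have s: "fsummable f B" for B using fsummable_subset[OF assms] by auto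
  show "fsummable (\<lambda>n. f (Suc n)) UNIV"
    using fsummable_reindex[OF bij, of f] s by simp
  have "fsum f ({0} \<union> {1..}) = f 0 + fsum f {1..}"
    by (subst fsum_Un[OF s s]) (auto simp: fsum_finite)
  then show "fsum f UNIV = f 0 + fsum (\<lambda>n. f (Suc n)) UNIV"
    using fsum_reindex[OF bij, of f] U by simp
qed

lemma fsummable_nat:
  fixes f :: "nat \<Rightarrow> 'a::field fls"
  assumes "\<And>n. n \<in> A \<Longrightarrow> vge (f n) (int n)"
  shows "fsummable f A"
proof (rule fsummableI[where e = int])
  fix N
  have "{i \<in> A. int i < N} \<subseteq> {..nat N}" by auto
  then show "finite {i \<in> A. int i < N}" using finite_subset by blast
qed (use assms in auto)

lemma fsummable_nat_pair:
  fixes f :: "nat \<Rightarrow> nat \<Rightarrow> 'a::field fls"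
  assumes "\<And>m n. m \<in> A \<Longrightarrow> n \<in> B \<Longrightarrow> vge (f m n) (int (m + n))"
  shows "fsummable (\<lambda>(m, n). f m n) (A \<times> B)"
proof (rule fsummableI[where e = "\<lambda>(m, n). int (m + n)"])
  fix N
  have "{p \<in> A \<times> B. (case p of (m, n) \<Rightarrow> int (m + n)) < N} \<subseteq> {..nat N} \<times> {..nat N}" by auto
  then show "finite {p \<in> A \<times> B. (case p of (m, n) \<Rightarrow> int (m + n)) < N}"
    using finite_subset by blast
qed (use assms in auto)

lemma fsum_geometric_telescope:
  fixes x :: "'a::field fls"
  assumes x: "vge x 1" and g: "\<And>j. vge (g j) B"
  shows "fsummable (\<lambda>j. x ^ j * g j - x ^ Suc j * g (Suc j)) UNIV"
    and "fsum (\<lambda>j. x ^ j * g j - x ^ Suc j * g (Suc j)) UNIV = g 0"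
proof -
  have lim: "\<exists>M. \<forall>m\<ge>M. vge (x ^ m * g m - 0) N" for N
  proof (intro exI[of _ "nat (N - B)"] allI impI)
    fix m assume "nat (N - B) \<le> m"
    have "vge (x ^ m * g m) (int m * 1 + B)"
      by (intro vge_mult vge_power x g)
    then show "vge (x ^ m * g m - 0) N"
      using \<open>nat (N - B) \<le> m\<close> by (auto elim!: vge_mono)
  qed
  show "fsummable (\<lambda>j. x ^ j * g j - x ^ Suc j * g (Suc j)) UNIV"
    "fsum (\<lambda>j. x ^ j * g j - x ^ Suc j * g (Suc j)) UNIV = g 0"
    using fsum_telescope[OF lim, of 0] by (simp_all only: atLeast_0 power_0 mult_1 diff_zero)
qed

lemma fsum_geometric:
  fixes x :: "'a::field fls"
  assumes x: "vge x 1"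
  shows "fsummable (\<lambda>j. c * x ^ j) UNIV" "fsum (\<lambda>j. c * x ^ j) UNIV = c / (1 - x)"
proof -
  have nz: "1 - x \<noteq> 0" using vge_inverse_one_plus(1)[of "- x"] x by simp
  obtain B where B: "vge (c / (1 - x)) B" using vge_exists by blast
  have "x ^ j * (c / (1 - x)) - x ^ Suc j * (c / (1 - x)) = c * x ^ j" for j
    using nz by (simp add: divide_simps) (simp add: algebra_simps)
  then show "fsummable (\<lambda>j. c * x ^ j) UNIV" "fsum (\<lambda>j. c * x ^ j) UNIV = c / (1 - x)"
    using fsum_geometric_telescope[OF x, of "\<lambda>j. c / (1 - x)", OF B] by simp_all
qed

lemma fsum_arith_geometric:
  fixes x :: "'a::field_char_0 fls"
  assumes x: "vge x 1"
  shows "fsummable (\<lambda>j. c * of_nat (a * j + b) * x ^ j) UNIV"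
    "fsum (\<lambda>j. c * of_nat (a * j + b) * x ^ j) UNIV
       = c * (of_nat b * (1 - x) + of_nat a * x) / (1 - x)\<^sup>2"
proof -
  define D where "D = 1 - x"
  have nz: "D \<noteq> 0" using vge_inverse_one_plus(1)[of "- x"] x by (simp add: D_def)
  have vD: "vge (inverse D) 0" using vge_inverse_one_plus(2)[of "- x"] x by (simp add: D_def)
  \<comment> \<open>\<open>x ^ j * g j\<close> is the closed form of the tail of the series from
    index j on.\<close>
  define g where "g j = c * (of_nat (a * j + b) * D + of_nat a * x) * (inverse D * inverse D)" for j
  obtain B where B: "vge c B" using vge_exists by blast
  have vx: "vge x 0" using x by (rule vge_mono) simp
  have vg: "vge (g j) (B + (0 + 0) + (0 + 0))" for j
    unfolding g_def by (intro vge_mult vge_add vge_of_nat vD B)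
      (auto simp: D_def intro!: vge_mult'[of _ 0 _ 0] vge_of_nat vge_diff vx)
  note tele = fsum_geometric_telescope[OF x, of g, OF vg]
  have "x ^ j * g j - x ^ Suc j * g (Suc j) = c * of_nat (a * j + b) * x ^ j" for j
  proof -
    have x: "x = 1 - D" by (simp add: D_def)
    have "g j - x * g (Suc j) = c * of_nat (a * j + b) * (D * inverse D) * (D * inverse D)"
      unfolding g_def x by (simp add: algebra_simps del: right_inverse left_inverse)
    also have "\<dots> = c * of_nat (a * j + b)" using nz by simp
    finally have "g j - x * g (Suc j) = c * of_nat (a * j + b)" .
    then have "x ^ j * (g j - x * g (Suc j)) = c * of_nat (a * j + b) * x ^ j" by simp
    then show ?thesis by (simp add: algebra_simps)
  qed
  moreover have "g 0 = c * (of_nat b * (1 - x) + of_nat a * x) / (1 - x)\<^sup>2"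
    by (simp add: g_def D_def divide_inverse power2_eq_square)
  ultimately show "fsummable (\<lambda>j. c * of_nat (a * j + b) * x ^ j) UNIV"
    "fsum (\<lambda>j. c * of_nat (a * j + b) * x ^ j) UNIV
       = c * (of_nat b * (1 - x) + of_nat a * x) / (1 - x)\<^sup>2"
    using tele by (simp_all only:)
qed

text \<open>With uniform lower bounds b and c for the two families, a product of order below N
  forces f i below N - c and g j below N - b.\<close>

lemma fsum_product:
  fixes f :: "'i \<Rightarrow> 'a::field fls" and g :: "'j \<Rightarrow> 'a fls"
  assumes f: "fsummable f A" and g: "fsummable g B"
  shows "fsummable (\<lambda>(i, j). f i * g j) (A \<times> B)"
    and "fsum (\<lambda>(i, j). f i * g j) (A \<times> B) = fsum f A * fsum g B"
proof -
  obtain b where b: "\<forall>i\<in>A. vge (f i) b" using fsummable_uniform_bound[OF f] by blast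
  obtain c where c: "\<forall>j\<in>B. vge (g j) c" using fsummable_uniform_bound[OF g] by blast
  show s: "fsummable (\<lambda>(i, j). f i * g j) (A \<times> B)"
    unfolding fsummable_def
  proof
    fix N
    have "vge (f i * g j) N" if "i \<in> A" "j \<in> B" "vge (f i) (N - c) \<or> vge (g j) (N - b)" for i j
      using that(3)
    proof
      assume "vge (f i) (N - c)"
      from vge_mult[OF this, of "g j" c] c that show ?thesis by simp
    next
      assume "vge (g j) (N - b)"
      from vge_mult[OF _ this, of "f i" b] b that show ?thesis by simp
    qed
    then have "{p \<in> A \<times> B. \<not> vge (case p of (i, j) \<Rightarrow> f i * g j) N}
        \<subseteq> {i\<in>A. \<not> vge (f i) (N - c)} \<times> {j\<in>B. \<not> vge (g j) (N - b)}"
      by auto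
    then show "finite {p \<in> A \<times> B. \<not> vge (case p of (i, j) \<Rightarrow> f i * g j) N}"
      using f g unfolding fsummable_def by (meson finite_SigmaI finite_subset)
  qed
  have "fsum (\<lambda>(i, j). f i * g j) (A \<times> B) = fsum (\<lambda>i. f i * fsum g B) A"
    using fsum_Sigma(3)[OF s] by (simp add: fsum_cmult[OF g])
  also have "\<dots> = fsum g B * fsum f A"
    by (subst fsum_cmult[OF f, symmetric]) (simp add: mult.commute)
  finally show "fsum (\<lambda>(i, j). f i * g j) (A \<times> B) = fsum f A * fsum g B"
    by (simp add: mult.commute)
qed

lemma fsum_int_even:
  fixes f :: "int \<Rightarrow> 'a::field fls"
  assumes "fsummable f UNIV" "\<And>l. f (- l) = f l"
  shows "fsum f UNIV = f 0 + 2 * fsum (\<lambda>n. f (int n)) {1..}"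
  using fsum_int_split(3)[OF assms(1)] by (simp add: assms(2))

lemma fsum_int_symmetrize:
  fixes f :: "int \<Rightarrow> 'a::field_char_0 fls"
  assumes "fsummable f UNIV"
  shows "fsummable (\<lambda>l. f l + f (- l)) UNIV" "fsum (\<lambda>l. f l + f (- l)) UNIV = 2 * fsum f UNIV"
  using fsummable_add[OF assms, of "\<lambda>l. f (- l)"] fsum_add[OF assms, of "\<lambda>l. f (- l)"]
    fsum_int_minus[of f] assms by auto

section \<open>From the Eulerian series to a sum over the largest part\<close>

context nome2
begin

lemma vge_u_power: "vge (u * Q ^ m) 1"
  using vge_mult[OF vge_u vge_mono[OF vge_Q_power, of 0 m]] by simp

lemma one_minus_uQ: "1 - u * Q ^ m \<noteq> 0"
  using vge_inverse_one_plus(1)[of "- (u * Q ^ m)"] vge_u_power by simp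

text \<open>Entries of a double array: weighted by (-1)^m (Q; Q)_m, its sums over n and over m yield
  the two sides of \<open>eulerian_eq\<close>.\<close>

definition er :: "nat \<Rightarrow> nat \<Rightarrow> 'a fls" where
  "er m n = Q ^ (m * n) * ws n / qm (Suc m + n)"

lemma vge_er: "vge (er m n) (int (m * n + n))"
proof -
  have "vge (Q ^ (m * n) * ws n * inverse (qm (Suc m + n))) (int (m * n) + int n + 0)"
    by (intro vge_mult vge_Q_power vge_ws vge_inverse_qm)
  then show ?thesis by (simp add: er_def divide_inverse)
qed

text \<open>The ratio of consecutive entries gives \<open>er m (Suc n) - u * Q ^ m * er m n\<close>
  as a telescoping difference. Hence the sum S satisfies S - u Q^m (er m 0 + S) = Q^(m+1) er m 0, a
  linear equation.\<close>

lemma er_sum: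
  "fsum (\<lambda>n. er m (Suc n)) UNIV = Q ^ m * (Q + u) / (qm (Suc m) * (1 - u * Q ^ m))"
proof -
  define g where "g n = Q ^ (m + n + 1) * er m n" for n
  have step: "er m (Suc n) - u * Q ^ m * er m n = g n - g (Suc n)" for n
  proof -
    have "qm (Suc m + Suc n) = qm (Suc m + n) * (1 + Q ^ (m + n + 2))"
      by (simp add: qm_Suc)
    moreover have "Q ^ (m * Suc n) * ws (Suc n) = Q ^ (m * n) * ws n * (Q ^ m * (u + Q ^ Suc n))"
      by (simp add: ws_def power_add)
    ultimately have "er m (Suc n) * (1 + Q ^ (m + n + 2)) = er m n * (Q ^ m * (u + Q ^ Suc n))"
      using one_plus_Q_power(1)[of "m + n + 2"] qm_nonzero[of "Suc m + n"]
      unfolding er_def by simp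
    then show ?thesis by (simp add: g_def algebra_simps power_add)
  qed
  have vg: "vge (g n) (int n)" for n
  proof -
    have "vge (Q ^ (m + n + 1) * er m n) (int (m + n + 1) + int (m * n + n))"
      by (intro vge_mult vge_Q_power vge_er)
    then show ?thesis by (auto simp: g_def elim!: vge_mono)
  qed
  have s: "fsummable (er m) UNIV"
    by (rule fsummable_nat) (auto intro: vge_mono[OF vge_er])
  have "fsum (\<lambda>n. g n - g (Suc n)) {0..} = g 0 - 0"
  proof (rule fsum_telescope(2))
    show "\<exists>M. \<forall>m\<ge>M. vge (g m - 0) N" for N
      by (rule exI[of _ "nat N"]) (auto intro: vge_mono[OF vg])
  qed
  then have "fsum (\<lambda>n. er m (Suc n) - u * Q ^ m * er m n) UNIV = g 0"
    by (simp only: step atLeast_0 diff_zero)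
  then have "fsum (\<lambda>n. er m (Suc n)) UNIV - u * Q ^ m * fsum (er m) UNIV = g 0"
    by (simp add: fsum_diff fsum_cmult fsummable_cmult s fsum_nat_Suc(1))
  then have "fsum (\<lambda>n. er m (Suc n)) UNIV * (1 - u * Q ^ m) = Q ^ m * (Q + u) * er m 0"
    unfolding fsum_nat_Suc(2)[OF s] by (simp add: g_def algebra_simps)
  moreover have "er m 0 = 1 / qm (Suc m)" by (simp add: er_def ws_def)
  ultimately show ?thesis
    using one_minus_uQ[of m] qm_nonzero[of "Suc m"] by (simp add: field_simps)
qed

text \<open>The summand times 1 + Q^N is \<open>g m - g (Suc m)\<close>; N > 0 provides the decay in
  m.\<close>

lemma er_sum':
  assumes "N > 0"
  shows "fsum (\<lambda>m. (-1) ^ m * qp m * Q ^ (m * N) / qm (Suc m + N)) UNIV = 1 / (qm N * (1 + Q ^ N))"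
proof -
  define c where "c = 1 / (1 + Q ^ N)"
  define g where "g m = (-1) ^ m * Q ^ (m * N) * qp m / qm (m + N)" for m
  have vg: "vge (g m) (int m)" for m
  proof -
    have "vge ((-1) ^ m * Q ^ (m * N) * qp m * inverse (qm (m + N))) (0 + int (m * N) + 0 + 0)"
      by (intro vge_mult vge_Q_power vge_qp vge_inverse_qm) (cases "even m"; simp)
    moreover have "m \<le> m * N" using assms by simp
    then have "int m \<le> 0 + int (m * N) + 0 + 0" by linarith
    ultimately show ?thesis unfolding g_def divide_inverse by (rule vge_mono)
  qed
  have lim: "\<exists>M. \<forall>m\<ge>M. vge (g m - 0) N" for N
    by (rule exI[of _ "nat N"]) (auto intro: vge_mono[OF vg])
  have step: "c * (g m - g (Suc m)) = (-1) ^ m * qp m * Q ^ (m * N) / qm (Suc m + N)" for m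
  proof -
    define R where "R = qm (m + N)"
    define D where "D = 1 + Q ^ Suc (m + N)"
    have R: "R \<noteq> 0" "D \<noteq> 0" using qm_nonzero one_plus_Q_power(1) by (simp_all only: R_def D_def not_False_eq_True)
    have qs: "qm (Suc m + N) = R * D" by (simp add: R_def D_def qm_Suc)
    have "g m - g (Suc m) = (-1) ^ m * Q ^ (m * N) * qp m * (D + Q ^ N * (1 - Q ^ Suc m)) / (R * D)"
      using R unfolding g_def R_def[symmetric] add_Suc[symmetric] qs qp_Suc
      by (simp add: field_simps power_add)
    also have "D + Q ^ N * (1 - Q ^ Suc m) = 1 + Q ^ N"
      by (simp add: D_def power_add algebra_simps)
    finally show ?thesis
      using one_plus_Q_power(1)[of N] unfolding qs by (simp add: c_def mult_ac)
  qed
  have "fsum (\<lambda>m. c * (g m - g (Suc m))) {0..} = c * (g 0 - 0)"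
    using fsum_telescope[OF lim, of 0] by (simp only: fsum_cmult)
  then show ?thesis by (simp add: step atLeast_0) (simp add: g_def c_def mult.commute)
qed

lemma wq_ws: "wq (Suc n) = 2 * qm n * ws (Suc n)"
proof -
  have "(\<Prod>i<Suc n. 1 + Q ^ i) = 2 * qm n"
    by (induction n) (simp_all add: qm_Suc)
  then show ?thesis unfolding wq_def ws_def prod.distrib by simp
qed

text \<open>Expanding \<open>(Q + u) Q\<^sup>m / (1 - u Q\<^sup>m)\<close> as a Newton series makes the sum over \<open>m\<close> telescope.\<close>

lemma eulerian_eq:
  "eulerian = 1 + 2 * fsum (\<lambda>m. (-1) ^ m * (qp m / qm (Suc m)) * (Q ^ m * (Q + u) / (1 - u * Q ^ m))) UNIV"
proof -
  \<comment> \<open>Its sums over n are given by \<open>er_sum\<close>, those over m by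
    \<open>er_sum'\<close> with N = n + 1.\<close>
  define t where "t m n = (-1) ^ m * qp m * er m (Suc n)" for m n
  have vt: "vge (t m n) (int (m + n))" for m n
  proof -
    have "vge ((-1) ^ m * qp m * er m (Suc n)) (0 + 0 + int (m * Suc n + Suc n))"
      by (intro vge_mult vge_qp vge_er) (cases "even m"; simp)
    then show ?thesis by (auto simp: t_def elim!: vge_mono)
  qed
  have s: "fsummable (\<lambda>(m, n). t m n) (UNIV \<times> UNIV)"
    by (rule fsummable_nat_pair) (rule vt)
  have se: "fsummable (\<lambda>n. er m (Suc n)) UNIV" for m
    by (rule fsummable_nat) (rule vge_mono[OF vge_er], auto)
  have "fsum (\<lambda>n. t m n) UNIV = (-1) ^ m * (qp m / qm (Suc m)) * (Q ^ m * (Q + u) / (1 - u * Q ^ m))" for m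
    unfolding t_def fsum_cmult[OF se] er_sum by simp
  moreover have "fsum (\<lambda>m. t m n) UNIV = ws (Suc n) / (qm (Suc n) * (1 + Q ^ Suc n))" for n
  proof -
    let ?h = "\<lambda>m. (-1) ^ m * qp m * Q ^ (m * Suc n) / qm (Suc m + Suc n)"
    have sh: "fsummable ?h UNIV"
    proof (rule fsummable_nat)
      fix m
      have "vge ((-1) ^ m * qp m * Q ^ (m * Suc n) * inverse (qm (Suc m + Suc n))) (0 + 0 + int (m * Suc n) + 0)"
        by (intro vge_mult vge_Q_power vge_qp vge_inverse_qm) (cases "even m"; simp)
      then show "vge (?h m) (int m)" by (auto simp: divide_inverse elim!: vge_mono)
    qed
    have "t m n = ws (Suc n) * ?h m" for m
      by (simp add: t_def er_def)
    then have "fsum (\<lambda>m. t m n) UNIV = ws (Suc n) * fsum ?h UNIV"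
      by (simp only: fsum_cmult[OF sh])
    then show ?thesis unfolding er_sum'[OF zero_less_Suc] by simp
  qed
  ultimately have *: "fsum (\<lambda>m. (-1) ^ m * (qp m / qm (Suc m)) * (Q ^ m * (Q + u) / (1 - u * Q ^ m))) UNIV
      = fsum (\<lambda>n. ws (Suc n) / (qm (Suc n) * (1 + Q ^ Suc n))) UNIV"
    using fsum_swap[OF s] by simp
  have sw: "fsummable (\<lambda>n. wq n / (qm n)\<^sup>2) UNIV"
  proof -
    have "vge (inverse (qm n) * inverse (qm n)) (0 + 0)" for n
      by (intro vge_mult vge_inverse_qm)
    then have "fsummable (\<lambda>n. wq n * (inverse (qm n) * inverse (qm n))) UNIV"
      by (intro fsummable_wq) simp
    then show ?thesis by (simp add: divide_inverse power2_eq_square)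
  qed
  have tm: "wq (Suc n) / (qm (Suc n))\<^sup>2 = 2 * (ws (Suc n) / (qm (Suc n) * (1 + Q ^ Suc n)))" for n
    using qm_nonzero[of n] by (simp only: wq_ws qm_Suc) (simp add: power2_eq_square)
  have "fsummable (\<lambda>n. ws (Suc n) / (qm (Suc n) * (1 + Q ^ Suc n))) UNIV"
    using fsum_nat_Suc(1)[OF sw, unfolded tm] fsummable_cmult[of "\<lambda>n. 2 * (ws (Suc n) / (qm (Suc n) * (1 + Q ^ Suc n)))" UNIV "1/2"]
    by simp
  then have "eulerian = wq 0 / (qm 0)\<^sup>2 + 2 * fsum (\<lambda>n. ws (Suc n) / (qm (Suc n) * (1 + Q ^ Suc n))) UNIV"
    unfolding eulerian_def fsum_nat_Suc(2)[OF sw] tm by (simp only: fsum_cmult)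
  then show ?thesis unfolding * by (simp add: wq_def)
qed

end

section \<open>Theta series and sums of two squares\<close>

definition qX :: "complex fls" where "qX = fls_X"

lemma qX_nonzero [simp]: "qX \<noteq> 0"
  by (simp add: qX_def)

lemma vge_qX: "vge qX 1"
  by (simp add: vge_iff qX_def)

interpretation q1: nome2 qX 0
  by unfold_locales (simp_all add: vge_qX)

interpretation q2: nome2 "qX\<^sup>2" qX
  by unfold_locales (use vge_qX vge_mono[OF vge_power[OF vge_qX, of 2], of 1] in auto)

text \<open>At nome -q the signs of \<open>theta_term\<close> disappear, because (-1)^(k^2) =
  (-1)^k; this instance serves the two-square theorem.\<close>

interpretation nq: nome "- qX"
  by unfold_locales (simp_all add: vge_qX)

lemmas qX_add = q1.Q_powi_add

lemma qX_sq_powi: "(qX\<^sup>2) powi k = qX powi (2 * k)"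
  by (simp add: power_int_mult)

definition ath :: "int \<Rightarrow> complex fls" where
  "ath l = (-1) powi l * qX powi (l\<^sup>2)"

text \<open>1 / (2 cosh(l t)) for q = e^-t, half of the hyperbolic secant.\<close>

definition sech :: "int \<Rightarrow> complex fls" where
  "sech l = qX powi l / (1 + qX powi (2 * l))"

definition theta_neg :: "complex fls" where "theta_neg = fsum ath UNIV"

definition theta_pos :: "complex fls" where "theta_pos = fsum (\<lambda>l. qX powi (l\<^sup>2)) UNIV"

definition sech_sum :: "complex fls" where "sech_sum = fsum sech UNIV"

lemma ath_q1: "ath = q1.theta_term"
  by (simp add: fun_eq_iff ath_def q1.theta_term_def)

lemma ath_minus [simp]: "ath (- l) = ath l"
  by (simp add: ath_def minus_one_powi_minus)

lemma vge_ath: "vge (ath l) (l\<^sup>2)"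
  unfolding ath_q1 by (rule q1.vge_theta_term)

lemma vge_ath_abs: "vge (ath l) \<bar>l\<bar>"
  unfolding ath_q1 by (rule q1.vge_theta_term_abs)

lemmas fsummable_abs = q1.fsummable_abs

lemma fsummable_ath: "fsummable ath UNIV"
  by (rule fsummable_abs) (rule vge_ath_abs)

lemma fsummable_ath_mult:
  assumes "\<And>l. vge (f l) 0"
  shows "fsummable (\<lambda>l. ath l * f l) UNIV"
  by (rule fsummable_abs) (use vge_mult[OF vge_ath_abs assms] in simp)

lemma one_plus_qX: "1 + qX powi k \<noteq> 0"
  by (rule q1.one_plus_Q_powi)

lemma sech_minus [simp]: "sech (- l) = sech l"
proof -
  have "qX powi (- l) * inverse (1 + qX powi (- (2 * l))) = qX powi (- l) * qX powi (2 * l) * inverse (1 + qX powi (2 * l))"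
    by (simp only: q1.one_plus_Q_powi_neg mult.assoc)
  also have "\<dots> = qX powi l * inverse (1 + qX powi (2 * l))"
    by (simp only: qX_add[symmetric]) simp
  finally show ?thesis by (simp add: sech_def divide_inverse)
qed

lemma vge_sech: "vge (sech l) \<bar>l\<bar>"
proof -
  have pos: "vge (sech l) l" if "l \<ge> 0" for l
  proof -
    have "vge (qX powi l * inverse (1 + qX powi (2 * l))) (l + 0)"
      by (intro vge_mult q1.vge_Q_powi q1.one_plus_Q_powi_pos) (use that in auto)
    then show ?thesis by (simp add: sech_def divide_inverse)
  qed
  show ?thesis using pos[of l] pos[of "- l"] by (cases "l \<ge> 0") auto
qed

lemma vge_sech0: "vge (sech l) 0"
  by (rule vge_mono[OF vge_sech]) simp

lemma fsummable_sech: "fsummable sech UNIV"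
  by (rule fsummable_abs) (rule vge_sech)

lemma int_induct_sym:
  assumes "\<And>n. P (int n)" "\<And>k. P k \<Longrightarrow> P (- k)"
  shows "P (k::int)"
  using assms by (metis int_cases2)

text \<open>For u = 0 the recurrence of \<open>bS\<close> is solved by \<open>bpair\<close> without
  its sign. Pairing k with -k in the unit sum cancels the denominator 1 + q^k and leaves theta(-q),
  while the product with \<open>bpair\<close> squares that denominator.\<close>

theorem theta_eulerian1:
  "theta_neg * q1.eulerian = 4 * fsum (\<lambda>l. ath l * (qX powi l / (1 + qX powi l)\<^sup>2)) UNIV"
proof -
  define \<gamma> where "\<gamma> k = (-1) powi k * q1.bpair k" for k :: int
  have \<gamma>_eq: "\<gamma> k = 2 * qX powi (k * (k + 1) div 2) / (1 + qX powi k)" for k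
  proof -
    have "\<gamma> k = 2 * ((-1) powi k * (-1) powi k) * qX powi (k * (k + 1) div 2) / (1 + qX powi k)"
      unfolding \<gamma>_def q1.bpair_def by (simp only: mult_ac times_divide_eq_left times_divide_eq_right)
    then show ?thesis by simp
  qed
  have \<gamma>_minus: "\<gamma> (- k) = \<gamma> k" for k
    by (simp add: \<gamma>_def q1.bpair_minus minus_one_powi_minus)
  have v\<gamma>: "vge (\<gamma> k) \<bar>k\<bar>" for k
    using vge_mult[OF vge_minus_one_powi[of 0] q1.vge_bpair[of k]] by (simp add: \<gamma>_def)
  have bS: "q1.bS k = \<gamma> k * q1.bS 0" for k
  proof (induction k rule: int_induct_sym)
    case (1 n)
    show ?case
    proof (induction n)
      case 0
      then show ?case by (simp add: \<gamma>_eq)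
    next
      case (Suc n)
      define A where "A = qX ^ n"
      have nz: "1 + A \<noteq> 0" "1 + qX * A \<noteq> 0"
        using q1.one_plus_Q_power(1)[of n] q1.one_plus_Q_power(1)[of "Suc n"] by (simp_all add: A_def)
      have "int (Suc n) * (int (Suc n) + 1) = int n * (int n + 1) + 2 * (int n + 1)"
        by (simp add: algebra_simps)
      then have "int (Suc n) * (int (Suc n) + 1) div 2 = int n * (int n + 1) div 2 + int (Suc n)"
        by (simp add: add.commute)
      then have t: "qX powi (int (Suc n) * (int (Suc n) + 1) div 2) = qX powi (int n * (int n + 1) div 2) * (qX * A)"
        by (simp only: qX_add power_int_of_nat) (simp add: A_def)
      have g1: "\<gamma> (int (Suc n)) = 2 * (qX powi (int n * (int n + 1) div 2) * (qX * A)) / (1 + qX * A)"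
        unfolding \<gamma>_eq t by (simp only: power_int_of_nat power_Suc A_def)
      have g0: "\<gamma> (int n) = 2 * qX powi (int n * (int n + 1) div 2) / (1 + A)"
        unfolding \<gamma>_eq by (simp only: power_int_of_nat A_def)
      have "(1 + qX * A) * q1.bS (int (Suc n)) = (1 + A) * (qX * A) * q1.bS (int n)"
        using q1.bS_recurrence[of n] unfolding power_Suc A_def[symmetric] by simp
      also have "\<dots> = (1 + qX * A) * (\<gamma> (int (Suc n)) * q1.bS 0)"
        unfolding Suc g1 g0 using nz by simp
      finally show ?case using nz by simp
    qed
  next
    case (2 k)
    then show ?case by (simp add: q1.bS_minus \<gamma>_minus)
  qed
  have v0: "vge (\<gamma> k) 0" for k by (rule vge_mono[OF v\<gamma>]) simp
  have s1: "fsummable (\<lambda>k. q1.ue k * \<gamma> k) UNIV"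
    by (rule fsummable_abs) (use vge_mult[OF q1.vge_ue v\<gamma>] in simp)
  have s2: "fsummable (\<lambda>k. q1.bpair k * \<gamma> k) UNIV"
    by (rule fsummable_abs) (use vge_mult[OF q1.vge_bpair v0] in simp)
  have tri: "k * (k - 1) div 2 + k * (k + 1) div 2 = (k::int)\<^sup>2" for k
  proof -
    have "even (k * (k - 1))" "even (k * (k + 1))" by auto
    then have "k * (k - 1) div 2 + k * (k + 1) div 2 = (k * (k - 1) + k * (k + 1)) div 2" by simp
    also have "k * (k - 1) + k * (k + 1) = 2 * k\<^sup>2" by (simp add: algebra_simps power2_eq_square)
    finally show ?thesis by simp
  qed
  have "q1.ue k * \<gamma> k + q1.ue (- k) * \<gamma> (- k) = 2 * ath k" for k
  proof -
    have "q1.ue k * \<gamma> k + q1.ue (- k) * \<gamma> (- k) = q1.ue k * (\<gamma> k * (1 + qX powi k))"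
      by (simp add: q1.ue_minus \<gamma>_minus algebra_simps)
    also have "\<dots> = 2 * ((-1) powi k * (qX powi (k * (k - 1) div 2) * qX powi (k * (k + 1) div 2)))"
      using one_plus_qX[of k] by (simp add: \<gamma>_eq q1.ue_def)
    finally show ?thesis by (simp only: qX_add[symmetric] tri ath_def)
  qed
  then have "2 * fsum (\<lambda>k. q1.ue k * \<gamma> k) UNIV = 2 * theta_neg"
    using fsum_int_symmetrize(2)[OF s1] by (simp add: fsum_cmult fsummable_ath theta_neg_def)
  then have e1: "fsum (\<lambda>k. q1.ue k * \<gamma> k) UNIV = theta_neg" by simp
  have "q1.bpair k * \<gamma> k = 4 * (ath k * (qX powi k / (1 + qX powi k)\<^sup>2))" for k
  proof -
    have "k * (k + 1) div 2 + k * (k + 1) div 2 = k\<^sup>2 + k"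
      by (simp add: algebra_simps power2_eq_square flip: mult_2)
    then have *: "qX powi (k * (k + 1) div 2) * qX powi (k * (k + 1) div 2) = qX powi (k\<^sup>2) * qX powi k"
      by (simp only: qX_add[symmetric])
    have "q1.bpair k * \<gamma> k = 4 * (-1) powi k * (qX powi (k * (k + 1) div 2) * qX powi (k * (k + 1) div 2)) / (1 + qX powi k)\<^sup>2"
      unfolding q1.bpair_def \<gamma>_eq using one_plus_qX[of k] by (simp add: field_simps power2_eq_square)
    then show ?thesis unfolding * by (simp add: ath_def mult_ac)
  qed
  moreover have "fsummable (\<lambda>l. ath l * (qX powi l / (1 + qX powi l)\<^sup>2)) UNIV"
    using fsummable_cmult[OF s2, of "1/4"] calculation by simp
  ultimately have e2: "fsum (\<lambda>k. q1.bpair k * \<gamma> k) UNIV = 4 * fsum (\<lambda>l. ath l * (qX powi l / (1 + qX powi l)\<^sup>2)) UNIV"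
    by (simp only: fsum_cmult)
  show ?thesis
    using q1.eulerian_times[OF bS v0 s1 s2] unfolding e1 e2 .
qed

lemma q2_bpair: "q2.bpair k = 2 * (ath k * sech k)"
proof -
  have "2 * (k * (k + 1) div 2) = k\<^sup>2 + k"
    by (simp add: algebra_simps power2_eq_square)
  then show ?thesis
    unfolding q2.bpair_def qX_sq_powi by (simp add: ath_def sech_def qX_add mult_ac)
qed

text \<open>For (Q, u) = (q^2, q) the factors 1 + u Q^k and u + Q^(k+1) are 1 + q^(2k+1) and q (1 +
  q^(2k+1)). They cancel in the recurrence, which is then solved by
  \<open>2 * sech k\<close>.\<close>

theorem theta_eulerian2:
  "theta_neg * q2.eulerian = 4 * fsum (\<lambda>l. ath l * (sech l)\<^sup>2) UNIV"
proof -
  define \<gamma> where "\<gamma> k = 2 * sech k" for k :: int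
  have \<gamma>_minus: "\<gamma> (- k) = \<gamma> k" for k by (simp add: \<gamma>_def)
  have v\<gamma>: "vge (\<gamma> k) \<bar>k\<bar>" for k
    using vge_mult[OF vge_numeral[of 0] vge_sech[of k]] by (simp add: \<gamma>_def)
  have bS: "q2.bS k = \<gamma> k * q2.bS 0" for k
  proof (induction k rule: int_induct_sym)
    case (1 n)
    show ?case
    proof (induction n)
      case 0
      then show ?case by (simp add: \<gamma>_def sech_def)
    next
      case (Suc n)
      define A where "A = qX ^ n"
      have nz: "1 + A\<^sup>2 \<noteq> 0" "1 + (qX * A)\<^sup>2 \<noteq> 0" "1 + qX * A\<^sup>2 \<noteq> 0"
        using q1.one_plus_Q_power(1)[of "n * 2"] q1.one_plus_Q_power(1)[of "Suc n * 2"]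
          q1.one_plus_Q_power(1)[of "Suc (n * 2)"]
        by (simp_all only: A_def power_mult power_Suc not_False_eq_True)
      have pw: "qX powi (2 * int m) = (qX ^ m)\<^sup>2" for m
        by (simp add: power_int_def nat_mult_distrib mult.commute flip: power_mult)
      have g1: "\<gamma> (int (Suc n)) = 2 * (qX * A) / (1 + (qX * A)\<^sup>2)"
        unfolding \<gamma>_def sech_def pw power_int_of_nat by (simp add: A_def)
      have g0: "\<gamma> (int n) = 2 * A / (1 + A\<^sup>2)"
        unfolding \<gamma>_def sech_def pw power_int_of_nat by (simp add: A_def)
      have e: "(qX\<^sup>2) ^ n = A\<^sup>2" by (simp add: A_def mult.commute flip: power_mult)
      have "(1 + qX\<^sup>2 * A\<^sup>2) * (1 + qX * A\<^sup>2) * q2.bS (int (Suc n))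
          = (1 + A\<^sup>2) * (qX + qX\<^sup>2 * A\<^sup>2) * q2.bS (int n)"
        using q2.bS_recurrence[of n] unfolding power_Suc e by simp
      also have "\<dots> = (1 + A\<^sup>2) * (qX * (1 + qX * A\<^sup>2)) * q2.bS (int n)"
        by (simp add: algebra_simps power2_eq_square)
      also have "\<dots> = (1 + (qX * A)\<^sup>2) * (1 + qX * A\<^sup>2) * (\<gamma> (int (Suc n)) * q2.bS 0)"
        unfolding Suc g1 g0 using nz by simp
      finally show ?case using nz by (simp add: power_mult_distrib)
    qed
  next
    case (2 k)
    then show ?case by (simp add: q2.bS_minus \<gamma>_minus)
  qed
  have v0: "vge (\<gamma> k) 0" for k by (rule vge_mono[OF v\<gamma>]) simp
  have s1: "fsummable (\<lambda>k. q2.ue k * \<gamma> k) UNIV"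
    by (rule fsummable_abs) (use vge_mult[OF q2.vge_ue v\<gamma>] in simp)
  have s2: "fsummable (\<lambda>k. q2.bpair k * \<gamma> k) UNIV"
    by (rule fsummable_abs) (use vge_mult[OF q2.vge_bpair v0] in simp)
  have "q2.ue k * \<gamma> k + q2.ue (- k) * \<gamma> (- k) = 2 * ath k" for k
  proof -
    have "2 * (k * (k - 1) div 2) + k = k\<^sup>2"
      by (simp add: algebra_simps power2_eq_square)
    then have *: "qX powi (2 * (k * (k - 1) div 2)) * qX powi k = qX powi (k\<^sup>2)"
      by (simp only: qX_add[symmetric])
    have "q2.ue k * \<gamma> k + q2.ue (- k) * \<gamma> (- k) = q2.ue k * (\<gamma> k * (1 + qX powi (2 * k)))"
      by (simp add: q2.ue_minus \<gamma>_minus qX_sq_powi algebra_simps)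
    also have "\<dots> = 2 * ((-1) powi k * (qX powi (2 * (k * (k - 1) div 2)) * qX powi k))"
      using one_plus_qX[of "2 * k"] by (simp only: \<gamma>_def sech_def q2.ue_def qX_sq_powi) simp
    finally show ?thesis by (simp only: * ath_def)
  qed
  then have "2 * fsum (\<lambda>k. q2.ue k * \<gamma> k) UNIV = 2 * theta_neg"
    using fsum_int_symmetrize(2)[OF s1] by (simp add: fsum_cmult fsummable_ath theta_neg_def)
  then have e1: "fsum (\<lambda>k. q2.ue k * \<gamma> k) UNIV = theta_neg" by simp
  have "q2.bpair k * \<gamma> k = 4 * (ath k * (sech k)\<^sup>2)" for k
    unfolding q2_bpair \<gamma>_def by (simp add: power2_eq_square)
  moreover have "fsummable (\<lambda>l. ath l * (sech l)\<^sup>2) UNIV"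
    using vge_mult[OF vge_sech0 vge_sech0] by (intro fsummable_ath_mult) (simp add: power2_eq_square)
  ultimately have e2: "fsum (\<lambda>k. q2.bpair k * \<gamma> k) UNIV = 4 * fsum (\<lambda>l. ath l * (sech l)\<^sup>2) UNIV"
    by (simp add: fsum_cmult)
  show ?thesis
    using q2.eulerian_times[OF bS v0 s1 s2] unfolding e1 e2 .
qed

section \<open>Jacobi's two-square theorem and theta(q) theta(-q)\<close>

definition eo :: "nat \<times> nat \<Rightarrow> nat \<times> nat" where
  "eo = (\<lambda>(k, j). if even k then (k div 2, k div 2 + j) else ((k + 1) div 2 + j, k div 2))"

text \<open>A pair \<open>k < d = k + 2 j + 1\<close> of opposite parity is matched with its even member \<open>2 n\<close> and its
  odd member \<open>2 i + 1\<close>, where \<open>(n, i) = eo (k, j)\<close>.\<close>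

lemma bij_betw_eo: "bij_betw eo ({1..} \<times> UNIV) ({1..} \<times> UNIV)"
proof (rule bij_betwI[where g = "\<lambda>(n, i). if n \<le> i then (2 * n, i - n) else (2 * i + 1, n - i - 1)"])
  show "eo \<in> {1..} \<times> UNIV \<rightarrow> {1..} \<times> UNIV"
    by (auto simp: eo_def elim!: evenE oddE)
qed (auto simp: eo_def elim!: evenE oddE)

text \<open>The exponent k d / 2 of one double series becomes the exponent n (2i + 1) of the other.
  In the last part d - k = 2j + 1 acquires the sign (-1)^k and so is the odd member minus the even
  one.\<close>

lemma eo_product:
  assumes "eo (k, j) = (n, i)"
  shows "k * (k + 2 * j + 1) = 2 * (n * (2 * i + 1))" "(-1 :: 'a::ring_1) ^ (n + i) = (-1) ^ (k + j)"
    "(-1 :: 'a) ^ k * of_nat (2 * j + 1) = of_nat (2 * i + 1) - of_nat (2 * n)"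
proof -
  show "k * (k + 2 * j + 1) = 2 * (n * (2 * i + 1))"
    using assms by (cases "even k") (auto simp: eo_def elim!: evenE oddE)
  have "n + i = k + j"
    using assms by (cases "even k") (auto simp: eo_def elim!: evenE oddE)
  then show "(-1 :: 'a) ^ (n + i) = (-1) ^ (k + j)" by simp
  show "(-1 :: 'a) ^ k * of_nat (2 * j + 1) = of_nat (2 * i + 1) - of_nat (2 * n)"
    using assms by (cases "even k") (auto simp: eo_def elim!: evenE oddE)
qed

lemma vge_neg_qX_power: "vge ((- qX) ^ n) (int n)"
  using vge_power[of "- qX" 1 n] vge_qX by simp

text \<open>\<open>theta_Q_squared\<close> at nome -q writes theta^2 as a sum with denominators 1 +
  (-q)^k. Expanding these as geometric series and reordering by \<open>eo\<close> produces the
  expansions of the terms \<open>sech n\<close>.\<close>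

theorem two_squares: "theta_pos\<^sup>2 = 2 * sech_sum"
proof -
  let ?q = "- qX"
  have tt: "nq.theta_term k = qX powi (k\<^sup>2)" for k
  proof -
    have "?q powi (k\<^sup>2) = (-1) powi (k\<^sup>2) * qX powi (k\<^sup>2)"
      by (simp flip: power_int_mult_distrib)
    moreover have "(-1 :: complex fls) powi (k\<^sup>2) = (-1) powi k"
      by (cases "even k") (simp_all add: power_int_minus_left)
    ultimately show ?thesis
      unfolding nq.theta_term_def by (simp add: mult.assoc[symmetric])
  qed
  then have "nq.theta_term = (\<lambda>k. qX powi (k\<^sup>2))" by (rule ext)
  then have th: "theta_pos = nq.theta_Q"
    by (simp only: theta_pos_def nq.theta_Q_def)
  have sb: "fsummable nq.bpair UNIV" by (rule nq.fsummable_abs) (rule nq.vge_bpair)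
  define B where "B k j = (-1) ^ (k + j) * ?q ^ (k * (k + 2 * j + 1) div 2)" for k j :: nat
  define C where "C n i = (-1) ^ (n + i) * ?q ^ (n * (2 * i + 1))" for n i :: nat
  have vm: "vge ((-1 :: complex fls) ^ n) 0" for n by (cases "even n") auto
  have vC: "vge (C n i) (int (n + i))" if "n \<ge> 1" for n i
  proof -
    have "n + i \<le> n * (2 * i + 1)"
    proof -
      have "i \<le> n * i" using that by simp
      then show ?thesis by (simp add: algebra_simps)
    qed
    then have "int (n + i) \<le> 0 + int (n * (2 * i + 1))" by linarith
    then show ?thesis
      unfolding C_def by (rule vge_mono[OF vge_mult[OF vm vge_neg_qX_power]])
  qed
  have sC: "fsummable (\<lambda>(n, i). C n i) ({1..} \<times> UNIV)"
    by (rule fsummable_nat_pair) (use vC in auto)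
  have BC: "(case eo p of (n, i) \<Rightarrow> C n i) = (case p of (k, j) \<Rightarrow> B k j)" for p
  proof -
    obtain k j n i where p: "p = (k, j)" "eo (k, j) = (n, i)" by (metis surj_pair)
    have "k * (k + 2 * j + 1) div 2 = n * (2 * i + 1)"
      unfolding eo_product(1)[OF p(2)] by simp
    then show ?thesis
      using eo_product(2)[OF p(2), where ?'a = "complex fls"]
      unfolding p prod.case B_def C_def by (simp only:)
  qed
  have sB: "fsummable (\<lambda>(k, j). B k j) ({1..} \<times> UNIV)"
    using fsummable_reindex[OF bij_betw_eo, of "\<lambda>(n, i). C n i"] sC by (simp add: BC)
  have "fsum (\<lambda>(k, j). B k j) ({1..} \<times> UNIV) = fsum (\<lambda>(n, i). C n i) ({1..} \<times> UNIV)"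
    using fsum_reindex[OF bij_betw_eo, of "\<lambda>(n, i). C n i"] by (simp add: BC)
  then have BCsum: "fsum (\<lambda>k. fsum (B k) UNIV) {1..} = fsum (\<lambda>n. fsum (C n) UNIV) {1..}"
    using fsum_Sigma(3)[OF sB] fsum_Sigma(3)[OF sC] by simp
  have Bk: "2 * fsum (B k) UNIV = nq.bpair (int k)" if "k \<ge> 1" for k
  proof -
    have "k * (k + 2 * j + 1) div 2 = k * (k + 1) div 2 + k * j" for j
    proof -
      have "k * (k + 2 * j + 1) = k * (k + 1) + 2 * (k * j)" by (simp add: algebra_simps)
      then show ?thesis by simp
    qed
    then have "B k j = ((-1) ^ k * ?q ^ (k * (k + 1) div 2)) * (- (?q ^ k)) ^ j" for j
      by (simp add: B_def power_add power_minus[of "?q ^ k"] mult_ac flip: power_mult)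
    then have Bk: "B k = (\<lambda>j. ((-1) ^ k * ?q ^ (k * (k + 1) div 2)) * (- (?q ^ k)) ^ j)"
      by (simp add: fun_eq_iff)
    have "vge (- (?q ^ k)) 1"
      using vge_mono[OF vge_neg_qX_power[of k], of 1] that by simp
    from fsum_geometric(2)[OF this]
    have "fsum (B k) UNIV = (-1) ^ k * ?q ^ (k * (k + 1) div 2) / (1 + ?q ^ k)"
      unfolding Bk by simp
    moreover have "int k * (int k + 1) div 2 = int (k * (k + 1) div 2)"
      by (simp add: zdiv_int algebra_simps)
    ultimately show ?thesis
      unfolding nq.bpair_def by (simp only: power_int_of_nat mult.assoc times_divide_eq_right)
  qed
  have Cn: "fsum (C n) UNIV = sech (int n)" if "n \<ge> 1" for n
  proof -
    have "C n i = qX ^ n * (- (qX ^ (2 * n))) ^ i" for i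
    proof -
      have "?q ^ (n * (2 * i + 1)) = (-1) ^ (n * (2 * i + 1)) * qX ^ (n * (2 * i + 1))"
        by (rule power_minus)
      moreover have "(-1 :: complex fls) ^ (n + i) * (-1) ^ (n * (2 * i + 1)) = (-1) ^ i"
        by (simp add: minus_one_power_iff)
      ultimately have "C n i = (-1) ^ i * qX ^ (n * (2 * i + 1))"
        by (simp add: C_def mult.assoc[symmetric])
      also have "\<dots> = qX ^ n * (- (qX ^ (2 * n))) ^ i"
      proof -
        have "(- (qX ^ (2 * n))) ^ i = (-1) ^ i * qX ^ (2 * n * i)"
          by (subst power_minus) (simp only: power_mult)
        moreover have "qX ^ (n * (2 * i + 1)) = qX ^ n * qX ^ (2 * n * i)"
          by (simp add: algebra_simps flip: power_add)
        ultimately show ?thesis by (simp only: mult_ac)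
      qed
      finally show ?thesis .
    qed
    then have Cn: "C n = (\<lambda>i. qX ^ n * (- (qX ^ (2 * n))) ^ i)" by (simp add: fun_eq_iff)
    have "vge (- (qX ^ (2 * n))) 1"
      using vge_mono[OF q1.vge_Q_power[of "2 * n"], of 1] that by simp
    from fsum_geometric(2)[OF this] show ?thesis
      unfolding Cn sech_def by (simp add: power_int_def nat_mult_distrib)
  qed
  have sB1: "fsummable (\<lambda>k. fsum (B k) UNIV) {1..}" using fsum_Sigma(2)[OF sB] .
  have sC1: "fsummable (\<lambda>k. fsum (C k) UNIV) {1..}" using fsum_Sigma(2)[OF sC] .
  have "theta_pos\<^sup>2 = nq.bpair 0 + 2 * fsum (\<lambda>k. nq.bpair (int k)) {1..}"
    unfolding th nq.theta_Q_squared[symmetric] by (rule fsum_int_even[OF sb nq.bpair_minus])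
  also have "fsum (\<lambda>k. nq.bpair (int k)) {1..} = fsum (\<lambda>k. 2 * fsum (B k) UNIV) {1..}"
    by (rule fsum_cong) (simp add: Bk)
  also have "\<dots> = 2 * fsum (\<lambda>n. fsum (C n) UNIV) {1..}"
    unfolding fsum_cmult[OF sB1] BCsum ..
  also have "fsum (\<lambda>n. fsum (C n) UNIV) {1..} = fsum (\<lambda>n. sech (int n)) {1..}"
    by (rule fsum_cong) (simp add: Cn)
  finally have 1: "theta_pos\<^sup>2 = nq.bpair 0 + 2 * (2 * fsum (\<lambda>n. sech (int n)) {1..})" .
  have 2: "sech_sum = sech 0 + 2 * fsum (\<lambda>n. sech (int n)) {1..}"
    unfolding sech_sum_def by (rule fsum_int_even[OF fsummable_sech sech_minus])
  have 3: "nq.bpair 0 = 1" "sech 0 = 1 / 2" by (simp_all add: nq.bpair_def sech_def)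
  show ?thesis unfolding 1 2 3 by (simp only: distrib_left) simp
qed

text \<open>By \<open>q2_bpair\<close> the left side is theta(-q^2)^2. The substitution (a, b) -> (a
  + b, a - b) identifies it with the part of theta(-q) theta(q) over pairs of even sum; the pairs of
  odd sum cancel when the two variables are exchanged.\<close>

lemma theta_product: "2 * fsum (\<lambda>l. ath l * sech l) UNIV = theta_pos * theta_neg"
proof -
  have s: "fsummable (\<lambda>l. ath l * sech l) UNIV"
    by (rule fsummable_ath_mult[OF vge_sech0])
  have "2 * fsum (\<lambda>l. ath l * sech l) UNIV = fsum q2.bpair UNIV"
    unfolding fsum_cmult[OF s, symmetric] by (rule fsum_cong) (simp add: q2_bpair)
  also have "\<dots> = q2.theta_Q\<^sup>2" by (rule q2.theta_Q_squared)
  also have "\<dots> = theta_neg * theta_pos"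
  proof -
    define P where "P = (\<lambda>(u, v). ath u * qX powi (v\<^sup>2))"
    define E where "E = {(u::int, v::int). even (u + v)}"
    define Od where "Od = {(u::int, v::int). odd (u + v)}"
    have sp: "fsummable (\<lambda>l. qX powi (l\<^sup>2)) UNIV"
      by (rule fsummable_abs) (rule vge_mono[OF q1.vge_Q_powi q1.abs_le_square_int], simp)
    have sP: "fsummable P (UNIV \<times> UNIV)" and eP: "fsum P (UNIV \<times> UNIV) = theta_neg * theta_pos"
      unfolding P_def theta_neg_def theta_pos_def
      by (rule fsum_product[OF fsummable_ath sp])+
    have sPB: "fsummable P B" for B using fsummable_subset[OF sP] by auto
    have bijE: "bij_betw (\<lambda>(a, b). (a + b, a - b)) (UNIV \<times> UNIV) E"
      by (rule bij_betwI[where g = "\<lambda>(u, v). ((u + v) div 2, (u - v) div 2)"]) (auto simp: E_def, presburger+)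
    have bijO: "bij_betw prod.swap Od Od"
      by (rule bij_betwI[where g = prod.swap]) (auto simp: Od_def)
    have sq: "q2.theta_term a * q2.theta_term b = P (a + b, a - b)" for a b
    proof -
      have "2 * a\<^sup>2 + 2 * b\<^sup>2 = (a + b)\<^sup>2 + (a - b)\<^sup>2" by (simp add: power2_eq_square algebra_simps)
      then have "qX powi (2 * a\<^sup>2) * qX powi (2 * b\<^sup>2) = qX powi ((a + b)\<^sup>2) * qX powi ((a - b)\<^sup>2)"
        by (simp only: qX_add[symmetric])
      moreover have "(-1 :: complex fls) powi (a + b) = (-1) powi a * (-1) powi b"
        by (simp add: power_int_add)
      ultimately show ?thesis
        unfolding q2.theta_term_def qX_sq_powi P_def ath_def by (simp add: mult_ac)
    qed
    have "q2.theta_Q\<^sup>2 = fsum (\<lambda>(a, b). q2.theta_term a * q2.theta_term b) (UNIV \<times> UNIV)"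
      unfolding power2_eq_square[of "q2.theta_Q"]
      unfolding q2.theta_Q_def
      by (rule fsum_product(2)[symmetric]) (rule q2.fsummable_theta)+
    also have "\<dots> = fsum (\<lambda>p. P (case p of (a, b) \<Rightarrow> (a + b, a - b))) (UNIV \<times> UNIV)"
      by (rule fsum_cong) (auto simp: sq)
    also have "\<dots> = fsum P E" by (rule fsum_reindex[OF bijE])
    finally have 1: "q2.theta_Q\<^sup>2 = fsum P E" .
    have "fsum P Od = fsum (\<lambda>p. P (prod.swap p)) Od"
      by (rule fsum_reindex[OF bijO, symmetric])
    also have "\<dots> = fsum (\<lambda>p. - P p) Od"
    proof (rule fsum_cong)
      fix p assume "p \<in> Od"
      then obtain u v where p: "p = (u, v)" "odd (u + v)" by (auto simp: Od_def)
      then have "(-1 :: complex fls) powi v = - ((-1) powi u)"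
        by (cases "even u") (auto simp: power_int_minus_left)
      then show "P (prod.swap p) = - P p" by (simp add: p P_def ath_def mult_ac)
    qed
    also have "\<dots> = - fsum P Od" by (rule fsum_uminus[OF sPB])
    finally have 2: "fsum P Od = 0" by (simp add: eq_neg_iff_add_eq_0 flip: mult_2)
    have "(UNIV \<times> UNIV) = E \<union> Od" "E \<inter> Od = {}" by (auto simp: E_def Od_def)
    then have "fsum P (UNIV \<times> UNIV) = fsum P E + fsum P Od"
      by (simp only: fsum_Un[OF sPB sPB])
    then show ?thesis using 1 2 eP by simp
  qed
  finally show ?thesis by (simp add: mult.commute)
qed

section \<open>Theta series times hyperbolic sums\<close>

text \<open>tanh(l t) for q = e^-t; \<open>cth\<close> below is coth(l t).\<close>

definition tnh :: "int \<Rightarrow> complex fls" where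
  "tnh l = (1 - qX powi (2 * l)) / (1 + qX powi (2 * l))"

text \<open>Since \<open>x / 0 = 0\<close>, the value at \<open>l = 0\<close> is \<open>0\<close>, which keeps the function odd.\<close>

definition cth :: "int \<Rightarrow> complex fls" where
  "cth l = (1 + qX powi (2 * l)) / (1 - qX powi (2 * l))"

lemma one_minus_qX: "k \<noteq> 0 \<Longrightarrow> 1 - qX powi k \<noteq> 0"
proof -
  assume "k \<noteq> 0"
  have pos: "1 - qX powi k \<noteq> 0" if "k > 0" for k
    using q1.one_minus_Q_power(1)[of "nat k"] that by (simp add: power_int_def)
  show ?thesis
  proof (cases "k > 0")
    case False
    then have "1 - qX powi (- k) \<noteq> 0" using \<open>k \<noteq> 0\<close> by (intro pos) simp
    moreover have "qX powi k = inverse (qX powi (- k))" by (simp add: power_int_minus)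
    ultimately show ?thesis by auto
  qed (rule pos)
qed

lemma qX_powi_inverse: "qX powi (- k) = 1 / qX powi k"
  by (simp add: power_int_minus_divide)

lemma tnh_minus [simp]: "tnh (- l) = - tnh l"
proof -
  define Y where "Y = qX powi (2 * l)"
  have "Y \<noteq> 0" "1 + Y \<noteq> 0" using one_plus_qX by (simp_all add: Y_def)
  then have "(1 - 1 / Y) / (1 + 1 / Y) = - ((1 - Y) / (1 + Y))"
    by (simp add: divide_simps) (simp add: algebra_simps)
  then show ?thesis by (simp add: tnh_def Y_def qX_powi_inverse)
qed

lemma cth_minus [simp]: "cth (- l) = - cth l"
proof (cases "l = 0")
  case False
  define Y where "Y = qX powi (2 * l)"
  have "Y \<noteq> 0" "1 - Y \<noteq> 0" "Y - 1 \<noteq> 0" using one_minus_qX[of "2 * l"] False by (auto simp: Y_def)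
  then have "(1 + 1 / Y) / (1 - 1 / Y) = - ((1 + Y) / (1 - Y))"
    by (simp add: divide_simps) (simp add: algebra_simps)
  then show ?thesis by (simp add: cth_def Y_def qX_powi_inverse)
qed (simp add: cth_def)

lemma cth_0 [simp]: "cth 0 = 0" and tnh_0 [simp]: "tnh 0 = 0"
  by (simp_all add: cth_def tnh_def)

lemma vge_tnh_one: "k \<ge> 0 \<Longrightarrow> vge (tnh k - 1) (2 * k)"
proof -
  assume k: "k \<ge> 0"
  have "tnh k - 1 = (-2) * qX powi (2 * k) * inverse (1 + qX powi (2 * k))"
    using one_plus_qX[of "2 * k"] by (simp add: tnh_def field_simps)
  moreover have "vge ((-2) * qX powi (2 * k) * inverse (1 + qX powi (2 * k))) (0 + 2 * k + 0)"
    by (intro vge_mult q1.vge_Q_powi q1.one_plus_Q_powi_pos) (use k in \<open>auto simp: vge_numeral\<close>)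
  ultimately show ?thesis by simp
qed

lemma vge_inverse_one_minus_qX: "k > 0 \<Longrightarrow> vge (inverse (1 - qX powi k)) 0"
  using q1.one_minus_Q_power(2)[of "nat k"] by (simp add: power_int_def)

lemma vge_cth_one: "k > 0 \<Longrightarrow> vge (cth k - 1) (2 * k)"
proof -
  assume k: "k > 0"
  have "cth k - 1 = 2 * qX powi (2 * k) * inverse (1 - qX powi (2 * k))"
    using one_minus_qX[of "2 * k"] k by (simp add: cth_def field_simps)
  moreover have "vge (2 * qX powi (2 * k) * inverse (1 - qX powi (2 * k))) (0 + 2 * k + 0)"
    by (intro vge_mult q1.vge_Q_powi vge_inverse_one_minus_qX vge_numeral) (use k in auto)
  ultimately show ?thesis by simp
qed

text \<open>The features shared by tanh and coth that are used below: oddness, and the limit 1 with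
  error of order q^(2l).\<close>

locale odd_to_one =
  fixes \<phi> :: "int \<Rightarrow> complex fls"
  assumes odd: "\<phi> (- l) = - \<phi> l" and to_one: "l > 0 \<Longrightarrow> vge (\<phi> l - 1) (2 * l)"
begin

lemma zero: "\<phi> 0 = 0"
  using odd[of 0] by (simp add: eq_neg_iff_add_eq_0 flip: mult_2)

lemma vge0: "vge (\<phi> l) 0"
proof -
  have "vge (\<phi> l) 0" if "l > 0" for l
    using vge_add[OF vge_mono[OF to_one[OF that], of 0], of 1] that by simp
  from this[of l] this[of "- l"] show ?thesis
    by (cases l "0 :: int" rule: linorder_cases) (auto simp: odd zero)
qed

lemma vge_diff_tail:
  "\<bar>l\<bar> < int m \<Longrightarrow> vge (\<phi> (int m + l) - \<phi> (int m - l)) (2 * (int m - \<bar>l\<bar>))"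
proof -
  assume l: "\<bar>l\<bar> < int m"
  have "vge (\<phi> (int m + l) - 1) (2 * (int m - \<bar>l\<bar>))" "vge (\<phi> (int m - l) - 1) (2 * (int m - \<bar>l\<bar>))"
    using l by (auto intro!: vge_mono[OF to_one])
  from vge_diff[OF this] show ?thesis by simp
qed

text \<open>For |l| < m, (|l| - 1)^2 >= 0 gives l^2 + 2 (m - |l|) >= 2m - 1 >= m; otherwise l^2 >=
  |l| suffices. Order max(m, |l|) makes the double family over m and l summable.\<close>

lemma vge_ath_diff: "vge (ath l * (\<phi> (int m + l) - \<phi> (int m - l))) (max (int m) \<bar>l\<bar>)"
proof (cases "\<bar>l\<bar> < int m")
  case True
  have "0 \<le> (\<bar>l\<bar> - 1)\<^sup>2" by simp
  then have "2 * \<bar>l\<bar> - 1 \<le> l\<^sup>2" by (simp add: power2_eq_square algebra_simps)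
  with True have "max (int m) \<bar>l\<bar> \<le> l\<^sup>2 + 2 * (int m - \<bar>l\<bar>)" by simp
  then show ?thesis by (rule vge_mult'[OF vge_ath vge_diff_tail[OF True]])
next
  case False
  then have "max (int m) \<bar>l\<bar> \<le> \<bar>l\<bar> + 0" by simp
  then show ?thesis
    by (rule vge_mult'[OF vge_ath_abs vge_diff[OF vge0 vge0]])
qed

lemma summable_diff: "fsummable (\<lambda>m. \<phi> (int m + l) - \<phi> (int m - l)) A"
proof (rule fsummableI[where e = "\<lambda>m. if \<bar>l\<bar> < int m then 2 * (int m - \<bar>l\<bar>) else 0"])
  show "vge (\<phi> (int m + l) - \<phi> (int m - l)) (if \<bar>l\<bar> < int m then 2 * (int m - \<bar>l\<bar>) else 0)" for m
    using vge_diff_tail vge_diff[OF vge0 vge0] by auto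
  fix N :: int
  have "{m \<in> A. (if \<bar>l\<bar> < int m then 2 * (int m - \<bar>l\<bar>) else 0) < N} \<subseteq> {..nat (\<bar>N\<bar> + \<bar>l\<bar>)}"
    by (auto split: if_splits)
  then show "finite {m \<in> A. (if \<bar>l\<bar> < int m then 2 * (int m - \<bar>l\<bar>) else 0) < N}"
    using finite_subset by blast
qed

text \<open>Call the sum F(l). Then F(l + 1) - c F(l) telescopes in m, and the limit 1 of \<phi>
  contributes 1 + c at infinity. Induction from F(0) = 0 and oddness reach all l. The linear term
  survives for c = 1 only.\<close>

lemma telescoping:
  assumes c: "c = 1 \<or> c = -1"
  shows "fsum (\<lambda>m. c ^ m * (\<phi> (int m + l) - \<phi> (int m - l))) {1..} = of_int l * (1 + c) - \<phi> l"
proof -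
  define F where "F l = fsum (\<lambda>m. c ^ m * (\<phi> (int m + l) - \<phi> (int m - l))) {1..}" for l
  have c2: "c * c = 1" using c by auto
  have cm: "c ^ m = 1 \<or> c ^ m = -1" for m using c by (cases "even m") auto
  have c1: "c ^ m * (1 + c) = 1 + c" for m using c by auto
  have vc: "vge (c ^ m * f) n \<longleftrightarrow> vge f n" for m f n using cm[of m] by auto
  have s: "fsummable (\<lambda>m. c ^ m * (\<phi> (int m + l) - \<phi> (int m - l))) {1..}" for l
    using summable_diff[of l "{1..}"] unfolding fsummable_def vc .
  have step: "F (l + 1) - c * F l = 1 + c - \<phi> (l + 1) + c * \<phi> l" for l
  proof -
    define g where "g m = - (c ^ Suc m * \<phi> (int m + l) + c ^ m * \<phi> (int m - l - 1))" for m
    have lim: "\<exists>M. \<forall>m\<ge>M. vge (g m - (- (1 + c))) N" for N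
    proof (intro exI[of _ "nat (\<bar>N\<bar> + \<bar>l\<bar> + 2)"] allI impI)
      fix m assume m: "nat (\<bar>N\<bar> + \<bar>l\<bar> + 2) \<le> m"
      have "g m - (- (1 + c)) = c ^ m * (1 + c) + g m" by (simp add: c1)
      also have "\<dots> = - (c ^ Suc m * (\<phi> (int m + l) - 1) + c ^ m * (\<phi> (int m - l - 1) - 1))"
        by (simp add: g_def algebra_simps)
      finally have e: "g m - (- (1 + c)) = - (c ^ Suc m * (\<phi> (int m + l) - 1) + c ^ m * (\<phi> (int m - l - 1) - 1))" .
      show "vge (g m - (- (1 + c))) N"
        unfolding e vge_uminus
        by (intro vge_add) (simp_all only: vc, use m in \<open>auto intro!: vge_mono[OF to_one]\<close>)
    qed
    have t: "c ^ m * (\<phi> (int m + (l + 1)) - \<phi> (int m - (l + 1))) - c * (c ^ m * (\<phi> (int m + l) - \<phi> (int m - l)))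
        = g m - g (Suc m)" for m
    proof -
      have "c ^ Suc (Suc m) = c ^ m" using c2 by (simp add: mult.assoc[symmetric])
      moreover have "int (Suc m) + l = int m + (l + 1)" "int (Suc m) - l - 1 = int m - l"
        "int m - (l + 1) = int m - l - 1" by simp_all
      ultimately show ?thesis unfolding g_def by (simp only:) (simp add: algebra_simps)
    qed
    have "F (l + 1) - c * F l = fsum (\<lambda>m. g m - g (Suc m)) {1..}"
      unfolding F_def fsum_cmult[OF s, symmetric] fsum_diff[OF s fsummable_cmult[OF s], symmetric] t ..
    also have "\<dots> = g 1 - (- (1 + c))" by (rule fsum_telescope(2)[OF lim])
    also have "g 1 = - \<phi> (l + 1) + c * \<phi> l"
      using c2 odd[of l] by (simp add: g_def add.commute)
    finally show ?thesis by simp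
  qed
  have pos: "F (int n) = of_int (int n) * (1 + c) - \<phi> (int n)" for n
  proof (induction n)
    case 0
    then show ?case by (simp add: F_def zero fsum_def zero_fls_def[symmetric])
  next
    case (Suc n)
    have "int (Suc n) = int n + 1" by simp
    then have "F (int (Suc n)) = c * F (int n) + (1 + c - \<phi> (int n + 1) + c * \<phi> (int n))"
      using step[of "int n"] by (simp only:) (simp add: algebra_simps)
    also have "\<dots> = of_int (int n) * (c * (1 + c)) + (1 + c) - \<phi> (int (Suc n))"
      unfolding Suc by (simp add: algebra_simps)
    also have "c * (1 + c) = 1 + c" using c2 by (simp add: algebra_simps)
    finally show ?case by (simp add: algebra_simps)
  qed
  have neg: "F (- l) = - F l" for l
    unfolding F_def fsum_uminus[OF s, symmetric]
    by (rule fsum_cong) (simp add: algebra_simps)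
  have "F l = of_int l * (1 + c) - \<phi> l"
  proof (induction l rule: int_induct_sym)
    case (1 n)
    show ?case by (rule pos)
  next
    case (2 k)
    then show ?case by (simp add: neg odd)
  qed
  then show ?thesis by (simp add: F_def)
qed

lemma vge_ath_mult_diff:
  assumes "vge f 0"
  shows "vge (f * (ath l * (\<phi> (int m + l) - \<phi> (int m - l)))) (max (int m) \<bar>l\<bar>)"
  using vge_mult[OF assms vge_ath_diff] by simp

end

lemma fsummable_max:
  fixes C :: "nat \<Rightarrow> int \<Rightarrow> complex fls"
  assumes "\<And>m l. m \<ge> 1 \<Longrightarrow> vge (C m l) (max (int m) \<bar>l\<bar>)"
  shows "fsummable (\<lambda>(m, l). C m l) ({1..} \<times> UNIV)"
proof (rule fsummableI[where e = "\<lambda>(m, l). max (int m) \<bar>l\<bar>"])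
  fix N :: int
  have "{p \<in> {1..} \<times> UNIV. (case p of (m, l) \<Rightarrow> max (int m) \<bar>l\<bar>) < N} \<subseteq> {..nat N} \<times> {-N..N}"
    by (auto simp: abs_less_iff)
  then show "finite {p \<in> {1..} \<times> UNIV. (case p of (m, l) \<Rightarrow> max (int m) \<bar>l\<bar>) < N}"
    using finite_subset by blast
qed (use assms in auto)

interpretation tnh: odd_to_one tnh
  by unfold_locales (auto intro: vge_tnh_one)

interpretation cth: odd_to_one cth
  by unfold_locales (auto intro: vge_cth_one)

section \<open>Addition theorems\<close>

lemma tnh_sq: "(tnh l)\<^sup>2 = 1 - 4 * (sech l)\<^sup>2"
proof -
  define A where "A = qX powi l"
  have e: "qX powi (2 * l) = A * A" unfolding A_def qX_add[symmetric] by simp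
  have "1 + A * A \<noteq> 0" using one_plus_qX[of "2 * l"] by (simp add: e)
  then show ?thesis
    unfolding tnh_def sech_def e A_def[symmetric]
    by (simp add: divide_simps power2_eq_square) (simp add: algebra_simps)
qed

lemma powi_add_diff:
  "qX powi (2 * (m + l)) = qX powi (2 * m) * qX powi (2 * l)"
  "qX powi (2 * (m - l)) = qX powi (2 * m) / qX powi (2 * l)"
  by (simp_all add: distrib_left right_diff_distrib power_int_add power_int_diff)

lemma one_minus_div_one_plus:
  fixes x y :: "'a::field"
  assumes "y \<noteq> 0"
  shows "(1 - x / y) / (1 + x / y) = (y - x) / (x + y)"
proof -
  have "1 - x / y = (y - x) / y" "1 + x / y = (x + y) / y"
    using assms by (simp_all add: field_simps)
  then show ?thesis using assms by simp
qed

text \<open>The addition theorem of tanh, arranged so that the right side contains the difference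
  that \<open>telescoping\<close> sums over m.\<close>

lemma tnh_addition:
  assumes "m \<noteq> 0"
  shows "cth m * (tnh (m + l) + tnh (m - l)) - 2 = - (tnh l * (tnh (m + l) - tnh (m - l)))"
proof -
  define X where "X = qX powi (2 * m)"
  define Y where "Y = qX powi (2 * l)"
  have nz: "X \<noteq> 0" "Y \<noteq> 0" "1 - X \<noteq> 0" "1 + Y \<noteq> 0" "1 + X * Y \<noteq> 0" "X + Y \<noteq> 0"
  proof -
    show "X \<noteq> 0" and Y: "Y \<noteq> 0" by (simp_all add: X_def Y_def)
    show "1 - X \<noteq> 0" "1 + Y \<noteq> 0" using assms one_minus_qX one_plus_qX by (simp_all add: X_def Y_def)
    show "1 + X * Y \<noteq> 0" using one_plus_qX[of "2 * (m + l)"] unfolding X_def Y_def powi_add_diff .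
    have "1 + X / Y \<noteq> 0" using one_plus_qX[of "2 * (m - l)"] unfolding X_def Y_def powi_add_diff .
    then show "X + Y \<noteq> 0" using Y by (auto simp: field_simps)
  qed
  have t: "tnh (m + l) = (1 - X * Y) / (1 + X * Y)" "tnh (m - l) = (Y - X) / (X + Y)"
    "tnh l = (1 - Y) / (1 + Y)" "cth m = (1 + X) / (1 - X)"
  proof -
    have "(1 - X / Y) / (1 + X / Y) = (Y - X) / (X + Y)"
      using nz(2) by (rule one_minus_div_one_plus)
    then show "tnh (m - l) = (Y - X) / (X + Y)"
      unfolding tnh_def powi_add_diff X_def[symmetric] Y_def[symmetric] .
    show "tnh (m + l) = (1 - X * Y) / (1 + X * Y)" "tnh l = (1 - Y) / (1 + Y)" "cth m = (1 + X) / (1 - X)"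
      unfolding tnh_def cth_def powi_add_diff X_def[symmetric] Y_def[symmetric] by (rule refl)+
  qed
  show ?thesis
    unfolding t using nz by (simp add: divide_simps) (simp add: algebra_simps)
qed

text \<open>For q = e^-t the prefactor is 1 / (2 sinh(m t)), and both sides equal cosh(m t) /
  (cosh((m + l) t) cosh((m - l) t)).\<close>

lemma tnh_sech_addition:
  assumes "m \<noteq> 0"
  shows "qX powi m / (1 - qX powi (2 * m)) * (tnh (m + l) + tnh (m - l)) = 2 * (sech l * (sech (m + l) + sech (m - l)))"
proof -
  define A where "A = qX powi m"
  define B where "B = qX powi l"
  have pw: "qX powi (2 * m) = A * A" "qX powi (2 * l) = B * B"
    unfolding A_def B_def qX_add[symmetric] by simp_all
  have pa: "qX powi (m + l) = A * B" "qX powi (m - l) = A / B"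
    by (simp_all add: A_def B_def power_int_add power_int_diff)
  have nz: "A \<noteq> 0" "B \<noteq> 0" "1 - A * A \<noteq> 0" "1 + B * B \<noteq> 0" "1 + A * A * (B * B) \<noteq> 0" "A * A + B * B \<noteq> 0"
  proof -
    show "A \<noteq> 0" and B: "B \<noteq> 0" by (simp_all add: A_def B_def)
    show "1 - A * A \<noteq> 0" "1 + B * B \<noteq> 0"
      using assms one_minus_qX[of "2 * m"] one_plus_qX[of "2 * l"] by (simp_all add: pw)
    show "1 + A * A * (B * B) \<noteq> 0" using one_plus_qX[of "2 * (m + l)"] unfolding powi_add_diff pw .
    have "1 + A * A / (B * B) \<noteq> 0" using one_plus_qX[of "2 * (m - l)"] unfolding powi_add_diff pw .
    then show "A * A + B * B \<noteq> 0" using B by (auto simp: field_simps)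
  qed
  have t: "tnh (m + l) = (1 - A * A * (B * B)) / (1 + A * A * (B * B))"
    "tnh (m - l) = (B * B - A * A) / (A * A + B * B)"
    "sech (m + l) = A * B / (1 + A * A * (B * B))" "sech (m - l) = A * B / (A * A + B * B)"
    "sech l = B / (1 + B * B)"
  proof -
    have "(1 - A * A / (B * B)) / (1 + A * A / (B * B)) = (B * B - A * A) / (A * A + B * B)"
      by (rule one_minus_div_one_plus) (use nz(2) in simp)
    then show "tnh (m - l) = (B * B - A * A) / (A * A + B * B)"
      unfolding tnh_def powi_add_diff pw .
    have "A / B / (1 + A * A / (B * B)) = A * B / (A * A + B * B)"
      using nz by (simp add: field_simps)
    then show "sech (m - l) = A * B / (A * A + B * B)"
      unfolding sech_def powi_add_diff pw pa .
    show "tnh (m + l) = (1 - A * A * (B * B)) / (1 + A * A * (B * B))"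
      "sech (m + l) = A * B / (1 + A * A * (B * B))" "sech l = B / (1 + B * B)"
      unfolding tnh_def sech_def powi_add_diff pw pa B_def[symmetric] by (rule refl)+
  qed
  show ?thesis
    unfolding t pw A_def[symmetric] using nz
    by (simp add: divide_simps) (simp add: algebra_simps)
qed

text \<open>The extra terms account for those l at which one of the arguments l, m + l, m - l is 0,
  where \<open>cth\<close> has the default value 0 instead of a pole.\<close>

lemma cth_addition:
  assumes "m > 0"
  shows "cth m * (cth (m + l) + cth (m - l)) - 2 = - (cth l * (cth (m + l) - cth (m - l)))
     + (if l = 0 then 2 * ((cth m)\<^sup>2 - 1) else if \<bar>l\<bar> = m then (cth m)\<^sup>2 - 1 else 0)"
proof -
  define X where "X = qX powi (2 * m)"
  have X: "X \<noteq> 0" "1 - X \<noteq> 0" using assms one_minus_qX by (simp_all add: X_def)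
  have cm: "cth m = (1 + X) / (1 - X)" by (simp add: cth_def X_def)
  have c2m: "cth m * cth (m + m) - 2 = - (cth m * cth (m + m)) + ((cth m)\<^sup>2 - 1)"
  proof -
    have c2: "cth (m + m) = (1 + X * X) / (1 - X * X)"
      by (simp only: cth_def powi_add_diff X_def)
    have "1 - X * X \<noteq> 0"
      using one_minus_qX[of "2 * (m + m)"] assms unfolding X_def powi_add_diff[symmetric] by auto
    then have "1 + X \<noteq> 0" by (auto simp: algebra_simps add_eq_0_iff)
    have f: "1 - X * X = (1 - X) * (1 + X)" by (simp add: algebra_simps)
    show ?thesis unfolding cm c2 f using X \<open>1 + X \<noteq> 0\<close>
      by (simp add: divide_simps power2_eq_square) (simp add: algebra_simps)
  qed
  consider "l = 0" | "l = m" | "l = - m" | "l \<noteq> 0" "l \<noteq> m" "l \<noteq> - m" by blast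
  then show ?thesis
  proof cases
    case 1
    then show ?thesis by (simp add: power2_eq_square)
  next
    case 2
    then show ?thesis using c2m assms by simp
  next
    case 3
    then show ?thesis using c2m assms by (simp add: algebra_simps)
  next
    case 4
    define Y where "Y = qX powi (2 * l)"
    have nz: "Y \<noteq> 0" "1 - Y \<noteq> 0" "1 - X * Y \<noteq> 0" "Y - X \<noteq> 0"
    proof -
      show Y: "Y \<noteq> 0" by (simp_all add: Y_def)
      show "1 - Y \<noteq> 0" using one_minus_qX[of "2 * l"] 4 by (simp add: Y_def)
      show "1 - X * Y \<noteq> 0" using one_minus_qX[of "2 * (m + l)"] 4 unfolding X_def Y_def powi_add_diff[symmetric] by auto
      have "1 - X / Y \<noteq> 0" using one_minus_qX[of "2 * (m - l)"] 4 unfolding X_def Y_def powi_add_diff[symmetric] by auto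
      then show "Y - X \<noteq> 0" using Y by (auto simp: field_simps)
    qed
    have t: "cth (m + l) = (1 + X * Y) / (1 - X * Y)" "cth (m - l) = (X + Y) / (Y - X)"
      "cth l = (1 + Y) / (1 - Y)"
    proof -
      have "(1 + X / Y) / (1 - X / Y) = (X + Y) / (Y - X)"
        using nz by (simp add: field_simps)
      then show "cth (m - l) = (X + Y) / (Y - X)"
        unfolding cth_def powi_add_diff X_def[symmetric] Y_def[symmetric] .
      show "cth (m + l) = (1 + X * Y) / (1 - X * Y)" "cth l = (1 + Y) / (1 - Y)"
        unfolding cth_def powi_add_diff X_def[symmetric] Y_def[symmetric] by (rule refl)+
    qed
    have "cth m * (cth (m + l) + cth (m - l)) - 2 = - (cth l * (cth (m + l) - cth (m - l)))"
      unfolding t cm using nz X by (simp add: divide_simps) (simp add: algebra_simps)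
    moreover have "\<bar>l\<bar> \<noteq> m" using 4 assms by auto
    ultimately show ?thesis using 4 by simp
  qed
qed

text \<open>For \<open>\<epsilon> = \<plusminus>1\<close>, this is the sum of \<open>\<epsilon>^(m - x) q^(m\<^sup>2 - x\<^sup>2)\<close> over \<open>0 \<le> x \<le> m\<close>, in which the two end
  terms count half.\<close>

primrec coneN :: "complex fls \<Rightarrow> nat \<Rightarrow> complex fls" where
  "coneN \<epsilon> 0 = 0"
| "coneN \<epsilon> (Suc m) = \<epsilon> * qX ^ (2 * m + 1) * coneN \<epsilon> m + (1 + \<epsilon> * qX ^ (2 * m + 1)) / 2"

lemma ath_pred: "ath (l - 1) = - (ath l * qX powi (1 - 2 * l))"
proof -
  have "(l - 1)\<^sup>2 = l\<^sup>2 + (1 - 2 * l)" by (simp add: power2_eq_square algebra_simps)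
  then have "qX powi ((l - 1)\<^sup>2) = qX powi (l\<^sup>2) * qX powi (1 - 2 * l)" by (simp only: qX_add)
  moreover have "(-1 :: complex fls) powi (l - 1) = - ((-1) powi l)"
    using minus_one_powi_Suc[of "l - 1", where ?'a = "complex fls"] by simp
  ultimately show ?thesis by (simp add: ath_def)
qed

lemma minus_int_Suc: "- int (Suc m) = - int m - 1"
  by simp

lemma ath_Suc: "ath (int (Suc m)) = - (qX ^ (2 * m + 1) * ath (int m))"
proof -
  have "ath (int (Suc m)) = ath (- int m - 1)"
    using ath_minus[of "int (Suc m)"] minus_int_Suc[of m] by (simp only:)
  also have "\<dots> = - (ath (int m) * qX powi (int (2 * m + 1)))"
    unfolding ath_pred by simp
  finally show ?thesis by (simp only: power_int_of_nat mult.commute)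
qed

text \<open>Shifting l trades m + 1 for m at the price of \<open>ath (l - 1)\<close>; this drives
  the inductions on m below.\<close>

lemma sum_shift:
  assumes "\<And>l. vge (\<phi> l) 0"
  shows "fsum (\<lambda>l. ath l * \<phi> (int (Suc m) + l)) UNIV = fsum (\<lambda>l. ath (l - 1) * \<phi> (int m + l)) UNIV"
    "fsummable (\<lambda>l. ath (l - 1) * \<phi> (int m + l)) UNIV"
proof -
  have s: "fsummable (\<lambda>l. ath l * \<phi> (int (Suc m) + l)) UNIV" by (intro fsummable_ath_mult assms)
  have e: "int (Suc m) + (l + - 1) = int m + l" for l by simp
  show "fsum (\<lambda>l. ath l * \<phi> (int (Suc m) + l)) UNIV = fsum (\<lambda>l. ath (l - 1) * \<phi> (int m + l)) UNIV"
    using fsum_int_shift(1)[of "\<lambda>l. ath l * \<phi> (int (Suc m) + l)" "-1"]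
    unfolding e by simp
  show "fsummable (\<lambda>l. ath (l - 1) * \<phi> (int m + l)) UNIV"
    using fsum_int_shift(2)[of "\<lambda>l. ath l * \<phi> (int (Suc m) + l)" "-1"] s
    unfolding e by simp
qed

lemma fsum_ath_pred: "fsum (\<lambda>l. ath (l - 1)) UNIV = theta_neg" "fsummable (\<lambda>l. ath (l - 1)) UNIV"
  using fsum_int_shift[of ath "-1"] fsummable_ath by (simp_all add: theta_neg_def)

text \<open>With c = q^(2m+1) and Z = q^(2(m+l)), \<open>ath (l - 1)\<close> is -(c / Z) times
  \<open>ath l\<close>. Clearing the denominator 1 + Z of tanh therefore reproduces the recursion of
  \<open>coneN\<close> term by term.\<close>

lemma theta_coneN_pos: "2 * theta_neg * coneN 1 m = fsum (\<lambda>l. ath l * tnh (int m + l)) UNIV"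
proof (induction m)
  case 0
  have "fsum (\<lambda>l. ath l * tnh l) UNIV = 0"
    by (rule fsum_int_odd) (auto intro: fsummable_ath_mult tnh.vge0)
  then show ?case by simp
next
  case (Suc m)
  define c where "c = qX ^ (2 * m + 1)"
  note s1 = fsummable_ath_mult[of "\<lambda>l. tnh (int m + l)", OF tnh.vge0]
  note sh = sum_shift[of tnh, OF tnh.vge0, of m]
  have pt: "ath (l - 1) * tnh (int m + l) - c * (ath l * tnh (int m + l)) = ath (l - 1) + c * ath l" for l
  proof -
    define Z where "Z = qX powi (2 * (int m + l))"
    have "c = qX powi (1 - 2 * l + 2 * (int m + l))" by (simp add: c_def power_int_def nat_add_distrib nat_mult_distrib)
    then have c: "c = qX powi (1 - 2 * l) * Z" by (simp only: Z_def qX_add)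
    have "tnh (int m + l) * (1 + Z) = 1 - Z"
      using one_plus_qX[of "2 * (int m + l)"] by (simp add: tnh_def Z_def)
    then have "- (ath l * qX powi (1 - 2 * l)) * (tnh (int m + l) * (1 + Z)) = - (ath l * qX powi (1 - 2 * l)) * (1 - Z)"
      by simp
    then show ?thesis unfolding c ath_pred by (simp add: algebra_simps)
  qed
  have "fsum (\<lambda>l. ath l * tnh (int (Suc m) + l)) UNIV - c * fsum (\<lambda>l. ath l * tnh (int m + l)) UNIV
      = fsum (\<lambda>l. ath (l - 1) + c * ath l) UNIV"
    unfolding sh(1) fsum_cmult[OF s1, symmetric] fsum_diff[OF sh(2) fsummable_cmult[OF s1], symmetric] pt ..
  also have "\<dots> = theta_neg + c * theta_neg"
    by (simp add: fsum_add fsum_ath_pred fsummable_cmult fsum_cmult fsummable_ath flip: theta_neg_def)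
  finally show ?case
    unfolding Suc[symmetric] coneN.simps c_def[symmetric] by (simp add: algebra_simps)
qed

text \<open>As for tanh, except that at l = -m the pole of coth is replaced by 0. Each induction
  step thereby loses \<open>2 * ath (m + 1)\<close>; since \<open>ath (m + 1)\<close> is -q^(2m+1)
  times \<open>ath m\<close>, the losses accumulate to 2 m times \<open>ath m\<close>.\<close>

lemma theta_coneN_neg:
  "2 * theta_neg * coneN (-1) m = fsum (\<lambda>l. ath l * cth (int m + l)) UNIV + 2 * of_nat m * ath (int m)"
proof (induction m)
  case 0
  have "fsum (\<lambda>l. ath l * cth l) UNIV = 0"
    by (rule fsum_int_odd) (auto intro: fsummable_ath_mult cth.vge0)
  then show ?case by simp
next
  case (Suc m)
  define c where "c = qX ^ (2 * m + 1)"
  note s1 = fsummable_ath_mult[of "\<lambda>l. cth (int m + l)", OF cth.vge0]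
  note sh = sum_shift[of cth, OF cth.vge0, of m]
  define corr where "corr l = (if l = - int m then - 2 * ath (int (Suc m)) else 0)" for l
  have pt: "ath (l - 1) * cth (int m + l) + c * (ath l * cth (int m + l)) = ath (l - 1) - c * ath l + corr l" for l
  proof (cases "l = - int m")
    case True
    have "ath (- int m - 1) = ath (int (Suc m))"
      using ath_minus[of "int (Suc m)"] minus_int_Suc[of m] by (simp only:)
    with True show ?thesis
      using ath_Suc[of m] by (simp add: corr_def c_def)
  next
    case False
    define Z where "Z = qX powi (2 * (int m + l))"
    have "c = qX powi (1 - 2 * l + 2 * (int m + l))" by (simp add: c_def power_int_def nat_add_distrib nat_mult_distrib)
    then have c: "c = qX powi (1 - 2 * l) * Z" by (simp only: Z_def qX_add)
    have "cth (int m + l) * (1 - Z) = 1 + Z"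
      using one_minus_qX[of "2 * (int m + l)"] False by (simp add: cth_def Z_def)
    then have "- (ath l * qX powi (1 - 2 * l)) * (cth (int m + l) * (1 - Z)) = - (ath l * qX powi (1 - 2 * l)) * (1 + Z)"
      by simp
    then show ?thesis using False unfolding c ath_pred corr_def by (simp add: algebra_simps)
  qed
  have sc: "fsummable corr UNIV"
    using fsummable_mono_neutral[of "{- int m}" UNIV corr] by (simp add: corr_def fsummable_finite)
  have fc: "fsum corr UNIV = - 2 * ath (int (Suc m))"
    using fsum_mono_neutral[of "{- int m}" UNIV corr] by (simp add: corr_def fsum_finite)
  have "fsum (\<lambda>l. ath l * cth (int (Suc m) + l)) UNIV + c * fsum (\<lambda>l. ath l * cth (int m + l)) UNIV
      = fsum (\<lambda>l. ath (l - 1) - c * ath l + corr l) UNIV"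
    unfolding sh(1) fsum_cmult[OF s1, symmetric] fsum_add[OF sh(2) fsummable_cmult[OF s1], symmetric] pt ..
  also have "\<dots> = theta_neg - c * theta_neg - 2 * ath (int (Suc m))"
    by (simp only: fsum_add fsum_diff fsum_ath_pred fsummable_cmult fsummable_diff fsum_cmult
        fsummable_ath sc fc flip: theta_neg_def) simp
  finally have R: "fsum (\<lambda>l. ath l * cth (int (Suc m) + l)) UNIV
      = theta_neg - c * theta_neg - 2 * ath (int (Suc m)) - c * fsum (\<lambda>l. ath l * cth (int m + l)) UNIV"
    by (simp add: algebra_simps)
  have R': "fsum (\<lambda>l. ath l * cth (int m + l)) UNIV = 2 * theta_neg * coneN (-1) m - 2 * of_nat m * ath (int m)"
    using Suc by (simp add: algebra_simps)
  have a: "ath (int (Suc m)) = - (c * ath (int m))" unfolding c_def by (rule ath_Suc)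
  show ?case
    unfolding R R' coneN.simps c_def[symmetric] a by (simp add: field_simps)
qed

section \<open>Ternary sums\<close>

text \<open>Positivity encodes that at most one entry is 0; then no entry exceeds the exponent, see
  \<open>cone_le_exp\<close>.\<close>

definition tcone :: "(nat \<times> nat \<times> nat) set" where
  "tcone = {(x, y, z). x * y + y * z + z * x > 0}"

definition cone_exp :: "nat \<times> nat \<times> nat \<Rightarrow> nat" where
  "cone_exp = (\<lambda>(x, y, z). x * y + y * z + z * x)"

definition cone_term :: "nat \<times> nat \<times> nat \<Rightarrow> complex fls" where
  "cone_term = (\<lambda>(x, y, z). (if x * y * z = 0 then 1/2 else 1) * qX ^ (x * y + y * z + z * x))"

definition cone_sum :: "(nat \<times> nat \<times> nat \<Rightarrow> complex fls) \<Rightarrow> complex fls" where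
  "cone_sum \<sigma> = fsum (\<lambda>p. \<sigma> p * cone_term p) tcone"

lemma vge_half: "vge (1 / 2 :: complex fls) 0"
  using q1.one_plus_Q_power(2)[of 0] by (simp add: inverse_eq_divide)

lemma vge_cone_term: "vge (cone_term p) (int (cone_exp p))"
proof -
  have "vge ((if b then 1/2 else 1) * qX ^ n) (0 + int n)" for b n
    by (intro vge_mult q1.vge_Q_power) (simp add: vge_half)
  then have "vge ((if b then 1/2 else 1) * qX ^ n) (int n)" for b n by simp
  then show ?thesis
    unfolding cone_term_def cone_exp_def by (cases p) (simp only: prod.case)
qed

lemma cone_le_exp:
  assumes "(x, y, z) \<in> tcone"
  shows "x \<le> cone_exp (x, y, z)" "y \<le> cone_exp (x, y, z)" "z \<le> cone_exp (x, y, z)"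
proof -
  have *: "a \<le> a * b + b * c + c * a" if "a * b + b * c + c * a > 0" for a b c :: nat
  proof -
    have "b + c \<ge> 1" using that by (cases "b = 0"; cases "c = 0") auto
    then have "a * 1 \<le> a * (b + c)" by (intro mult_left_mono) auto
    then show ?thesis by (simp add: algebra_simps)
  qed
  show "x \<le> cone_exp (x, y, z)" "y \<le> cone_exp (x, y, z)" "z \<le> cone_exp (x, y, z)"
    using assms *[of x y z] *[of y z x] *[of z x y] by (simp_all add: tcone_def cone_exp_def algebra_simps)
qed

lemma finite_cone_le: "finite {p \<in> tcone. cone_exp p \<le> n}"
proof (rule finite_subset)
  show "{p \<in> tcone. cone_exp p \<le> n} \<subseteq> {..n} \<times> {..n} \<times> {..n}"
    by (auto intro: order_trans[OF cone_le_exp(1)] order_trans[OF cone_le_exp(2)]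
        order_trans[OF cone_le_exp(3)])
qed auto

lemma fsummable_cone:
  assumes "\<And>p. vge (\<sigma> p) 0"
  shows "fsummable (\<lambda>p. \<sigma> p * cone_term p) tcone"
proof (rule fsummableI[where e = "\<lambda>p. int (cone_exp p)"])
  show "vge (\<sigma> p * cone_term p) (int (cone_exp p))" for p
    using vge_mult[OF assms vge_cone_term] by simp
  fix N
  have "{p \<in> tcone. int (cone_exp p) < N} \<subseteq> {p \<in> tcone. cone_exp p \<le> nat N}" by auto
  then show "finite {p \<in> tcone. int (cone_exp p) < N}"
    using finite_cone_le finite_subset by blast
qed

text \<open>Inverse of the coordinates m = x + min(y, z), d = z - y. In them the exponent is m |d| +
  m^2 - x^2, so the sum over d is geometric and the one over x is \<open>coneN\<close>. In
  \<open>tri_dom\<close> the pair x = m, d = 0 is left out because it means y = z = 0.\<close>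

definition tri :: "nat \<times> int \<times> nat \<Rightarrow> nat \<times> nat \<times> nat" where
  "tri = (\<lambda>(m, d, x). (x, m - x + nat (- d), m - x + nat d))"

definition tri_dom :: "nat \<Rightarrow> int \<Rightarrow> nat set" where
  "tri_dom m d = {x. x \<le> m \<and> (x = m \<longrightarrow> d \<noteq> 0)}"

lemma bij_betw_tri: "bij_betw tri (SIGMA m:{1..}. SIGMA d:UNIV. tri_dom m d) tcone"
proof (rule bij_betwI[where g = "\<lambda>(x, y, z). (x + min y z, int z - int y, x)"])
  show "tri \<in> (SIGMA m:{1..}. SIGMA d:UNIV. tri_dom m d) \<rightarrow> tcone"
    by (auto simp: tri_def tri_dom_def tcone_def Pi_def)
  show "(\<lambda>(x, y, z). (x + min y z, int z - int y, x)) \<in> tcone \<rightarrow> (SIGMA m:{1..}. SIGMA d:UNIV. tri_dom m d)"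
    by (auto simp: tri_dom_def tcone_def min_def)
qed (auto simp: tri_def tri_dom_def tcone_def min_def)

lemma tri_exp:
  assumes "x \<le> m"
  shows "(case tri (m, d, x) of (x, y, z) \<Rightarrow> x * y + y * z + z * x) = m * nat \<bar>d\<bar> + (m\<^sup>2 - x\<^sup>2)"
proof -
  obtain k where m: "m = x + k" using assms le_Suc_ex by blast
  have "m\<^sup>2 - x\<^sup>2 = k * k + 2 * (x * k)" by (simp add: m power2_eq_square algebra_simps)
  then show ?thesis
    by (cases "d \<ge> 0") (auto simp: tri_def m algebra_simps)
qed

text \<open>The end weights 1/2 are those of the cone: x = 0 is a zero entry, and x = m means min(y,
  z) = 0.\<close>

lemma coneN_eq:
  assumes "m \<ge> 1"
  shows "coneN \<epsilon> m = (\<Sum>x\<le>m. (if x = 0 \<or> x = m then 1/2 else 1) * \<epsilon> ^ (m - x) * qX ^ (m\<^sup>2 - x\<^sup>2))"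
proof -
  define w :: "nat \<Rightarrow> complex fls" where "w x = (if x = 0 then 1/2 else 1)" for x
  have B: "coneN \<epsilon> (Suc m) = 1/2 + (\<Sum>x\<le>m. w x * \<epsilon> ^ (Suc m - x) * qX ^ ((Suc m)\<^sup>2 - x\<^sup>2))" for m
  proof (induction m)
    case 0
    then show ?case by (simp add: w_def field_simps)
  next
    case (Suc m)
    define c where "c = qX ^ (2 * Suc m + 1)"
    have "w x * \<epsilon> ^ (Suc (Suc m) - x) * qX ^ ((Suc (Suc m))\<^sup>2 - x\<^sup>2)
        = \<epsilon> * c * (w x * \<epsilon> ^ (Suc m - x) * qX ^ ((Suc m)\<^sup>2 - x\<^sup>2))" if "x \<le> m" for x
    proof -
      have "x\<^sup>2 \<le> (Suc m)\<^sup>2" using that by (intro power_mono) auto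
      moreover have "(Suc (Suc m))\<^sup>2 = (Suc m)\<^sup>2 + (2 * Suc m + 1)" by (simp add: power2_eq_square)
      ultimately have "(Suc (Suc m))\<^sup>2 - x\<^sup>2 = ((Suc m)\<^sup>2 - x\<^sup>2) + (2 * Suc m + 1)" by linarith
      then have "qX ^ ((Suc (Suc m))\<^sup>2 - x\<^sup>2) = qX ^ ((Suc m)\<^sup>2 - x\<^sup>2) * c"
        by (simp only: power_add c_def)
      moreover have "Suc (Suc m) - x = Suc (Suc m - x)" using that by simp
      ultimately show ?thesis by (simp only: power_Suc mult_ac)
    qed
    then have "(\<Sum>x\<le>m. w x * \<epsilon> ^ (Suc (Suc m) - x) * qX ^ ((Suc (Suc m))\<^sup>2 - x\<^sup>2))
        = \<epsilon> * c * (\<Sum>x\<le>m. w x * \<epsilon> ^ (Suc m - x) * qX ^ ((Suc m)\<^sup>2 - x\<^sup>2))"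
      unfolding sum_distrib_left by (intro sum.cong) auto
    also have "\<dots> = \<epsilon> * c * (coneN \<epsilon> (Suc m) - 1/2)" unfolding Suc by simp
    finally have 1: "(\<Sum>x\<le>m. w x * \<epsilon> ^ (Suc (Suc m) - x) * qX ^ ((Suc (Suc m))\<^sup>2 - x\<^sup>2))
        = \<epsilon> * c * (coneN \<epsilon> (Suc m) - 1/2)" .
    have "(Suc (Suc m))\<^sup>2 - (Suc m)\<^sup>2 = 2 * Suc m + 1" by (simp add: power2_eq_square)
    then have 2: "w (Suc m) * \<epsilon> ^ (Suc (Suc m) - Suc m) * qX ^ ((Suc (Suc m))\<^sup>2 - (Suc m)\<^sup>2) = \<epsilon> * c"
      by (simp add: w_def c_def)
    show ?case
      unfolding sum.atMost_Suc 1 2 coneN.simps(2)[of \<epsilon> "Suc m"] c_def[symmetric]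
      by (simp add: field_simps)
  qed
  obtain k where m: "m = Suc k" using assms by (cases m) auto
  have "(\<Sum>x\<le>k. (if x = 0 \<or> x = Suc k then 1/2 else 1) * \<epsilon> ^ (Suc k - x) * qX ^ ((Suc k)\<^sup>2 - x\<^sup>2))
     = (\<Sum>x\<le>k. w x * \<epsilon> ^ (Suc k - x) * qX ^ ((Suc k)\<^sup>2 - x\<^sup>2))"
    by (intro sum.cong) (auto simp: w_def)
  then show ?thesis unfolding m B sum.atMost_Suc by simp
qed

text \<open>For d = 0 the end term x = m of \<open>coneN\<close> is not a triple of the cone, so its
  share \<kappa> m 0 / 2 is subtracted. The difference stays under one sum over m because the two
  parts alone need not tend to 0.\<close>

lemma cone_sum_eq:
  assumes \<sigma>: "\<And>m d x. m \<ge> 1 \<Longrightarrow> x \<in> tri_dom m d \<Longrightarrow> \<sigma> (tri (m, d, x)) = \<epsilon> ^ (m - x) * \<kappa> m d"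
    and v\<sigma>: "\<And>p. vge (\<sigma> p) 0" and v\<kappa>: "\<And>m d. vge (\<kappa> m d) 0"
    and K: "\<And>m. m \<ge> 1 \<Longrightarrow> fsum (\<lambda>d. \<kappa> m d * qX ^ (m * nat \<bar>d\<bar>)) UNIV = K m"
  shows "cone_sum \<sigma> = fsum (\<lambda>m. coneN \<epsilon> m * K m - \<kappa> m 0 / 2) {1..}"
    "fsummable (\<lambda>m. coneN \<epsilon> m * K m - \<kappa> m 0 / 2) {1..}"
proof -
  define f where "f m p = (case p of (d, x) \<Rightarrow> \<sigma> (tri (m, d, x)) * cone_term (tri (m, d, x)))" for m p
  let ?J = "SIGMA m:{1..}. SIGMA d:UNIV. tri_dom m d"
  have fe: "(\<lambda>p. \<sigma> (tri p) * cone_term (tri p)) = (\<lambda>(m, p). f m p)"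
    by (auto simp: f_def fun_eq_iff)
  have s: "fsummable (\<lambda>(m, p). f m p) ?J"
    using fsummable_reindex[OF bij_betw_tri, of "\<lambda>p. \<sigma> p * cone_term p"] fsummable_cone[of \<sigma>, OF v\<sigma>]
    unfolding fe by simp
  have e: "cone_sum \<sigma> = fsum (\<lambda>(m, p). f m p) ?J"
    using fsum_reindex[OF bij_betw_tri, of "\<lambda>p. \<sigma> p * cone_term p"]
    unfolding fe cone_sum_def by simp
  have inner: "fsum (f m) (SIGMA d:UNIV. tri_dom m d) = coneN \<epsilon> m * K m - \<kappa> m 0 / 2" if m: "m \<ge> 1" for m
  proof -
    define g where "g d x = f m (d, x)" for d x
    have fg: "f m = (\<lambda>(d, x). g d x)" by (auto simp: g_def fun_eq_iff)
    have s2: "fsummable (\<lambda>(d, x). g d x) (SIGMA d:UNIV. tri_dom m d)"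
      using fsum_Sigma(1)[OF s, of m] m unfolding fg[symmetric] by simp
    define w :: "nat \<Rightarrow> complex fls" where "w x = (if x = 0 \<or> x = m then 1/2 else 1) * \<epsilon> ^ (m - x) * qX ^ (m\<^sup>2 - x\<^sup>2)" for x
    have gx: "g d x = \<kappa> m d * qX ^ (m * nat \<bar>d\<bar>) * w x" if x: "x \<in> tri_dom m d" for d x
    proof -
      have "x \<le> m" using x by (simp add: tri_dom_def)
      have "cone_term (tri (m, d, x)) = (if x = 0 \<or> x = m then 1/2 else 1) * qX ^ (m * nat \<bar>d\<bar> + (m\<^sup>2 - x\<^sup>2))"
        unfolding tri_exp[OF \<open>x \<le> m\<close>, symmetric] using x m
        by (auto simp: cone_term_def tri_def tri_dom_def)
      then show ?thesis
        unfolding g_def f_def prod.case \<sigma>[OF m x] by (simp add: w_def power_add)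
    qed
    have sx: "fsum (g d) (tri_dom m d) = coneN \<epsilon> m * (\<kappa> m d * qX ^ (m * nat \<bar>d\<bar>)) - (if d = 0 then \<kappa> m 0 / 2 else 0)" for d
    proof -
      have fin: "finite (tri_dom m d)" by (rule finite_subset[of _ "{..m}"]) (auto simp: tri_dom_def)
      have "fsum (g d) (tri_dom m d) = (\<Sum>x\<in>tri_dom m d. \<kappa> m d * qX ^ (m * nat \<bar>d\<bar>) * w x)"
        unfolding fsum_finite[OF fin] by (intro sum.cong refl gx)
      also have "\<dots> = \<kappa> m d * qX ^ (m * nat \<bar>d\<bar>) * sum w (tri_dom m d)"
        by (simp add: sum_distrib_left)
      also have "sum w (tri_dom m d) = coneN \<epsilon> m - (if d = 0 then 1/2 else 0)"
      proof (cases "d = 0")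
        case True
        have "{..m} = insert m (tri_dom m d)" "m \<notin> tri_dom m d"
          using True by (auto simp: tri_dom_def)
        then have "coneN \<epsilon> m = w m + sum w (tri_dom m d)"
          unfolding coneN_eq[OF m] w_def[symmetric] using fin by simp
        then show ?thesis using True by (simp add: w_def)
      next
        case False
        then have "tri_dom m d = {..m}" by (auto simp: tri_dom_def)
        then show ?thesis unfolding coneN_eq[OF m] w_def[symmetric] using False by simp
      qed
      finally show ?thesis by (cases "d = 0") (simp_all add: algebra_simps)
    qed
    have sk: "fsummable (\<lambda>d. \<kappa> m d * qX ^ (m * nat \<bar>d\<bar>)) UNIV"
    proof (rule fsummable_abs)
      fix d
      have "nat \<bar>d\<bar> \<le> m * nat \<bar>d\<bar>" using m by simp
      then have "\<bar>d\<bar> \<le> 0 + int (m * nat \<bar>d\<bar>)" by linarith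
      then show "vge (\<kappa> m d * qX ^ (m * nat \<bar>d\<bar>)) \<bar>d\<bar>"
        by (rule vge_mono[OF vge_mult[OF v\<kappa> q1.vge_Q_power]])
    qed
    define h where "h d = (if d = 0 then \<kappa> m 0 / 2 else 0)" for d :: int
    have sh: "fsummable h UNIV" and fh: "fsum h UNIV = \<kappa> m 0 / 2"
      using fsum_mono_neutral[of "{0}" UNIV h] fsummable_mono_neutral[of "{0}" UNIV h]
      by (simp_all add: h_def fsummable_finite fsum_finite)
    have "fsum (f m) (SIGMA d:UNIV. tri_dom m d) = fsum (\<lambda>d. fsum (g d) (tri_dom m d)) UNIV"
      unfolding fg by (rule fsum_Sigma(3)[OF s2])
    also have "\<dots> = fsum (\<lambda>d. coneN \<epsilon> m * (\<kappa> m d * qX ^ (m * nat \<bar>d\<bar>)) - h d) UNIV"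
      unfolding sx h_def ..
    also have "\<dots> = coneN \<epsilon> m * K m - \<kappa> m 0 / 2"
      unfolding fsum_diff[OF fsummable_cmult[OF sk] sh] fsum_cmult[OF sk] fh K[OF m] ..
    finally show ?thesis .
  qed
  show "cone_sum \<sigma> = fsum (\<lambda>m. coneN \<epsilon> m * K m - \<kappa> m 0 / 2) {1..}"
    unfolding e fsum_Sigma(3)[OF s] by (rule fsum_cong) (simp add: inner)
  show "fsummable (\<lambda>m. coneN \<epsilon> m * K m - \<kappa> m 0 / 2) {1..}"
    using fsum_Sigma(2)[OF s] by (subst fsummable_cong) (auto simp: inner)
qed

lemma fsum_geometric_1:
  fixes x :: "complex fls"
  assumes "vge x 1"
  shows "fsummable (\<lambda>n. c * x ^ n) {1..}" "fsum (\<lambda>n. c * x ^ n) {1..} = c * x / (1 - x)"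
proof -
  have bij: "bij_betw Suc UNIV {1..}"
    by (rule bij_betwI[where g = "\<lambda>n. n - 1"]) auto
  have e: "(\<lambda>n. c * x ^ Suc n) = (\<lambda>n. (c * x) * x ^ n)" by (simp add: fun_eq_iff)
  show "fsummable (\<lambda>n. c * x ^ n) {1..}" "fsum (\<lambda>n. c * x ^ n) {1..} = c * x / (1 - x)"
    using fsummable_reindex[OF bij, of "\<lambda>n. c * x ^ n"] fsum_reindex[OF bij, of "\<lambda>n. c * x ^ n"]
      fsum_geometric[OF assms, of "c * x"] unfolding e by simp_all
qed

lemma vge_minus_one_power [simp]: "vge ((-1 :: complex fls) ^ n) 0"
  by (cases "even n") auto

lemma fsum_two_sided:
  assumes "m \<ge> 1" and c: "c = 1 \<or> c = -1" and c': "c' = 1 \<or> c' = -1"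
    and \<kappa>: "\<And>n. n \<ge> 1 \<Longrightarrow> \<kappa> (int n) = a * c ^ n" "\<And>n. n \<ge> 1 \<Longrightarrow> \<kappa> (- int n) = a * c' ^ n"
  shows "fsum (\<lambda>d. \<kappa> d * qX ^ (m * nat \<bar>d\<bar>)) UNIV
    = \<kappa> 0 + a * (c * qX ^ m) / (1 - c * qX ^ m) + a * (c' * qX ^ m) / (1 - c' * qX ^ m)"
    "fsummable (\<lambda>d. \<kappa> d * qX ^ (m * nat \<bar>d\<bar>)) UNIV"
proof -
  let ?x = "qX ^ m"
  have "vge ?x 1" using vge_mono[OF q1.vge_Q_power, of 1 m] assms(1) by simp
  then have vx: "vge (c * ?x) 1" and vx': "vge (c' * ?x) 1" using c c' by auto
  have p: "\<kappa> (int n) * qX ^ (m * nat \<bar>int n\<bar>) = a * (c * ?x) ^ n" if "n \<in> {1..}" for n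
    using that \<kappa>(1) by (simp add: power_mult_distrib mult.assoc flip: power_mult)
  have q: "\<kappa> (- int n) * qX ^ (m * nat \<bar>- int n\<bar>) = a * (c' * ?x) ^ n" if "n \<in> {1..}" for n
    using that \<kappa>(2) by (simp add: power_mult_distrib mult.assoc flip: power_mult)
  show s: "fsummable (\<lambda>d. \<kappa> d * qX ^ (m * nat \<bar>d\<bar>)) UNIV"
  proof (rule fsummable_int_split)
    show "fsummable (\<lambda>n. \<kappa> (int n) * qX ^ (m * nat \<bar>int n\<bar>)) {1..}"
      using fsum_geometric_1(1)[OF vx, of a] by (subst fsummable_cong[OF p]) auto
    show "fsummable (\<lambda>n. \<kappa> (- int n) * qX ^ (m * nat \<bar>- int n\<bar>)) {1..}"
      using fsum_geometric_1(1)[OF vx', of a] by (subst fsummable_cong[OF q]) auto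
  qed
  show "fsum (\<lambda>d. \<kappa> d * qX ^ (m * nat \<bar>d\<bar>)) UNIV
    = \<kappa> 0 + a * (c * ?x) / (1 - c * ?x) + a * (c' * ?x) / (1 - c' * ?x)"
  proof -
    have "fsum (\<lambda>n. \<kappa> (int n) * qX ^ (m * nat \<bar>int n\<bar>)) {1..} = a * (c * ?x) / (1 - c * ?x)"
      unfolding fsum_geometric_1(2)[OF vx, symmetric] by (rule fsum_cong[OF p])
    moreover have "fsum (\<lambda>n. \<kappa> (- int n) * qX ^ (m * nat \<bar>- int n\<bar>)) {1..} = a * (c' * ?x) / (1 - c' * ?x)"
      unfolding fsum_geometric_1(2)[OF vx', symmetric] by (rule fsum_cong[OF q])
    ultimately show ?thesis unfolding fsum_int_split(3)[OF s] by (simp only:) simp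
  qed
qed

lemma qX_frac:
  assumes "m \<ge> 1"
  shows "1 + qX ^ m / (1 - qX ^ m) + (-1 * qX ^ m) / (1 - -1 * qX ^ m) = cth (int m)"
    "qX ^ m / (1 - qX ^ m) + qX ^ m / (1 + qX ^ m) = 2 * qX ^ m / (1 - qX ^ (2 * m))"
proof -
  define x where "x = qX ^ m"
  have "qX powi (2 * int m) = qX ^ (2 * m)"
    using power_int_of_nat[of qX "2 * m"] by simp
  moreover have "qX ^ (2 * m) = x * x" by (simp only: x_def mult_2 power_add)
  ultimately have e: "qX powi (2 * int m) = x * x" "qX ^ (2 * m) = x * x" by simp_all
  have nz: "1 - x \<noteq> 0" "1 + x \<noteq> 0"
    using q1.one_minus_Q_power(1)[of m] q1.one_plus_Q_power(1)[of m] assms by (simp_all add: x_def)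
  have f: "1 - x * x = (1 - x) * (1 + x)" by (simp add: algebra_simps)
  show "1 + qX ^ m / (1 - qX ^ m) + (-1 * qX ^ m) / (1 - -1 * qX ^ m) = cth (int m)"
    unfolding cth_def e f x_def[symmetric] using nz by (simp add: divide_simps) (simp add: algebra_simps)
  show "qX ^ m / (1 - qX ^ m) + qX ^ m / (1 + qX ^ m) = 2 * qX ^ m / (1 - qX ^ (2 * m))"
    unfolding e f x_def[symmetric] using nz by (simp add: divide_simps) (simp add: algebra_simps)
qed

definition T0 :: "complex fls" where "T0 = cone_sum (\<lambda>p. 1)"
definition T1 :: "complex fls" where "T1 = cone_sum (\<lambda>(x, y, z). (-1) ^ (x + y))"
definition T2 :: "complex fls" where "T2 = cone_sum (\<lambda>(x, y, z). (-1) ^ y)"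

lemma bij_rotate: "bij_betw (\<lambda>(x, y, z). (y, z, x)) tcone tcone"
  by (rule bij_betwI[where g = "\<lambda>(y, z, x). (x, y, z)"]) (auto simp: tcone_def)

lemma cone_sum_rotate: "cone_sum (\<lambda>(x, y, z). \<sigma> (y, z, x)) = cone_sum \<sigma>"
proof -
  have "(\<lambda>p. (case p of (x, y, z) \<Rightarrow> \<sigma> (y, z, x)) * cone_term p)
      = (\<lambda>p. \<sigma> (case p of (x, y, z) \<Rightarrow> (y, z, x)) * cone_term (case p of (x, y, z) \<Rightarrow> (y, z, x)))"
    by (auto simp: fun_eq_iff cone_term_def algebra_simps)
  then show ?thesis
    unfolding cone_sum_def using fsum_reindex[OF bij_rotate, of "\<lambda>p. \<sigma> p * cone_term p"] by simp
qed

text \<open>Here (-1)^(x+y) = (-1)^m (-1)^max(-d, 0) is independent of x, so the inner sum does not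
  alternate.\<close>

lemma T1_eq:
  "T1 = fsum (\<lambda>m. coneN 1 m * ((-1) ^ m * cth (int m)) - (-1) ^ m / 2) {1..}"
  "fsummable (\<lambda>m. coneN 1 m * ((-1) ^ m * cth (int m)) - (-1) ^ m / 2) {1..}"
proof -
  define \<kappa> :: "nat \<Rightarrow> int \<Rightarrow> complex fls" where "\<kappa> m d = (-1) ^ m * (-1) ^ nat (- d)" for m d
  have \<kappa>0: "\<kappa> m 0 = (-1) ^ m" for m by (simp add: \<kappa>_def)
  have K: "fsum (\<lambda>d. \<kappa> m d * qX ^ (m * nat \<bar>d\<bar>)) UNIV = (-1) ^ m * cth (int m)" if m: "m \<ge> 1" for m
  proof -
    have "fsum (\<lambda>d. \<kappa> m d * qX ^ (m * nat \<bar>d\<bar>)) UNIV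
        = \<kappa> m 0 + (-1) ^ m * (1 * qX ^ m) / (1 - 1 * qX ^ m) + (-1) ^ m * (-1 * qX ^ m) / (1 - -1 * qX ^ m)"
      by (rule fsum_two_sided(1)[OF m]) (auto simp: \<kappa>_def)
    then show ?thesis
      unfolding qX_frac(1)[OF m, symmetric] \<kappa>0 distrib_left by simp
  qed
  have \<sigma>: "(case tri (m, d, x) of (x, y, z) \<Rightarrow> (-1) ^ (x + y)) = 1 ^ (m - x) * \<kappa> m d" if "x \<in> tri_dom m d" for m d x
    using that by (simp add: tri_def tri_dom_def \<kappa>_def flip: power_add)
  have v: "vge (\<kappa> m d) 0" for m d
    unfolding \<kappa>_def power_add[symmetric] by (rule vge_minus_one_power)
  have *: "T1 = fsum (\<lambda>m. coneN 1 m * ((-1) ^ m * cth (int m)) - \<kappa> m 0 / 2) {1..}"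
    "fsummable (\<lambda>m. coneN 1 m * ((-1) ^ m * cth (int m)) - \<kappa> m 0 / 2) {1..}"
    unfolding T1_def
    by (rule cone_sum_eq[where \<kappa> = \<kappa>, OF \<sigma> _ v K]; auto)+
  then show "T1 = fsum (\<lambda>m. coneN 1 m * ((-1) ^ m * cth (int m)) - (-1) ^ m / 2) {1..}"
    "fsummable (\<lambda>m. coneN 1 m * ((-1) ^ m * cth (int m)) - (-1) ^ m / 2) {1..}"
    by (simp_all only: \<kappa>0)
qed

text \<open>Here (-1)^y = (-1)^(m-x) (-1)^max(-d, 0), so the inner sum alternates and coth
  enters.\<close>

lemma T2_eq:
  "T2 = fsum (\<lambda>m. coneN (-1) m * cth (int m) - 1 / 2) {1..}"
  "fsummable (\<lambda>m. coneN (-1) m * cth (int m) - 1 / 2) {1..}"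
proof -
  define \<kappa> :: "nat \<Rightarrow> int \<Rightarrow> complex fls" where "\<kappa> m d = (-1) ^ nat (- d)" for m d
  have K: "fsum (\<lambda>d. \<kappa> m d * qX ^ (m * nat \<bar>d\<bar>)) UNIV = cth (int m)" if m: "m \<ge> 1" for m
  proof -
    have "fsum (\<lambda>d. \<kappa> m d * qX ^ (m * nat \<bar>d\<bar>)) UNIV
        = \<kappa> m 0 + 1 * (1 * qX ^ m) / (1 - 1 * qX ^ m) + 1 * (-1 * qX ^ m) / (1 - -1 * qX ^ m)"
      by (rule fsum_two_sided(1)[OF m]) (auto simp: \<kappa>_def)
    then show ?thesis unfolding qX_frac(1)[OF m, symmetric] by (simp add: \<kappa>_def)
  qed
  have \<sigma>: "(case tri (m, d, x) of (x, y, z) \<Rightarrow> (-1) ^ y) = (-1) ^ (m - x) * \<kappa> m d" for m d x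
    by (simp add: tri_def \<kappa>_def power_add)
  have *: "T2 = fsum (\<lambda>m. coneN (-1) m * cth (int m) - \<kappa> m 0 / 2) {1..}"
    "fsummable (\<lambda>m. coneN (-1) m * cth (int m) - \<kappa> m 0 / 2) {1..}"
    unfolding T2_def
    by (rule cone_sum_eq[where \<kappa> = \<kappa>, OF \<sigma> _ _ K]; auto simp: \<kappa>_def)+
  then show "T2 = fsum (\<lambda>m. coneN (-1) m * cth (int m) - 1 / 2) {1..}"
    "fsummable (\<lambda>m. coneN (-1) m * cth (int m) - 1 / 2) {1..}"
    by (simp_all add: \<kappa>_def)
qed

text \<open>After a rotation T1 carries the sign (-1)^(y+z) = (-1)^d. The difference keeps only odd
  d, with weight 2, which is a geometric series in q^(2m) without a boundary term at d = 0.\<close>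

lemma T0_minus_T1_eq:
  "T0 - T1 = fsum (\<lambda>m. coneN 1 m * (4 * qX ^ m / (1 - qX ^ (2 * m)))) {1..}"
  "fsummable (\<lambda>m. coneN 1 m * (4 * qX ^ m / (1 - qX ^ (2 * m)))) {1..}"
proof -
  define \<kappa> :: "nat \<Rightarrow> int \<Rightarrow> complex fls" where "\<kappa> m d = 1 - (-1) ^ nat \<bar>d\<bar>" for m d
  define \<sigma> :: "nat \<times> nat \<times> nat \<Rightarrow> complex fls" where "\<sigma> = (\<lambda>(x, y, z). 1 - (-1) ^ (y + z))"
  have v1: "vge (1 - (-1 :: complex fls) ^ n) 0" for n
    by (rule vge_diff) auto
  have K: "fsum (\<lambda>d. \<kappa> m d * qX ^ (m * nat \<bar>d\<bar>)) UNIV = 4 * qX ^ m / (1 - qX ^ (2 * m))" if m: "m \<ge> 1" for m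
  proof -
    note a = fsum_two_sided[OF m, where c = 1 and c' = 1 and a = 1 and \<kappa> = "\<lambda>d. 1"]
    note b = fsum_two_sided[OF m, where c = "-1" and c' = "-1" and a = 1 and \<kappa> = "\<lambda>d. (-1) ^ nat \<bar>d\<bar>"]
    have s: "fsummable (\<lambda>d. 1 * qX ^ (m * nat \<bar>d\<bar>)) UNIV" "fsummable (\<lambda>d. (-1) ^ nat \<bar>d\<bar> * qX ^ (m * nat \<bar>d\<bar>)) UNIV"
      by (rule a(2); simp) (rule b(2); simp)
    have "fsum (\<lambda>d. \<kappa> m d * qX ^ (m * nat \<bar>d\<bar>)) UNIV
       = fsum (\<lambda>d. 1 * qX ^ (m * nat \<bar>d\<bar>)) UNIV - fsum (\<lambda>d. (-1) ^ nat \<bar>d\<bar> * qX ^ (m * nat \<bar>d\<bar>)) UNIV"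
      unfolding fsum_diff[OF s, symmetric] by (simp add: \<kappa>_def left_diff_distrib)
    also have "fsum (\<lambda>d. 1 * qX ^ (m * nat \<bar>d\<bar>)) UNIV = 1 + 2 * (qX ^ m / (1 - qX ^ m))"
      using a(1) by simp
    also have "fsum (\<lambda>d. (-1) ^ nat \<bar>d\<bar> * qX ^ (m * nat \<bar>d\<bar>)) UNIV = 1 - 2 * (qX ^ m / (1 + qX ^ m))"
      using b(1) by simp
    finally have "fsum (\<lambda>d. \<kappa> m d * qX ^ (m * nat \<bar>d\<bar>)) UNIV = 2 * (qX ^ m / (1 - qX ^ m) + qX ^ m / (1 + qX ^ m))"
      by (simp add: algebra_simps)
    then show ?thesis unfolding qX_frac(2)[OF m] by simp
  qed
  have ts: "\<sigma> (tri (m, d, x)) = 1 ^ (m - x) * \<kappa> m d" if "x \<in> tri_dom m d" for m d x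
  proof -
    have "(-1 :: complex fls) ^ ((m - x + nat (- d)) + (m - x + nat d)) = (-1) ^ (2 * (m - x) + nat \<bar>d\<bar>)"
      by (rule arg_cong[where f = "\<lambda>n. (-1) ^ n"]) auto
    then show ?thesis by (simp add: \<sigma>_def tri_def \<kappa>_def power_add power_mult)
  qed
  have *: "cone_sum \<sigma> = fsum (\<lambda>m. coneN 1 m * (4 * qX ^ m / (1 - qX ^ (2 * m))) - \<kappa> m 0 / 2) {1..}"
    "fsummable (\<lambda>m. coneN 1 m * (4 * qX ^ m / (1 - qX ^ (2 * m))) - \<kappa> m 0 / 2) {1..}"
    by (rule cone_sum_eq[where \<kappa> = \<kappa>, OF ts _ _ K]; auto simp: \<sigma>_def \<kappa>_def v1)+
  have "cone_sum \<sigma> = T0 - cone_sum (\<lambda>(x, y, z). (-1) ^ (y + z))"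
  proof -
    have "fsummable (\<lambda>p. (\<lambda>p. 1) p * cone_term p) tcone"
      "fsummable (\<lambda>p. (\<lambda>(x, y, z). (-1) ^ (y + z)) p * cone_term p) tcone"
      by (rule_tac [!] fsummable_cone) auto
    note s = this
    have "(\<lambda>p. \<sigma> p * cone_term p) = (\<lambda>p. 1 * cone_term p - (case p of (x, y, z) \<Rightarrow> (-1) ^ (y + z)) * cone_term p)"
      by (auto simp: \<sigma>_def fun_eq_iff left_diff_distrib)
    then show ?thesis
      unfolding T0_def cone_sum_def by (simp only: fsum_diff[OF s])
  qed
  also have "cone_sum (\<lambda>(x, y, z). (-1) ^ (y + z)) = T1"
    using cone_sum_rotate[of "\<lambda>(x, y, z). (-1) ^ (x + y)"] by (simp add: T1_def)
  finally have "T0 - T1 = cone_sum \<sigma>" by simp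
  then show "T0 - T1 = fsum (\<lambda>m. coneN 1 m * (4 * qX ^ m / (1 - qX ^ (2 * m)))) {1..}"
    "fsummable (\<lambda>m. coneN 1 m * (4 * qX ^ m / (1 - qX ^ (2 * m)))) {1..}"
    using * by (simp_all add: \<kappa>_def)
qed

section \<open>Products of the ternary sums with theta(-q)\<close>

lemma theta_neg_nonzero: "theta_neg \<noteq> 0"
proof
  assume "theta_neg = 0"
  have "vge (theta_neg - sum ath {0}) 1"
    unfolding theta_neg_def
  proof (rule fsum_approx[OF fsummable_ath])
    fix l :: int assume "l \<in> UNIV - {0}"
    then show "vge (ath l) 1" by (intro vge_mono[OF vge_ath_abs]) auto
  qed auto
  with \<open>theta_neg = 0\<close> show False by (simp add: ath_def)
qed

text \<open>Averaging over l and -l brings the sums into the shape of the addition theorems.\<close>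

lemma fsum_ath_symmetrize:
  assumes "\<And>l. vge (\<phi> l) 0"
  shows "2 * (c * fsum (\<lambda>l. ath l * \<phi> (m + l)) UNIV - theta_neg)
      = fsum (\<lambda>l. ath l * (c * (\<phi> (m + l) + \<phi> (m - l)) - 2)) UNIV"
    "2 * fsum (\<lambda>l. ath l * \<phi> (m + l)) UNIV = fsum (\<lambda>l. ath l * (\<phi> (m + l) + \<phi> (m - l))) UNIV"
proof -
  have s: "fsummable (\<lambda>l. ath l * \<phi> (m + l)) UNIV" by (intro fsummable_ath_mult assms)
  show 2: "2 * fsum (\<lambda>l. ath l * \<phi> (m + l)) UNIV = fsum (\<lambda>l. ath l * (\<phi> (m + l) + \<phi> (m - l))) UNIV"
    unfolding fsum_int_symmetrize(2)[OF s, symmetric] by (rule fsum_cong) (simp add: distrib_left)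
  have s': "fsummable (\<lambda>l. ath l * (\<phi> (m + l) + \<phi> (m - l))) UNIV"
    by (intro fsummable_ath_mult vge_add assms)
  have "2 * (c * fsum (\<lambda>l. ath l * \<phi> (m + l)) UNIV - theta_neg)
      = c * fsum (\<lambda>l. ath l * (\<phi> (m + l) + \<phi> (m - l))) UNIV - 2 * theta_neg"
    unfolding 2[symmetric] by (simp add: algebra_simps)
  also have "\<dots> = fsum (\<lambda>l. c * (ath l * (\<phi> (m + l) + \<phi> (m - l))) - 2 * ath l) UNIV"
    unfolding theta_neg_def
    by (simp only: fsum_diff fsum_cmult s' fsummable_ath fsummable_cmult)
  also have "\<dots> = fsum (\<lambda>l. ath l * (c * (\<phi> (m + l) + \<phi> (m - l)) - 2)) UNIV"
    by (rule fsum_cong) (simp add: algebra_simps)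
  finally show "2 * (c * fsum (\<lambda>l. ath l * \<phi> (m + l)) UNIV - theta_neg)
      = fsum (\<lambda>l. ath l * (c * (\<phi> (m + l) + \<phi> (m - l)) - 2)) UNIV" .
qed

text \<open>Row m becomes a sum over l by \<open>theta_coneN_pos\<close> and
  \<open>tnh_addition\<close>. After the exchange, \<open>telescoping\<close> with c = -1 sums each
  column to another factor tanh(l t).\<close>

lemma theta_T1: "4 * theta_neg * T1 = fsum (\<lambda>l. ath l * (tnh l)\<^sup>2) UNIV"
proof -
  define C where "C m l = - ((-1) ^ m * tnh l) * (ath l * (tnh (int m + l) - tnh (int m - l)))" for m l
  have vC: "vge (C m l) (max (int m) \<bar>l\<bar>)" for m l
    unfolding C_def
    by (intro tnh.vge_ath_mult_diff) (simp add: vge_mult'[OF vge_minus_one_power tnh.vge0])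
  have s: "fsummable (\<lambda>(m, l). C m l) ({1..} \<times> UNIV)"
    by (rule fsummable_max) (rule vC)
  have m: "4 * theta_neg * (coneN 1 m * ((-1) ^ m * cth (int m)) - (-1) ^ m / 2) = fsum (C m) UNIV"
    if "m \<in> {1..}" for m
  proof -
    have sc: "fsummable (\<lambda>l. ath l * (cth (int m) * (tnh (int m + l) + tnh (int m - l)) - 2)) UNIV"
      by (intro fsummable_ath_mult vge_diff vge_mult'[of _ 0 _ 0] vge_add tnh.vge0 cth.vge0 vge_numeral) auto
    have "4 * theta_neg * (coneN 1 m * ((-1) ^ m * cth (int m)) - (-1) ^ m / 2)
        = (-1) ^ m * (2 * (cth (int m) * (2 * theta_neg * coneN 1 m) - theta_neg))"
      by (simp add: field_simps)
    also have "\<dots> = (-1) ^ m * fsum (\<lambda>l. ath l * (cth (int m) * (tnh (int m + l) + tnh (int m - l)) - 2)) UNIV"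
      unfolding theta_coneN_pos fsum_ath_symmetrize(1)[of tnh, OF tnh.vge0] ..
    also have "\<dots> = fsum (C m) UNIV"
      unfolding fsum_cmult[OF sc, symmetric]
      by (rule fsum_cong) (use that in \<open>simp add: tnh_addition C_def\<close>)
    finally show ?thesis .
  qed
  have l: "fsum (\<lambda>m. C m l) {1..} = ath l * (tnh l)\<^sup>2" for l
  proof -
    have s1: "fsummable (\<lambda>m. (-1) ^ m * (tnh (int m + l) - tnh (int m - l))) {1..}"
    proof -
      have "vge ((-1 :: complex fls) ^ m * f) N \<longleftrightarrow> vge f N" for m f N
        by (cases "even m") auto
      then show ?thesis using tnh.summable_diff[of l "{1..}"] by (simp add: fsummable_def)
    qed
    have "fsum (\<lambda>m. C m l) {1..} = fsum (\<lambda>m. (- (tnh l * ath l)) * ((-1) ^ m * (tnh (int m + l) - tnh (int m - l)))) {1..}"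
      by (rule fsum_cong) (simp add: C_def mult_ac)
    also have "\<dots> = (- (tnh l * ath l)) * (of_int l * (1 + -1) - tnh l)"
      unfolding fsum_cmult[OF s1] by (subst tnh.telescoping) auto
    finally show ?thesis by (simp add: power2_eq_square mult_ac)
  qed
  have "4 * theta_neg * T1 = fsum (\<lambda>m. fsum (C m) UNIV) {1..}"
    unfolding T1_eq(1) fsum_cmult[OF T1_eq(2), symmetric] by (rule fsum_cong) (rule m)
  also have "\<dots> = fsum (\<lambda>l. fsum (\<lambda>m. C m l) {1..}) UNIV"
    by (rule fsum_swap[OF s])
  finally show ?thesis unfolding l .
qed

text \<open>Here the column sums are immediate: for m >= 1 the arguments l + m and l - m run through
  all integers except l.\<close>

lemma theta_T0_minus_T1:
  "theta_neg * (T0 - T1) = 2 * fsum (\<lambda>l. ath l * (sech l * (sech_sum - sech l))) UNIV"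
proof -
  define C where "C m l = (2 * (ath l * sech l)) * (sech (int m + l) + sech (int m - l))" for m l
  have vC: "vge (C m l) (max (int m) \<bar>l\<bar>)" for m l
  proof -
    have a: "vge (sech (int m + l) + sech (int m - l)) (int m - \<bar>l\<bar>)"
      by (intro vge_add vge_mono[OF vge_sech]) auto
    have b: "vge (sech (int m + l) + sech (int m - l)) 0"
      by (intro vge_add vge_sech0)
    have c: "vge (2 * (ath l * sech l)) (0 + (\<bar>l\<bar> + \<bar>l\<bar>))"
      by (intro vge_mult vge_numeral vge_ath_abs vge_sech) simp
    from vge_mult[OF c a] vge_mult[OF c b] show ?thesis unfolding C_def[symmetric] by (auto simp: max_def elim!: vge_mono)
  qed
  have s: "fsummable (\<lambda>(m, l). C m l) ({1..} \<times> UNIV)"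
    by (rule fsummable_max) (rule vC)
  have m: "theta_neg * (coneN 1 m * (4 * qX ^ m / (1 - qX ^ (2 * m)))) = fsum (C m) UNIV"
    if "m \<in> {1..}" for m
  proof -
    let ?c = "qX powi (int m) / (1 - qX powi (2 * int m))"
    have c: "4 * qX ^ m / (1 - qX ^ (2 * m)) = 4 * ?c"
      by (simp add: power_int_def nat_mult_distrib)
    have sc: "fsummable (\<lambda>l. ath l * (tnh (int m + l) + tnh (int m - l))) UNIV"
      by (intro fsummable_ath_mult vge_add tnh.vge0)
    have "theta_neg * (coneN 1 m * (4 * ?c)) = ?c * (2 * (2 * theta_neg * coneN 1 m))"
      by simp
    also have "\<dots> = ?c * fsum (\<lambda>l. ath l * (tnh (int m + l) + tnh (int m - l))) UNIV"
      unfolding theta_coneN_pos fsum_ath_symmetrize(2)[of tnh, OF tnh.vge0] ..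
    also have "\<dots> = fsum (C m) UNIV"
      unfolding fsum_cmult[OF sc, symmetric]
    proof (rule fsum_cong)
      fix l
      have "?c * (ath l * (tnh (int m + l) + tnh (int m - l))) = ath l * (?c * (tnh (int m + l) + tnh (int m - l)))"
        by simp
      also have "\<dots> = C m l"
        using that by (subst tnh_sech_addition) (auto simp: C_def)
      finally show "?c * (ath l * (tnh (int m + l) + tnh (int m - l))) = C m l" .
    qed
    finally show ?thesis unfolding c .
  qed
  have l: "fsum (\<lambda>m. C m l) {1..} = 2 * (ath l * (sech l * (sech_sum - sech l)))" for l
  proof -
    have s1: "fsummable (\<lambda>k. sech (k + l)) UNIV"
      using fsum_int_shift(2)[of sech l] fsummable_sech by simp
    have e: "sech (- int m + l) = sech (int m - l)" for m
      using sech_minus[of "int m - l"] by (simp add: algebra_simps)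
    note sp = fsum_int_split[OF s1, unfolded e]
    have ss: "sech_sum = sech l + fsum (\<lambda>m. sech (int m + l)) {1..} + fsum (\<lambda>m. sech (int m - l)) {1..}"
      unfolding sech_sum_def using sp(3) fsum_int_shift(1)[of sech l] by simp
    have "fsum (\<lambda>m. sech (int m + l) + sech (int m - l)) {1..} = sech_sum - sech l"
      unfolding ss fsum_add[OF sp(1,2)] by simp
    then show ?thesis
      unfolding C_def fsum_cmult[OF fsummable_add[OF sp(1,2)]] by simp
  qed
  have sl: "fsummable (\<lambda>l. ath l * (sech l * (sech_sum - sech l))) UNIV"
  proof -
    have "vge sech_sum 0"
      unfolding sech_sum_def by (rule fsum_vge[OF fsummable_sech vge_sech0])
    then show ?thesis
      by (intro fsummable_ath_mult vge_mult'[of _ 0 _ 0] vge_diff vge_sech0) auto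
  qed
  have "theta_neg * (T0 - T1) = fsum (\<lambda>m. fsum (C m) UNIV) {1..}"
    unfolding T0_minus_T1_eq(1) fsum_cmult[OF T0_minus_T1_eq(2), symmetric] by (rule fsum_cong) (rule m)
  also have "\<dots> = fsum (\<lambda>l. fsum (\<lambda>m. C m l) {1..}) UNIV"
    by (rule fsum_swap[OF s])
  finally show ?thesis unfolding l fsum_cmult[OF sl] .
qed

lemma fsummable_ath_sech_sq: "fsummable (\<lambda>l. ath l * (sech l)\<^sup>2) UNIV"
  using vge_mult[OF vge_sech0 vge_sech0] by (intro fsummable_ath_mult) (simp add: power2_eq_square)

lemma fsum_ath_tnh_sq:
  "fsum (\<lambda>l. ath l * (tnh l)\<^sup>2) UNIV = theta_neg - 4 * fsum (\<lambda>l. ath l * (sech l)\<^sup>2) UNIV"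
proof -
  have "fsum (\<lambda>l. ath l * (tnh l)\<^sup>2) UNIV = fsum (\<lambda>l. ath l - 4 * (ath l * (sech l)\<^sup>2)) UNIV"
    by (rule fsum_cong) (simp add: tnh_sq algebra_simps)
  also have "\<dots> = theta_neg - 4 * fsum (\<lambda>l. ath l * (sech l)\<^sup>2) UNIV"
    unfolding theta_neg_def
    by (simp only: fsum_diff fsum_cmult fsummable_ath fsummable_cmult fsummable_ath_sech_sq)
  finally show ?thesis .
qed

theorem eulerian2_eq: "q2.eulerian = 1 - 4 * T1"
proof -
  have "theta_neg * q2.eulerian = theta_neg * (1 - 4 * T1)"
    using theta_T1 fsum_ath_tnh_sq theta_eulerian2 by (simp add: algebra_simps)
  then show ?thesis using theta_neg_nonzero by simp
qed

text \<open>After multiplication by theta(-q) the sums of \<open>ath l\<close> times the square of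
  \<open>sech l\<close> coming from T0 - T1 and from T1 cancel. What remains is
  \<open>2 * sech_sum\<close>, which is theta^2, times \<open>2 * S\<close>, which is theta(q)
  theta(-q).\<close>

theorem theta_cubed: "theta_pos ^ 3 = 1 + 2 * T0 - 6 * T1"
proof -
  define S where "S = fsum (\<lambda>l. ath l * sech l) UNIV"
  have s: "fsummable (\<lambda>l. ath l * sech l) UNIV" by (rule fsummable_ath_mult[OF vge_sech0])
  have "fsum (\<lambda>l. ath l * (sech l * (sech_sum - sech l))) UNIV
      = fsum (\<lambda>l. sech_sum * (ath l * sech l) - ath l * (sech l)\<^sup>2) UNIV"
    by (rule fsum_cong) (simp add: algebra_simps power2_eq_square)
  also have "\<dots> = sech_sum * S - fsum (\<lambda>l. ath l * (sech l)\<^sup>2) UNIV"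
    unfolding S_def by (simp only: fsum_diff fsum_cmult s fsummable_cmult fsummable_ath_sech_sq)
  finally have e: "theta_neg * (T0 - T1) = 2 * (sech_sum * S - fsum (\<lambda>l. ath l * (sech l)\<^sup>2) UNIV)"
    by (simp only: theta_T0_minus_T1)
  have "theta_neg * (1 + 2 * T0 - 6 * T1) = theta_neg + 2 * (theta_neg * (T0 - T1)) - 4 * theta_neg * T1"
    by (simp add: algebra_simps)
  also have "\<dots> = 4 * sech_sum * S"
    unfolding e theta_T1 fsum_ath_tnh_sq by (simp add: algebra_simps)
  also have "\<dots> = (2 * sech_sum) * (2 * S)" by simp
  also have "\<dots> = theta_neg * theta_pos ^ 3"
    unfolding two_squares[symmetric] S_def theta_product by (simp add: power2_eq_square power3_eq_cube)
  finally show ?thesis using theta_neg_nonzero by simp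
qed

section \<open>Lambert series and the product with T2\<close>

lemma fsum_atLeast_1:
  fixes f :: "nat \<Rightarrow> complex fls"
  assumes "f 0 = 0"
  shows "fsum f {1..} = fsum f UNIV" "fsummable f {1..} \<longleftrightarrow> fsummable f UNIV"
proof -
  have *: "f i = 0" if "i \<in> UNIV - {1..}" for i
    using that assms by (cases i) auto
  show "fsum f {1..} = fsum f UNIV" "fsummable f {1..} \<longleftrightarrow> fsummable f UNIV"
    by (rule fsum_mono_neutral fsummable_mono_neutral, simp, rule *, simp)+
qed

text \<open>Both sides are the sum of \<open>j y\<^bsup>n j\<^esup>\<close>, summed in either order.\<close>

lemma lambert_swap:
  fixes y :: "complex fls"
  assumes y: "vge y 1"
  shows "fsum (\<lambda>n. y ^ n / (1 - y ^ n)\<^sup>2) {1..} = fsum (\<lambda>n. of_nat n * y ^ n / (1 - y ^ n)) {1..}"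
    "fsummable (\<lambda>n. y ^ n / (1 - y ^ n)\<^sup>2) {1..}" "fsummable (\<lambda>n. of_nat n * y ^ n / (1 - y ^ n)) {1..}"
proof -
  have vy: "vge (y ^ n) (int n)" for n using vge_power[OF y, of n] by simp
  define f where "f n j = of_nat j * (y ^ n) ^ j" for n j :: nat
  have s: "fsummable (\<lambda>(n, j). f n j) ({1..} \<times> {1..})"
  proof (rule fsummableI[where e = "\<lambda>(n, j). int (n * j)"])
    fix p :: "nat \<times> nat"
    obtain n j where p: "p = (n, j)" by fastforce
    have "vge (of_nat j * (y ^ n) ^ j) (0 + int j * int n)"
      by (intro vge_mult vge_power vy vge_of_nat) simp
    then show "vge (case p of (n, j) \<Rightarrow> f n j) (case p of (n, j) \<Rightarrow> int (n * j))"
      by (simp add: p f_def mult.commute)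
  next
    fix N
    have "n \<le> nat N \<and> j \<le> nat N" if "int (n * j) < N" "n \<ge> 1" "j \<ge> 1" for n j
    proof -
      have "n * 1 \<le> n * j" "1 * j \<le> n * j" using that by (intro mult_le_mono; simp)+
      with that(1) show ?thesis by linarith
    qed
    then have "{p \<in> {1..} \<times> {1..}. (case p of (n, j) \<Rightarrow> int (n * j)) < N} \<subseteq> {..nat N} \<times> {..nat N}"
      by (auto simp del: of_nat_mult)
    then show "finite {p \<in> {1..} \<times> {1..}. (case p of (n, j) \<Rightarrow> int (n * j)) < N}"
      using finite_subset by blast
  qed
  have v1: "vge (y ^ n) 1" if "n \<in> {1..}" for n
    by (rule vge_mono[OF vy]) (use that in auto)
  have r: "fsum (\<lambda>j. f n j) {1..} = y ^ n / (1 - y ^ n)\<^sup>2" if "n \<in> {1..}" for n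
  proof -
    have "fsum (f n) {1..} = fsum (f n) UNIV" by (rule fsum_atLeast_1(1)) (simp add: f_def)
    also have "\<dots> = fsum (\<lambda>j. 1 * of_nat (1 * j + 0) * (y ^ n) ^ j) UNIV"
      by (rule fsum_cong) (simp add: f_def)
    also have "\<dots> = y ^ n / (1 - y ^ n)\<^sup>2"
      unfolding fsum_arith_geometric(2)[OF v1[OF that]] by simp
    finally show ?thesis .
  qed
  have c: "fsum (\<lambda>n. f n j) {1..} = of_nat j * y ^ j / (1 - y ^ j)" if "j \<in> {1..}" for j
  proof -
    have "(\<lambda>n. f n j) = (\<lambda>n. of_nat j * (y ^ j) ^ n)"
      by (simp add: f_def fun_eq_iff mult.commute flip: power_mult)
    then show ?thesis using fsum_geometric_1(2)[OF v1[OF that]] by simp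
  qed
  have "fsum (\<lambda>n. fsum (f n) {1..}) {1..} = fsum (\<lambda>j. fsum (\<lambda>n. f n j) {1..}) {1..}"
    by (rule fsum_swap[OF s])
  also have "fsum (\<lambda>n. fsum (f n) {1..}) {1..} = fsum (\<lambda>n. y ^ n / (1 - y ^ n)\<^sup>2) {1..}"
    by (rule fsum_cong) (rule r)
  also have "fsum (\<lambda>j. fsum (\<lambda>n. f n j) {1..}) {1..} = fsum (\<lambda>n. of_nat n * y ^ n / (1 - y ^ n)) {1..}"
    by (rule fsum_cong) (rule c)
  finally show "fsum (\<lambda>n. y ^ n / (1 - y ^ n)\<^sup>2) {1..} = fsum (\<lambda>n. of_nat n * y ^ n / (1 - y ^ n)) {1..}" .
  have swap: "bij_betw prod.swap ({1::nat..} \<times> {1::nat..}) ({1..} \<times> {1..})"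
    by (rule bij_betwI[where g = prod.swap]) auto
  have s': "fsummable (\<lambda>(j, n). f n j) ({1..} \<times> {1..})"
  proof -
    have "(\<lambda>p. case prod.swap p of (n, j) \<Rightarrow> f n j) = (\<lambda>(j, n). f n j)"
      by (auto simp: fun_eq_iff)
    then show ?thesis using fsummable_reindex[OF swap, of "\<lambda>(n, j). f n j"] s by simp
  qed
  show "fsummable (\<lambda>n. y ^ n / (1 - y ^ n)\<^sup>2) {1..}"
    using fsum_Sigma(2)[OF s] by (subst fsummable_cong[OF r[symmetric]])
  show "fsummable (\<lambda>n. of_nat n * y ^ n / (1 - y ^ n)) {1..}"
    using fsum_Sigma(2)[OF s'] by (subst fsummable_cong[OF c[symmetric]])
qed

text \<open>Expanded, the left side has terms (-1)^k (d - k) p^(k d / 2) over k < d of opposite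
  parity; \<open>eo\<close> turns them into (2i + 1 - 2n) p^(n (2i + 1)). Let a and b be the sums of
  p^n / (1 - p^n)^2 for p and for p^2. By \<open>lambert_swap\<close> the two halves are a - 2b and
  2 (a - b), and their difference is -a.\<close>

lemma lambert_triangular:
  fixes p :: "complex fls"
  assumes p: "vge p 1"
  shows "fsum (\<lambda>k. (-1) ^ k * p ^ (k * (k + 1) div 2) * (1 + p ^ k) / (1 - p ^ k)\<^sup>2) {1..}
      = - fsum (\<lambda>n. p ^ n / (1 - p ^ n)\<^sup>2) {1..}"
    "fsummable (\<lambda>k. (-1) ^ k * p ^ (k * (k + 1) div 2) * (1 + p ^ k) / (1 - p ^ k)\<^sup>2) {1..}"
proof -
  have vp: "vge (p ^ n) (int n)" for n using vge_power[OF p, of n] by simp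
  have v1: "vge (p ^ n) 1" if "n \<in> {1..}" for n
    by (rule vge_mono[OF vp]) (use that in auto)
  define B where "B k j = (-1) ^ k * of_nat (2 * j + 1) * p ^ (k * (k + 2 * j + 1) div 2)" for k j :: nat
  define C where "C n i = (of_nat (2 * i + 1) - of_nat (2 * n)) * p ^ (n * (2 * i + 1))" for n i :: nat
  have vC: "vge (C n i) (int (n + i))" if "n \<ge> 1" for n i
  proof -
    have "i \<le> n * i" using that by simp
    then have "n + i \<le> n * (2 * i + 1)" by (simp add: algebra_simps)
    then have le: "int (n + i) \<le> 0 + int (n * (2 * i + 1))" by linarith
    show ?thesis
      unfolding C_def by (rule vge_mono[OF vge_mult[OF vge_diff[OF vge_of_nat vge_of_nat] vp] le]) auto
  qed
  have sC: "fsummable (\<lambda>(n, i). C n i) ({1..} \<times> UNIV)"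
    by (rule fsummable_nat_pair) (use vC in auto)
  have BC: "(case eo p of (n, i) \<Rightarrow> C n i) = (case p of (k, j) \<Rightarrow> B k j)" for p
  proof -
    obtain k j n i where p: "p = (k, j)" "eo (k, j) = (n, i)" by (metis surj_pair)
    have "k * (k + 2 * j + 1) div 2 = n * (2 * i + 1)"
      unfolding eo_product(1)[OF p(2)] by simp
    then show ?thesis
      using eo_product(3)[OF p(2), where ?'a = "complex fls"]
      unfolding p prod.case B_def C_def by (simp only:)
  qed
  have sB: "fsummable (\<lambda>(k, j). B k j) ({1..} \<times> UNIV)"
    using fsummable_reindex[OF bij_betw_eo, of "\<lambda>(n, i). C n i"] sC by (simp add: BC)
  have "fsum (\<lambda>(k, j). B k j) ({1..} \<times> UNIV) = fsum (\<lambda>(n, i). C n i) ({1..} \<times> UNIV)"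
    using fsum_reindex[OF bij_betw_eo, of "\<lambda>(n, i). C n i"] by (simp add: BC)
  then have BCsum: "fsum (\<lambda>k. fsum (B k) UNIV) {1..} = fsum (\<lambda>n. fsum (C n) UNIV) {1..}"
    using fsum_Sigma(3)[OF sB] fsum_Sigma(3)[OF sC] by simp
  have Bk: "fsum (B k) UNIV = (-1) ^ k * p ^ (k * (k + 1) div 2) * (1 + p ^ k) / (1 - p ^ k)\<^sup>2" if "k \<in> {1..}" for k
  proof -
    have "k * (k + 2 * j + 1) div 2 = k * (k + 1) div 2 + k * j" for j
    proof -
      have "k * (k + 2 * j + 1) = k * (k + 1) + 2 * (k * j)" by (simp add: algebra_simps)
      then show ?thesis by simp
    qed
    then have "p ^ (k * (k + 2 * j + 1) div 2) = p ^ (k * (k + 1) div 2) * (p ^ k) ^ j" for j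
      by (simp only: power_add power_mult)
    then have "B k j = ((-1) ^ k * p ^ (k * (k + 1) div 2)) * of_nat (2 * j + 1) * (p ^ k) ^ j" for j
      unfolding B_def by (simp only: mult_ac)
    then have "B k = (\<lambda>j. ((-1) ^ k * p ^ (k * (k + 1) div 2)) * of_nat (2 * j + 1) * (p ^ k) ^ j)"
      by (rule ext)
    moreover have "of_nat 1 * (1 - p ^ k) + of_nat 2 * p ^ k = 1 + p ^ k" by simp
    ultimately show ?thesis
      using fsum_arith_geometric(2)[OF v1[OF that], of "(-1) ^ k * p ^ (k * (k + 1) div 2)" 2 1] by (simp only:)
  qed
  let ?a = "\<lambda>n. p ^ n / (1 - p ^ n)\<^sup>2" and ?b = "\<lambda>n. (p\<^sup>2) ^ n / (1 - (p\<^sup>2) ^ n)\<^sup>2"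
  let ?c = "\<lambda>n. of_nat n * p ^ n / (1 - p ^ n)" and ?d = "\<lambda>n. of_nat n * (p\<^sup>2) ^ n / (1 - (p\<^sup>2) ^ n)"
  have Cn: "fsum (C n) UNIV = (?a n - 2 * ?b n) - 2 * (?c n - ?d n)" if "n \<in> {1..}" for n
  proof -
    define x where "x = p ^ n"
    have "1 + p ^ n \<noteq> 0" "1 + - (p ^ n) \<noteq> 0"
      by (rule vge_inverse_one_plus(1), use v1[OF that] in simp)+
    then have nz: "1 + x \<noteq> 0" "1 - x \<noteq> 0" by (simp_all add: x_def)
    have x2: "(p\<^sup>2) ^ n = x * x" by (simp add: x_def power2_eq_square power_mult_distrib)
    have vxx: "vge (x * x) 1"
      by (rule vge_mono[OF vge_mult[OF v1[OF that] v1[OF that], folded x_def]]) simp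
    have "C n i = x * of_nat (2 * i + 1) * (x * x) ^ i - (2 * of_nat n * x) * (x * x) ^ i" for i
    proof -
      have "p ^ (n * (2 * i + 1)) = x ^ (2 * i + 1)" by (simp only: x_def power_mult)
      also have "\<dots> = x * (x * x) ^ i" by (simp add: power_add power_mult power2_eq_square)
      finally show ?thesis by (simp add: C_def algebra_simps)
    qed
    then have "C n = (\<lambda>i. x * of_nat (2 * i + 1) * (x * x) ^ i - (2 * of_nat n * x) * (x * x) ^ i)"
      by (rule ext)
    then have "fsum (C n) UNIV = x * (of_nat 1 * (1 - x * x) + of_nat 2 * (x * x)) / (1 - x * x)\<^sup>2
        - (2 * of_nat n * x) / (1 - x * x)"
      using fsum_diff[OF fsum_arith_geometric(1)[OF vxx] fsum_geometric(1)[OF vxx], of x 2 1 "2 * of_nat n * x"]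
      unfolding fsum_arith_geometric(2)[OF vxx] fsum_geometric(2)[OF vxx] by simp
    also have "\<dots> = (x / (1 - x)\<^sup>2 - 2 * (x * x / (1 - x * x)\<^sup>2))
        - 2 * (of_nat n * x / (1 - x) - of_nat n * (x * x) / (1 - x * x))"
    proof -
      have f: "1 - x * x = (1 - x) * (1 + x)" by (simp add: algebra_simps)
      have 1: "x / (1 - x)\<^sup>2 - 2 * (x * x / ((1 - x) * (1 + x))\<^sup>2)
          = x * (of_nat 1 * ((1 - x) * (1 + x)) + of_nat 2 * (x * x)) / ((1 - x) * (1 + x))\<^sup>2"
        using nz by (simp add: divide_simps) (simp add: algebra_simps power2_eq_square)
      have 2: "2 * (of_nat n * x / (1 - x) - of_nat n * (x * x) / ((1 - x) * (1 + x)))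
          = (2 * of_nat n * x) / ((1 - x) * (1 + x))"
        using nz by (simp add: divide_simps) (simp add: algebra_simps)
      show ?thesis unfolding f 1 2 ..
    qed
    finally show ?thesis unfolding x2 x_def[symmetric] .
  qed
  have vp2: "vge (p\<^sup>2) 1" using vge_mono[OF vp[of 2]] by simp
  note L1 = lambert_swap[OF p] and L2 = lambert_swap[OF vp2]
  show "fsummable (\<lambda>k. (-1) ^ k * p ^ (k * (k + 1) div 2) * (1 + p ^ k) / (1 - p ^ k)\<^sup>2) {1..}"
    using fsum_Sigma(2)[OF sB] by (subst fsummable_cong[OF Bk[symmetric]])
  have "fsum (\<lambda>k. (-1) ^ k * p ^ (k * (k + 1) div 2) * (1 + p ^ k) / (1 - p ^ k)\<^sup>2) {1..}
      = fsum (\<lambda>k. fsum (B k) UNIV) {1..}"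
    by (rule fsum_cong) (rule Bk[symmetric])
  also have "\<dots> = fsum (\<lambda>n. (?a n - 2 * ?b n) - 2 * (?c n - ?d n)) {1..}"
    unfolding BCsum by (rule fsum_cong) (rule Cn)
  also have "\<dots> = (fsum ?a {1..} - 2 * fsum ?b {1..}) - 2 * (fsum ?c {1..} - fsum ?d {1..})"
    by (simp only: fsum_diff fsum_cmult fsummable_diff fsummable_cmult L1(2,3) L2(2,3))
  also have "\<dots> = - fsum ?a {1..}"
    unfolding L1(1)[symmetric] L2(1)[symmetric] by simp
  finally show "fsum (\<lambda>k. (-1) ^ k * p ^ (k * (k + 1) div 2) * (1 + p ^ k) / (1 - p ^ k)\<^sup>2) {1..}
      = - fsum (\<lambda>n. p ^ n / (1 - p ^ n)\<^sup>2) {1..}" .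
qed

text \<open>As for T1, with coth and c = 1. The corrections are collected in E: those of
  \<open>cth_addition\<close> at l = 0 and |l| = m, and the term of \<open>theta_coneN_neg\<close>.
  The latter cancels against the linear term of \<open>telescoping\<close>.\<close>

lemma theta_T2:
  "4 * theta_neg * T2 = fsum (\<lambda>m. 2 * (ath (int m) * (cth (int m))\<^sup>2) + 2 * ((cth (int m))\<^sup>2 - 1)
     + 2 * (ath (int m) * ((cth (int m))\<^sup>2 - 1))) {1..}"
proof -
  define C where "C m l = - cth l * (ath l * (cth (int m + l) - cth (int m - l)))" for m l
  define E where "E m = 2 * ((cth (int m))\<^sup>2 - 1) + 2 * (ath (int m) * ((cth (int m))\<^sup>2 - 1))
      + 4 * of_nat m * (ath (int m) * cth (int m))" for m
  have vC: "vge (C m l) (max (int m) \<bar>l\<bar>)" for m l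
    unfolding C_def by (intro cth.vge_ath_mult_diff) (simp add: cth.vge0)
  have s: "fsummable (\<lambda>(m, l). C m l) ({1..} \<times> UNIV)"
    by (rule fsummable_max) (rule vC)
  have sl: "fsummable (C m) UNIV" for m
    by (rule fsummable_abs) (rule vge_mono[OF vC], simp)
  have m: "4 * theta_neg * (coneN (-1) m * cth (int m) - 1 / 2) = fsum (C m) UNIV + E m"
    if "m \<in> {1..}" for m
  proof -
    define D where "D = (cth (int m))\<^sup>2 - 1"
    define corr where "corr l = (if l = 0 then 2 * D else if \<bar>l\<bar> = int m then D else 0)" for l :: int
    have m0: "int m > 0" using that by simp
    have fin_corr: "fsum (\<lambda>l. ath l * corr l) {0, int m, - int m} = fsum (\<lambda>l. ath l * corr l) UNIV"
      by (rule fsum_mono_neutral) (auto simp: corr_def)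
    have scorr: "fsummable (\<lambda>l. ath l * corr l) UNIV"
    proof -
      have "fsummable (\<lambda>l. ath l * corr l) {0, int m, - int m} \<longleftrightarrow> fsummable (\<lambda>l. ath l * corr l) UNIV"
        by (rule fsummable_mono_neutral) (auto simp: corr_def)
      then show ?thesis by (simp add: fsummable_finite)
    qed
    have fcorr: "fsum (\<lambda>l. ath l * corr l) UNIV = 2 * D + 2 * (ath (int m) * D)"
    proof -
      have "0 \<notin> {int m, - int m}" "int m \<noteq> - int m" "ath 0 = 1"
        using m0 by (auto simp: ath_def)
      then show ?thesis
        unfolding fin_corr[symmetric] by (simp add: fsum_finite corr_def)
    qed
    have "4 * theta_neg * (coneN (-1) m * cth (int m) - 1 / 2)
        = 2 * (cth (int m) * (2 * theta_neg * coneN (-1) m) - theta_neg)"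
      by (simp add: field_simps)
    also have "\<dots> = 2 * (cth (int m) * fsum (\<lambda>l. ath l * cth (int m + l)) UNIV - theta_neg)
        + 4 * of_nat m * (ath (int m) * cth (int m))"
      unfolding theta_coneN_neg by (simp add: algebra_simps)
    also have "2 * (cth (int m) * fsum (\<lambda>l. ath l * cth (int m + l)) UNIV - theta_neg)
        = fsum (\<lambda>l. C m l + ath l * corr l) UNIV"
      unfolding fsum_ath_symmetrize(1)[of cth, OF cth.vge0] cth_addition[OF m0]
      by (rule fsum_cong) (simp add: C_def corr_def D_def algebra_simps)
    also have "\<dots> = fsum (C m) UNIV + (2 * D + 2 * (ath (int m) * D))"
      unfolding fsum_add[OF sl scorr] fcorr ..
    finally show ?thesis by (simp add: E_def D_def algebra_simps)
  qed
  have l: "fsum (\<lambda>m. C m l) {1..} = - (cth l * ath l * (2 * of_int l - cth l))" for l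
  proof -
    have "fsum (\<lambda>m. C m l) {1..} = fsum (\<lambda>m. (- (cth l * ath l)) * (cth (int m + l) - cth (int m - l))) {1..}"
      by (rule fsum_cong) (simp add: C_def mult_ac)
    also have "\<dots> = (- (cth l * ath l)) * (2 * of_int l - cth l)"
      unfolding fsum_cmult[OF cth.summable_diff] using cth.telescoping[of 1 l] by (simp add: mult.commute)
    finally show ?thesis by simp
  qed
  have sC: "fsummable (\<lambda>m. fsum (C m) UNIV) {1..}" using fsum_Sigma(2)[OF s] .
  have s4: "fsummable (\<lambda>m. 4 * theta_neg * (coneN (-1) m * cth (int m) - 1 / 2)) {1..}"
    by (rule fsummable_cmult[OF T2_eq(2)])
  have sE: "fsummable E {1..}"
  proof -
    define E' where "E' m = 4 * theta_neg * (coneN (-1) m * cth (int m) - 1 / 2) - fsum (C m) UNIV" for m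
    have "fsummable E' {1..}"
      unfolding E'_def by (rule fsummable_diff[OF s4 sC])
    moreover have "fsummable E {1..} \<longleftrightarrow> fsummable E' {1..}"
      by (rule fsummable_cong) (simp add: E'_def m)
    ultimately show ?thesis by simp
  qed
  define G where "G l = - (cth l * ath l * (2 * of_int l - cth l))" for l
  have sG: "fsummable G UNIV"
  proof -
    have "vge (2 * of_int l - cth l) 0" for l
      by (intro vge_diff cth.vge0 vge_mult'[of _ 0 _ 0] vge_numeral vge_of_int) auto
    from vge_mult[OF cth.vge0 this]
    have "vge (- (cth l * (2 * of_int l - cth l))) 0" for l by simp
    from fsummable_ath_mult[OF this] show ?thesis
      by (simp add: G_def[abs_def] mult_ac)
  qed
  note G2 = fsum_int_split[OF sG]
  have Ge: "fsum G UNIV = 2 * fsum (\<lambda>m. G (int m)) {1..}"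
    using fsum_int_even[OF sG] by (simp add: G_def algebra_simps)
  have "4 * theta_neg * T2 = fsum (\<lambda>m. fsum (C m) UNIV + E m) {1..}"
    unfolding T2_eq(1) fsum_cmult[OF T2_eq(2), symmetric] by (rule fsum_cong) (rule m)
  also have "\<dots> = fsum (\<lambda>m. fsum (C m) UNIV) {1..} + fsum E {1..}"
    by (rule fsum_add[OF sC sE])
  also have "fsum (\<lambda>m. fsum (C m) UNIV) {1..} = fsum G UNIV"
    unfolding fsum_swap[OF s] l G_def ..
  also have "fsum G UNIV + fsum E {1..} = fsum (\<lambda>m. 2 * G (int m) + E m) {1..}"
    unfolding Ge by (simp only: fsum_add fsum_cmult fsummable_cmult G2(1) sE)
  also have "\<dots> = fsum (\<lambda>m. 2 * (ath (int m) * (cth (int m))\<^sup>2) + 2 * ((cth (int m))\<^sup>2 - 1)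
     + 2 * (ath (int m) * ((cth (int m))\<^sup>2 - 1))) {1..}"
    by (rule fsum_cong) (simp add: G_def E_def algebra_simps power2_eq_square)
  finally show ?thesis .
qed

text \<open>Both products with theta(-q) become series over m >= 1. With p = q^2, coth^2 - 1 is 4
  p^m / (1 - p^m)^2, and the two series differ by one that \<open>lambert_triangular\<close> sums to
  0.\<close>

theorem eulerian1_eq: "q1.eulerian = 1 - 4 * T2"
proof -
  let ?c = "\<lambda>m. (cth (int m))\<^sup>2 - 1" and ?a = "\<lambda>m. ath (int m)"
  have sa: "fsummable ?a {1..}" using fsum_int_split(1)[OF fsummable_ath] .
  have th: "theta_neg = 1 + 2 * fsum ?a {1..}"
    unfolding theta_neg_def using fsum_int_even[OF fsummable_ath] by (simp add: ath_def[of 0])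
  define U where "U l = ath l * (qX powi l / (1 + qX powi l)\<^sup>2)" for l
  have U_minus: "U (- l) = U l" for l
  proof -
    define A where "A = qX powi l"
    have "A \<noteq> 0" "1 + A \<noteq> 0" using one_plus_qX by (simp_all add: A_def)
    then have "1 / A / (1 + 1 / A)\<^sup>2 = A / (1 + A)\<^sup>2"
      by (simp add: divide_simps power2_eq_square) (simp add: algebra_simps)
    then show ?thesis by (simp add: U_def A_def qX_powi_inverse)
  qed
  have vc2: "vge ((cth (int m))\<^sup>2) 0" for m
    using vge_mult[OF cth.vge0 cth.vge0] by (simp add: power2_eq_square)
  have sac: "fsummable (\<lambda>m. ?a m * (cth (int m))\<^sup>2) {1..}"
  proof (rule fsummable_nat)
    show "vge (?a m * (cth (int m))\<^sup>2) (int m)" for m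
      using vge_mult[OF vge_ath_abs[of "int m"] vc2[of m]] by simp
  qed
  have sac1: "fsummable (\<lambda>m. ?a m * ?c m) {1..}"
    using fsummable_diff[OF sac sa] by (simp add: algebra_simps)
  have cm: "?c m = 4 * ((qX\<^sup>2) ^ m / (1 - (qX\<^sup>2) ^ m)\<^sup>2)" if "m \<in> {1..}" for m
  proof -
    define Y where "Y = (qX\<^sup>2) ^ m"
    have "qX powi (2 * int m) = qX ^ (2 * m)" using power_int_of_nat[of qX "2 * m"] by simp
    then have Y: "qX powi (2 * int m) = Y" by (simp add: Y_def power_mult)
    have "1 - Y \<noteq> 0" using one_minus_qX[of "2 * int m"] that by (simp add: Y)
    then show ?thesis
      unfolding cth_def Y Y_def[symmetric] by (simp add: divide_simps power2_eq_square) (simp add: algebra_simps)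
  qed
  have vp: "vge (qX\<^sup>2) 1" using vge_mono[OF q1.vge_Q_power[of 2]] by simp
  note L = lambert_swap[OF vp] and M = lambert_triangular[OF vp]
  have sc: "fsummable ?c {1..}"
    using fsummable_cmult[OF L(2), of 4] by (subst fsummable_cong[OF cm])
  have Um: "8 * U (int m) + 4 * (?a m * ?c m)
      = 8 * ((-1) ^ m * (qX\<^sup>2) ^ (m * (m + 1) div 2) * (1 + (qX\<^sup>2) ^ m) / (1 - (qX\<^sup>2) ^ m)\<^sup>2)" if "m \<in> {1..}" for m
  proof -
    define A where "A = qX ^ m"
    have Y: "(qX\<^sup>2) ^ m = A * A" by (simp add: A_def power2_eq_square power_mult_distrib)
    have "1 - qX ^ m \<noteq> 0" "1 + qX ^ m \<noteq> 0"
      using q1.one_minus_Q_power(1) q1.one_plus_Q_power(1) that by auto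
    then have nz: "1 - A \<noteq> 0" "1 + A \<noteq> 0" by (simp_all add: A_def)
    have f: "1 - A * A = (1 - A) * (1 + A)" by (simp add: algebra_simps)
    have "(qX\<^sup>2) ^ (m * (m + 1) div 2) = qX ^ (2 * (m * (m + 1) div 2))" by (simp only: power_mult)
    also have "2 * (m * (m + 1) div 2) = m\<^sup>2 + m" by (simp add: power2_eq_square)
    finally have t: "(-1) ^ m * (qX\<^sup>2) ^ (m * (m + 1) div 2) = ath (int m) * A"
    proof -
      assume a: "(qX\<^sup>2) ^ (m * (m + 1) div 2) = qX ^ (m\<^sup>2 + m)"
      have "qX powi ((int m)\<^sup>2) = qX ^ (m\<^sup>2)" using power_int_of_nat[of qX "m\<^sup>2"] by simp
      then show ?thesis unfolding a by (simp add: ath_def A_def power_add)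
    qed
    have "8 * (a * (A / (1 + A)\<^sup>2)) + 4 * (a * (4 * (A * A / ((1 - A) * (1 + A))\<^sup>2)))
       = 8 * (a * A * (1 + A * A) / ((1 - A) * (1 + A))\<^sup>2)" for a
      using nz by (simp add: divide_simps power2_eq_square) (simp add: algebra_simps)
    then show ?thesis
      unfolding cm[OF that] t Y f U_def power_int_of_nat A_def[symmetric] .
  qed
  have sUp: "fsummable (\<lambda>m. 8 * U (int m)) {1..}"
  proof -
    have "fsummable (\<lambda>m. 8 * U (int m) + 4 * (?a m * ?c m)) {1..}"
      using fsummable_cmult[OF M(2), of 8] by (subst fsummable_cong[OF Um])
    from fsummable_diff[OF this fsummable_cmult[OF sac1, of 4]] show ?thesis by simp
  qed
  have sU1: "fsummable (\<lambda>m. U (int m)) {1..}"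
  proof -
    have "(\<lambda>m. (1 / 8) * (8 * U (int m))) = (\<lambda>m. U (int m))" by simp
    with fsummable_cmult[OF sUp, of "1 / 8"] show ?thesis by (simp only:)
  qed
  have sU: "fsummable U UNIV"
    by (rule fsummable_int_split) (use sU1 in \<open>simp_all add: U_minus\<close>)
  have "theta_neg * q1.eulerian = 4 * fsum U UNIV"
    unfolding theta_eulerian1 U_def ..
  also have "fsum U UNIV = U 0 + 2 * fsum (\<lambda>m. U (int m)) {1..}"
    by (rule fsum_int_even[OF sU U_minus])
  also have "U 0 = 1 / 4" by (simp add: U_def ath_def)
  finally have 1: "theta_neg * q1.eulerian = 1 + fsum (\<lambda>m. 8 * U (int m)) {1..}"
    unfolding fsum_cmult[OF sU1] by (simp add: distrib_left)
  have "theta_neg * (1 - 4 * T2) = theta_neg - 4 * theta_neg * T2"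
    by (simp add: algebra_simps)
  also have "\<dots> = 1 + fsum (\<lambda>m. 2 * ?a m - (2 * (?a m * (cth (int m))\<^sup>2) + 2 * ?c m + 2 * (?a m * ?c m))) {1..}"
    unfolding theta_T2
    unfolding th
    by (simp only: fsum_diff fsum_add fsum_cmult fsummable_cmult fsummable_add sa sac sac1 sc) simp
  also have "fsum (\<lambda>m. 2 * ?a m - (2 * (?a m * (cth (int m))\<^sup>2) + 2 * ?c m + 2 * (?a m * ?c m))) {1..}
      = fsum (\<lambda>m. 8 * U (int m) - (8 * ((-1) ^ m * (qX\<^sup>2) ^ (m * (m + 1) div 2) * (1 + (qX\<^sup>2) ^ m) / (1 - (qX\<^sup>2) ^ m)\<^sup>2)
        + 8 * ((qX\<^sup>2) ^ m / (1 - (qX\<^sup>2) ^ m)\<^sup>2))) {1..}"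
  proof (rule fsum_cong)
    fix m :: nat assume "m \<in> {1..}"
    note u = Um[OF this, symmetric] and c = cm[OF this]
    have c8: "8 * ((qX\<^sup>2) ^ m / (1 - (qX\<^sup>2) ^ m)\<^sup>2) = 2 * ?c m" unfolding c by simp
    show "2 * ?a m - (2 * (?a m * (cth (int m))\<^sup>2) + 2 * ?c m + 2 * (?a m * ?c m)) =
      8 * U (int m) - (8 * ((-1) ^ m * (qX\<^sup>2) ^ (m * (m + 1) div 2) * (1 + (qX\<^sup>2) ^ m) / (1 - (qX\<^sup>2) ^ m)\<^sup>2)
        + 8 * ((qX\<^sup>2) ^ m / (1 - (qX\<^sup>2) ^ m)\<^sup>2))"
      unfolding u c8 by (simp add: algebra_simps)
  qed
  also have "\<dots> = fsum (\<lambda>m. 8 * U (int m)) {1..}"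
    by (simp only: fsum_diff fsum_add fsum_cmult fsummable_cmult fsummable_add sUp L(2) M) simp
  finally have "theta_neg * q1.eulerian = theta_neg * (1 - 4 * T2)"
    unfolding 1 by simp
  then show ?thesis using theta_neg_nonzero by simp
qed

section \<open>Overpartitions counted by their largest part\<close>

definition ov :: "nat \<Rightarrow> nat \<Rightarrow> overpartition set" where
  "ov m n = {p \<in> overpartitions n. \<forall>j\<in>#fst p. j \<le> m}"

definition ov_over :: "nat \<Rightarrow> nat \<Rightarrow> overpartition set" where
  "ov_over l n = {p \<in> ov l n. l \<in> snd p}"

definition ov_plain :: "nat \<Rightarrow> nat \<Rightarrow> overpartition set" where
  "ov_plain l n = {p \<in> ov l n. l \<in># fst p \<and> l \<notin> snd p}"

definition add_plain :: "nat \<Rightarrow> overpartition \<Rightarrow> overpartition" where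
  "add_plain l p = (add_mset l (fst p), snd p)"

definition add_over :: "nat \<Rightarrow> overpartition \<Rightarrow> overpartition" where
  "add_over l p = (add_mset l (fst p), insert l (snd p))"

lemma size_le_sum_mset: "0 \<notin># M \<Longrightarrow> size M \<le> \<Sum>\<^sub># (M :: nat multiset)"
  by (induction M) auto

lemma mem_le_sum_mset: "j \<in># M \<Longrightarrow> j \<le> \<Sum>\<^sub># (M :: nat multiset)"
  by (induction M) auto

lemma finite_overpartitions: "finite (overpartitions n)"
proof (rule finite_subset)
  show "overpartitions n \<subseteq> (mset ` {xs. set xs \<subseteq> {..n} \<and> length xs \<le> n}) \<times> Pow {..n}"
  proof
    fix p assume p: "p \<in> overpartitions n"
    obtain M S where pe: "p = (M, S)" by fastforce
    have M: "0 \<notin># M" "\<Sum>\<^sub># M = n" "S \<subseteq> set_mset M" using p by (auto simp: pe overpartitions_def)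
    obtain xs where xs: "mset xs = M" using ex_mset by blast
    have "set xs \<subseteq> {..n}" using mem_le_sum_mset[of _ M] M(2) xs by auto
    moreover have "length xs \<le> n" using size_le_sum_mset[OF M(1)] M(2) xs by auto
    ultimately show "p \<in> (mset ` {xs. set xs \<subseteq> {..n} \<and> length xs \<le> n}) \<times> Pow {..n}"
    proof -
      have "S \<subseteq> set xs" using M(3) xs by auto
      then have "S \<subseteq> {..n}" using \<open>set xs \<subseteq> {..n}\<close> by (rule subset_trans)
      moreover assume "length xs \<le> n"
      ultimately show ?thesis using xs \<open>set xs \<subseteq> {..n}\<close> by (auto simp: pe)
    qed
  qed
  show "finite ((mset ` {xs. set xs \<subseteq> {..n} \<and> length xs \<le> n}) \<times> Pow {..n})"
    by (intro finite_cartesian_product finite_imageI finite_lists_length_le) auto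
qed

lemma finite_ov: "finite (ov m n)" "finite (ov_over m n)" "finite (ov_plain m n)"
  using finite_overpartitions[of n] by (simp_all add: ov_def ov_over_def ov_plain_def)

lemma ov_0: "ov 0 n = (if n = 0 then {({#}, {})} else {})"
proof -
  have "p \<in> ov 0 n \<longleftrightarrow> p = ({#}, {}) \<and> n = 0" for p
  proof
    assume p: "p \<in> ov 0 n"
    obtain M S where pe: "p = (M, S)" by fastforce
    have "M = {#}" using p by (auto simp: pe ov_def overpartitions_def intro: multiset_nonemptyE)
    then show "p = ({#}, {}) \<and> n = 0" using p by (auto simp: pe ov_def overpartitions_def)
  qed (auto simp: ov_def overpartitions_def)
  then show ?thesis by auto
qed

lemma ov_Suc:
  "ov (Suc l) n = ov l n \<union> (ov_over (Suc l) n \<union> ov_plain (Suc l) n)"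
  "ov l n \<inter> (ov_over (Suc l) n \<union> ov_plain (Suc l) n) = {}"
  "ov_over (Suc l) n \<inter> ov_plain (Suc l) n = {}"
proof -
  have in_S: "Suc l \<in># fst p" if "p \<in> overpartitions n" "Suc l \<in> snd p" for p
    using that by (auto simp: overpartitions_def)
  show "ov (Suc l) n = ov l n \<union> (ov_over (Suc l) n \<union> ov_plain (Suc l) n)"
    unfolding ov_over_def ov_plain_def ov_def by (auto simp: le_Suc_eq)
  show "ov l n \<inter> (ov_over (Suc l) n \<union> ov_plain (Suc l) n) = {}"
    unfolding ov_over_def ov_plain_def ov_def using in_S by force
  show "ov_over (Suc l) n \<inter> ov_plain (Suc l) n = {}"
    unfolding ov_over_def ov_plain_def by auto
qed

text \<open>Remove one copy of the part l + 1: either another copy remains, or all remaining parts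
  are at most l.\<close>

lemma ov_plain_rec:
  assumes "n \<ge> Suc l"
  shows "ov_plain (Suc l) n = add_plain (Suc l) ` (ov_plain (Suc l) (n - Suc l) \<union> ov l (n - Suc l))"
    "ov_plain (Suc l) (n - Suc l) \<inter> ov l (n - Suc l) = {}"
proof -
  let ?L = "Suc l"
  show "ov_plain ?L (n - ?L) \<inter> ov l (n - ?L) = {}" using ov_Suc(2)[of l "n - ?L"] by auto
  show "ov_plain ?L n = add_plain ?L ` (ov_plain ?L (n - ?L) \<union> ov l (n - ?L))"
  proof (intro equalityI subsetI)
    fix p assume p: "p \<in> ov_plain ?L n"
    obtain M S where pe: "p = (M, S)" by fastforce
    obtain M' where M: "M = add_mset ?L M'"
      using p by (auto simp: pe ov_plain_def dest: multi_member_split)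
    have "(M', S) \<in> ov_plain ?L (n - ?L) \<union> ov l (n - ?L)"
      using p by (cases "?L \<in># M'") (auto simp: pe M ov_plain_def ov_def overpartitions_def le_Suc_eq)
    then show "p \<in> add_plain ?L ` (ov_plain ?L (n - ?L) \<union> ov l (n - ?L))"
      by (rule rev_image_eqI) (simp add: pe M add_plain_def)
  next
    fix p assume "p \<in> add_plain ?L ` (ov_plain ?L (n - ?L) \<union> ov l (n - ?L))"
    then obtain M S where MS: "(M, S) \<in> ov_plain ?L (n - ?L) \<union> ov l (n - ?L)" "p = add_plain ?L (M, S)"
      by auto
    then have "?L \<notin> S" by (force simp: ov_plain_def ov_def overpartitions_def)
    then show "p \<in> ov_plain ?L n"
      using MS assms by (auto simp: add_plain_def ov_plain_def ov_def overpartitions_def le_Suc_eq)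
  qed
qed

text \<open>If the part l + 1 occurs several times, remove a non-overlined copy; otherwise remove
  the overlined one.\<close>

lemma ov_over_rec:
  assumes "n \<ge> Suc l"
  shows "ov_over (Suc l) n = add_plain (Suc l) ` ov_over (Suc l) (n - Suc l) \<union> add_over (Suc l) ` ov l (n - Suc l)"
    "add_plain (Suc l) ` ov_over (Suc l) (n - Suc l) \<inter> add_over (Suc l) ` ov l (n - Suc l) = {}"
proof -
  let ?L = "Suc l"
  have notin: "?L \<notin># M" "?L \<notin> S" if "(M, S) \<in> ov l k" for M S k
    using that by (force simp: ov_def overpartitions_def)+
  show "add_plain ?L ` ov_over ?L (n - ?L) \<inter> add_over ?L ` ov l (n - ?L) = {}"
  proof (rule ccontr)
    assume "\<not> ?thesis"
    then obtain M S M' S' where *: "(M, S) \<in> ov_over ?L (n - ?L)" "(M', S') \<in> ov l (n - ?L)"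
      "add_plain ?L (M, S) = add_over ?L (M', S')" by fastforce
    then have "M = M'" by (simp add: add_plain_def add_over_def)
    moreover have "?L \<in># M" using *(1) by (auto simp: ov_over_def ov_def overpartitions_def)
    ultimately show False using notin(1)[OF *(2)] by simp
  qed
  show "ov_over ?L n = add_plain ?L ` ov_over ?L (n - ?L) \<union> add_over ?L ` ov l (n - ?L)"
  proof (intro equalityI subsetI)
    fix p assume p: "p \<in> ov_over ?L n"
    obtain M S where pe: "p = (M, S)" by fastforce
    have "?L \<in># M" using p by (auto simp: pe ov_over_def ov_def overpartitions_def)
    then obtain M' where M: "M = add_mset ?L M'" by (auto dest: multi_member_split)
    show "p \<in> add_plain ?L ` ov_over ?L (n - ?L) \<union> add_over ?L ` ov l (n - ?L)"
    proof (cases "?L \<in># M'")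
      case True
      then have "(M', S) \<in> ov_over ?L (n - ?L)"
        using p by (auto simp: pe M ov_over_def ov_def overpartitions_def)
      then show ?thesis by (intro UnI1 rev_image_eqI[of "(M', S)"]) (simp_all add: pe M add_plain_def)
    next
      case False
      then have "(M', S - {?L}) \<in> ov l (n - ?L)"
        using p by (auto simp: pe M ov_over_def ov_def overpartitions_def le_Suc_eq)
      moreover have "insert ?L (S - {?L}) = S" using p by (auto simp: pe ov_over_def)
      ultimately show ?thesis
        by (intro UnI2 rev_image_eqI[of "(M', S - {?L})"]) (simp_all add: pe M add_over_def)
    qed
  next
    fix p assume "p \<in> add_plain ?L ` ov_over ?L (n - ?L) \<union> add_over ?L ` ov l (n - ?L)"
    then show "p \<in> ov_over ?L n"
      using assms by (auto simp: add_plain_def add_over_def ov_over_def ov_def overpartitions_def le_Suc_eq)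
  qed
qed

text \<open>Non-overlined parts of size \<open>j\<close> have weight \<open>b j\<close>, overlined ones have weight \<open>-1\<close>.\<close>

definition ov_weight :: "(nat \<Rightarrow> complex) \<Rightarrow> overpartition \<Rightarrow> complex" where
  "ov_weight b p = (\<Prod>j\<in>#fst p - mset_set (snd p). b j) * (-1) ^ card (snd p)"

lemma mset_set_le_overpartition:
  assumes "(M, S) \<in> overpartitions n"
  shows "mset_set S \<subseteq># M" "finite S"
proof -
  have S: "S \<subseteq> set_mset M" using assms by (auto simp: overpartitions_def)
  then show "finite S" using finite_subset by blast
  then show "mset_set S \<subseteq># M"
    using S by (auto simp: subseteq_mset_def count_mset_set' Suc_le_eq)
qed

lemma ov_weight_add_plain:
  assumes "p \<in> overpartitions n"
  shows "ov_weight b (add_plain l p) = b l * ov_weight b p"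
proof -
  obtain M S where pe: "p = (M, S)" by fastforce
  have "add_mset l M - mset_set S = add_mset l (M - mset_set S)"
  proof (rule multiset_eqI)
    fix x
    have "count (mset_set S) x \<le> count M x"
      using mset_set_le_overpartition(1)[of M S n] assms by (simp add: pe subseteq_mset_def)
    then show "count (add_mset l M - mset_set S) x = count (add_mset l (M - mset_set S)) x"
      by (simp add: Suc_diff_le)
  qed
  then show ?thesis by (simp add: pe ov_weight_def add_plain_def)
qed

lemma ov_weight_add_over:
  assumes "p \<in> overpartitions n" "l \<notin> snd p"
  shows "ov_weight b (add_over l p) = - ov_weight b p"
proof -
  obtain M S where pe: "p = (M, S)" by fastforce
  have "finite S" using mset_set_le_overpartition(2)[of M S n] assms by (simp add: pe)
  then show ?thesis using assms(2) by (simp add: pe ov_weight_def add_over_def)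
qed

definition ov_gf :: "(nat \<Rightarrow> complex) \<Rightarrow> nat \<Rightarrow> complex fps" where
  "ov_gf b m = Abs_fps (\<lambda>n. \<Sum>p\<in>ov m n. ov_weight b p)"

definition ov_over_gf :: "(nat \<Rightarrow> complex) \<Rightarrow> nat \<Rightarrow> complex fps" where
  "ov_over_gf b m = Abs_fps (\<lambda>n. \<Sum>p\<in>ov_over m n. ov_weight b p)"

definition ov_plain_gf :: "(nat \<Rightarrow> complex) \<Rightarrow> nat \<Rightarrow> complex fps" where
  "ov_plain_gf b m = Abs_fps (\<lambda>n. \<Sum>p\<in>ov_plain m n. ov_weight b p)"

lemma ov_gf_0: "ov_gf b 0 = 1"
  by (rule fps_ext) (simp add: ov_gf_def ov_0 ov_weight_def)

lemma ov_gf_Suc: "ov_gf b (Suc l) = ov_gf b l + (ov_over_gf b (Suc l) + ov_plain_gf b (Suc l))"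
proof (rule fps_ext)
  fix n
  have "(\<Sum>p\<in>ov (Suc l) n. ov_weight b p)
      = (\<Sum>p\<in>ov l n. ov_weight b p) + ((\<Sum>p\<in>ov_over (Suc l) n. ov_weight b p) + (\<Sum>p\<in>ov_plain (Suc l) n. ov_weight b p))"
    unfolding ov_Suc(1)[of l n]
    by (subst sum.union_disjoint, use finite_ov ov_Suc in auto)+
  then show "fps_nth (ov_gf b (Suc l)) n = fps_nth (ov_gf b l + (ov_over_gf b (Suc l) + ov_plain_gf b (Suc l))) n"
    by (simp add: ov_gf_def ov_over_gf_def ov_plain_gf_def)
qed

lemma add_plain_inj: "inj_on (add_plain l) A"
  by (auto simp: inj_on_def add_plain_def)

lemma sub_overpartitions: "p \<in> ov m n \<Longrightarrow> p \<in> overpartitions n"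
  "p \<in> ov_over m n \<Longrightarrow> p \<in> overpartitions n" "p \<in> ov_plain m n \<Longrightarrow> p \<in> overpartitions n"
  by (simp_all add: ov_def ov_over_def ov_plain_def)

lemma ov_empty: "n < l \<Longrightarrow> ov_over l n = {}" "n < l \<Longrightarrow> ov_plain l n = {}"
proof -
  have "l \<le> n" if "p \<in> overpartitions n" "l \<in># fst p" for p
    using that mem_le_sum_mset by (fastforce simp: overpartitions_def)
  moreover have "l \<in># fst p" if "p \<in> overpartitions n" "l \<in> snd p" for p
    using that by (auto simp: overpartitions_def)
  ultimately show "n < l \<Longrightarrow> ov_over l n = {}" "n < l \<Longrightarrow> ov_plain l n = {}"
    by (fastforce simp: ov_over_def ov_plain_def ov_def)+
qed

lemma ov_plain_gf_eq:
  "ov_plain_gf b (Suc l) = fps_X ^ Suc l * (fps_const (b (Suc l)) * (ov_plain_gf b (Suc l) + ov_gf b l))"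
proof (rule fps_ext)
  fix n
  let ?L = "Suc l"
  show "fps_nth (ov_plain_gf b ?L) n
      = fps_nth (fps_X ^ ?L * (fps_const (b ?L) * (ov_plain_gf b ?L + ov_gf b l))) n"
  proof (cases "n < ?L")
    case True
    then show ?thesis by (simp add: ov_plain_gf_def ov_empty fps_X_power_mult_nth del: power_Suc)
  next
    case False
    then have n: "n \<ge> ?L" by simp
    have "(\<Sum>p\<in>ov_plain ?L n. ov_weight b p)
        = (\<Sum>p\<in>ov_plain ?L (n - ?L) \<union> ov l (n - ?L). b ?L * ov_weight b p)"
      unfolding ov_plain_rec(1)[OF n]
      by (subst sum.reindex[OF add_plain_inj]) (auto intro!: sum.cong dest: sub_overpartitions simp: ov_weight_add_plain[of _ "n - ?L"])
    also have "\<dots> = b ?L * ((\<Sum>p\<in>ov_plain ?L (n - ?L). ov_weight b p) + (\<Sum>p\<in>ov l (n - ?L). ov_weight b p))"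
      by (subst sum.union_disjoint) (use finite_ov ov_plain_rec(2)[OF n] in \<open>auto simp: sum_distrib_left distrib_left\<close>)
    finally show ?thesis
      using n by (simp add: ov_plain_gf_def ov_gf_def fps_X_power_mult_nth del: power_Suc)
  qed
qed

lemma ov_over_gf_eq:
  "ov_over_gf b (Suc l) = fps_X ^ Suc l * (fps_const (b (Suc l)) * ov_over_gf b (Suc l) - ov_gf b l)"
proof (rule fps_ext)
  fix n
  let ?L = "Suc l"
  show "fps_nth (ov_over_gf b ?L) n
      = fps_nth (fps_X ^ ?L * (fps_const (b ?L) * ov_over_gf b ?L - ov_gf b l)) n"
  proof (cases "n < ?L")
    case True
    then show ?thesis by (simp add: ov_over_gf_def ov_empty fps_X_power_mult_nth del: power_Suc)
  next
    case False
    then have n: "n \<ge> ?L" by simp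
    have notin: "?L \<notin> snd p" if "p \<in> ov l k" for p k
      using that by (force simp: ov_def overpartitions_def)
    have inj: "inj_on (add_over ?L) (ov l (n - ?L))"
    proof (rule inj_onI)
      fix p p' assume *: "p \<in> ov l (n - ?L)" "p' \<in> ov l (n - ?L)" "add_over ?L p = add_over ?L p'"
      then have "insert ?L (snd p) = insert ?L (snd p')" "fst p = fst p'"
        by (simp_all add: add_over_def)
      moreover have "?L \<notin> snd p" "?L \<notin> snd p'" using notin * by blast+
      ultimately show "p = p'" by (metis insert_ident prod_eq_iff)
    qed
    have "(\<Sum>p\<in>ov_over ?L n. ov_weight b p)
        = (\<Sum>p\<in>add_plain ?L ` ov_over ?L (n - ?L). ov_weight b p) + (\<Sum>p\<in>add_over ?L ` ov l (n - ?L). ov_weight b p)"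
      unfolding ov_over_rec(1)[OF n]
      by (rule sum.union_disjoint) (use finite_ov ov_over_rec(2)[OF n] in auto)
    also have "(\<Sum>p\<in>add_plain ?L ` ov_over ?L (n - ?L). ov_weight b p)
        = (\<Sum>p\<in>ov_over ?L (n - ?L). b ?L * ov_weight b p)"
      by (subst sum.reindex[OF add_plain_inj]) (auto intro!: sum.cong dest: sub_overpartitions simp: ov_weight_add_plain[of _ "n - ?L"])
    also have "(\<Sum>p\<in>add_over ?L ` ov l (n - ?L). ov_weight b p) = (\<Sum>p\<in>ov l (n - ?L). - ov_weight b p)"
      by (subst sum.reindex[OF inj]) (auto intro!: sum.cong ov_weight_add_over dest: sub_overpartitions notin)
    finally show ?thesis
      using n by (simp add: ov_over_gf_def ov_gf_def fps_X_power_mult_nth sum_distrib_left sum_negf del: power_Suc)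
  qed
qed

lemma fps_to_fls_X_power: "fps_to_fls (fps_X ^ n) = qX ^ n"
  by (simp add: qX_def fps_to_fls_power)

text \<open>The recurrences are linear equations with coefficient 1 - b x, x = q^(l+1). Together
  they give the Euler factor (1 - x) / (1 - b x): a geometric series of plain copies times an
  optional overlined copy of weight -x.\<close>

lemma ov_gf_fls:
  fixes b :: "nat \<Rightarrow> complex"
  defines "c \<equiv> \<lambda>l. fls_const (b l)"
  assumes "1 - c (Suc l) * qX ^ Suc l \<noteq> 0"
  shows "fps_to_fls (ov_over_gf b (Suc l)) = - (qX ^ Suc l) / (1 - c (Suc l) * qX ^ Suc l) * fps_to_fls (ov_gf b l)"
    "fps_to_fls (ov_plain_gf b (Suc l)) = c (Suc l) * qX ^ Suc l / (1 - c (Suc l) * qX ^ Suc l) * fps_to_fls (ov_gf b l)"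
    "fps_to_fls (ov_gf b (Suc l)) = (1 - qX ^ Suc l) / (1 - c (Suc l) * qX ^ Suc l) * fps_to_fls (ov_gf b l)"
proof -
  define x where "x = qX ^ Suc l"
  define d where "d = c (Suc l)"
  define G where "G = fps_to_fls (ov_gf b l)"
  define O' where "O' = fps_to_fls (ov_over_gf b (Suc l))"
  define P where "P = fps_to_fls (ov_plain_gf b (Suc l))"
  have nz: "1 - d * x \<noteq> 0" using assms by (simp only: x_def d_def not_False_eq_True)
  have "O' = x * (d * O' - G)"
    unfolding O'_def by (subst ov_over_gf_eq)
      (simp only: fls_times_fps_to_fls fps_to_fls_X_power fps_const_to_fls fps_to_fls_minus x_def d_def G_def c_def)
  then have 1: "O' = - x / (1 - d * x) * G"
    using nz by (simp add: field_simps)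
  have "P = x * (d * (P + G))"
    unfolding P_def by (subst ov_plain_gf_eq)
      (simp only: fls_times_fps_to_fls fps_to_fls_X_power fps_const_to_fls fps_to_fls_plus x_def d_def G_def c_def)
  then have 2: "P = d * x / (1 - d * x) * G"
    using nz by (simp add: field_simps)
  have "fps_to_fls (ov_gf b (Suc l)) = G + (O' + P)"
    by (simp only: ov_gf_Suc fps_to_fls_plus G_def O'_def P_def)
  also have "\<dots> = (1 - x) / (1 - d * x) * G"
    unfolding 1 2 using nz by (simp add: divide_simps) (simp add: algebra_simps)
  finally show "fps_to_fls (ov_gf b (Suc l)) = (1 - qX ^ Suc l) / (1 - c (Suc l) * qX ^ Suc l) * fps_to_fls (ov_gf b l)"
    by (simp only: x_def d_def G_def)
  show "fps_to_fls (ov_over_gf b (Suc l)) = - (qX ^ Suc l) / (1 - c (Suc l) * qX ^ Suc l) * fps_to_fls (ov_gf b l)"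
    using 1 by (simp only: x_def d_def G_def O'_def)
  show "fps_to_fls (ov_plain_gf b (Suc l)) = c (Suc l) * qX ^ Suc l / (1 - c (Suc l) * qX ^ Suc l) * fps_to_fls (ov_gf b l)"
    using 2 by (simp only: x_def d_def G_def P_def)
qed

lemma overpartitions_eq_ov: "overpartitions n = ov n n"
  using mem_le_sum_mset by (fastforce simp: ov_def overpartitions_def)

lemma largest_part_ov:
  assumes "p \<in> ov_over l n \<or> p \<in> ov_plain l n"
  shows "largest_part p = l"
proof -
  have p: "l \<in># fst p" "\<forall>j\<in>#fst p. j \<le> l"
    using assms by (auto simp: ov_over_def ov_plain_def ov_def overpartitions_def)
  then have "fst p \<noteq> {#}" by auto
  then show ?thesis
    using p by (auto simp: largest_part_def intro!: Max_eqI)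
qed

text \<open>The sign of a rank is a factor that depends on the largest part and its overlining,
  times a multiplicative weight. Overpartitions with largest part l + 1 start at q^(l+1), so sorting
  by the largest part gives a summable family.\<close>

lemma overpartition_gf:
  assumes over: "\<And>l n p. p \<in> ov_over (Suc l) n \<Longrightarrow> s p = \<sigma> (Suc l) * ov_weight b p"
    and plain: "\<And>l n p. p \<in> ov_plain (Suc l) n \<Longrightarrow> s p = \<tau> (Suc l) * ov_weight b p"
    and empty: "s ({#}, {}) = 1"
  defines "T \<equiv> \<lambda>l. fls_const (\<sigma> (Suc l)) * fps_to_fls (ov_over_gf b (Suc l)) + fls_const (\<tau> (Suc l)) * fps_to_fls (ov_plain_gf b (Suc l))"
  shows "fsummable T UNIV"
    "fps_to_fls (Abs_fps (\<lambda>n. \<Sum>p\<in>overpartitions n. s p)) = 1 + fsum T UNIV"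
proof -
  have Tn: "T l $$ int n = \<sigma> (Suc l) * (\<Sum>p\<in>ov_over (Suc l) n. ov_weight b p)
      + \<tau> (Suc l) * (\<Sum>p\<in>ov_plain (Suc l) n. ov_weight b p)" for l n
    by (simp add: T_def ov_over_gf_def ov_plain_gf_def)
  have Tneg: "T l $$ i = 0" if "i < 0" for l i
    using that by (simp add: T_def)
  have vT: "vge (T l) (int (Suc l))" for l
    unfolding vge_def
  proof (intro allI impI)
    fix i assume i: "i < int (Suc l)"
    show "T l $$ i = 0"
    proof (cases "i < 0")
      case False
      then obtain n where "i = int n" by (metis nonneg_int_cases not_less)
      then show ?thesis using i by (simp add: Tn ov_empty)
    qed (rule Tneg)
  qed
  show sT: "fsummable T UNIV"
    by (rule fsummable_nat) (rule vge_mono[OF vT], simp)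
  have part: "(\<Sum>p\<in>ov m n. s p) = (if n = 0 then 1 else 0) + (\<Sum>l<m. T l $$ int n)" for m n
  proof (induction m)
    case 0
    then show ?case by (simp add: ov_0 empty)
  next
    case (Suc m)
    have "(\<Sum>p\<in>ov (Suc m) n. s p) = (\<Sum>p\<in>ov m n. s p) + ((\<Sum>p\<in>ov_over (Suc m) n. s p) + (\<Sum>p\<in>ov_plain (Suc m) n. s p))"
      unfolding ov_Suc(1)[of m n]
      by (subst sum.union_disjoint, use finite_ov ov_Suc in auto)+
    also have "(\<Sum>p\<in>ov_over (Suc m) n. s p) + (\<Sum>p\<in>ov_plain (Suc m) n. s p) = T m $$ int n"
      unfolding Tn sum_distrib_left by (intro arg_cong2[of _ _ _ _ "(+)"] sum.cong refl over plain)
    finally show ?case using Suc by simp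
  qed
  show "fps_to_fls (Abs_fps (\<lambda>n. \<Sum>p\<in>overpartitions n. s p)) = 1 + fsum T UNIV"
  proof (rule fls_eqI)
    fix i
    show "fps_to_fls (Abs_fps (\<lambda>n. \<Sum>p\<in>overpartitions n. s p)) $$ i = (1 + fsum T UNIV) $$ i"
    proof (cases "i < 0")
      case True
      have "fsum T UNIV $$ i = (\<Sum>l\<in>{}. T l $$ i)"
        by (rule fsum_nth[OF sT]) (use Tneg True in auto)
      then show ?thesis using True by simp
    next
      case False
      then obtain n where n: "i = int n" by (metis nonneg_int_cases not_less)
      have "fsum T UNIV $$ i = (\<Sum>l<n. T l $$ i)"
        by (rule fsum_nth[OF sT]) (use vT in \<open>auto simp: n vge_def\<close>)
      then show ?thesis using part[of n n] by (simp add: n overpartitions_eq_ov)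
    qed
  qed
qed

section \<open>Generating functions of the two ranks\<close>

definition sgn_int :: "int \<Rightarrow> complex" where
  "sgn_int k = (if even k then 1 else -1)"

lemma sgn_int_add: "sgn_int (a + b) = sgn_int a * sgn_int b"
  by (auto simp: sgn_int_def)

lemma sgn_int_diff: "sgn_int (a - b) = sgn_int a * sgn_int b"
  by (auto simp: sgn_int_def)

lemma sgn_int_of_nat: "sgn_int (int n) = (-1) ^ n"
  by (simp add: sgn_int_def minus_one_power_iff)

lemma sum_sgn_int:
  "complex_of_int (int (card {p \<in> overpartitions n. even (r p)}) - int (card {p \<in> overpartitions n. odd (r p)}))
    = (\<Sum>p\<in>overpartitions n. sgn_int (r p))"
proof -
  have "(\<Sum>p\<in>overpartitions n. sgn_int (r p))
      = (\<Sum>p\<in>{p \<in> overpartitions n. even (r p)}. 1) + (\<Sum>p\<in>{p \<in> overpartitions n. \<not> even (r p)}. -1)"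
  proof -
    have "{p \<in> overpartitions n. even (r p)} = overpartitions n \<inter> {p. even (r p)}"
      "{p \<in> overpartitions n. \<not> even (r p)} = overpartitions n \<inter> - {p. even (r p)}" by auto
    then show ?thesis
      unfolding sgn_int_def by (simp only: sum.If_cases[OF finite_overpartitions])
  qed
  then show ?thesis by simp
qed

definition rank_gf :: "complex fls" where
  "rank_gf = fps_to_fls (Abs_fps (\<lambda>n. of_int (alpha_bar n)))"

definition M2_rank_gf :: "complex fls" where
  "M2_rank_gf = fps_to_fls (Abs_fps (\<lambda>n. of_int (alpha2_bar n)))"

lemma size_nonoverlined:
  assumes "p \<in> overpartitions n"
  shows "size (fst p) = size (fst p - mset_set (snd p)) + card (snd p)"
proof -
  obtain M S where pe: "p = (M, S)" by fastforce
  have "mset_set S \<subseteq># M" using mset_set_le_overpartition[of M S n] assms by (simp add: pe)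
  then show ?thesis by (simp add: pe size_Diff_submset size_mset_mono flip: size_mset_set)
qed

text \<open>The sign of the rank is -1 to the largest part, times -1 for every part. Parts up to l
  then contribute (q; q)_l / (-q; q)_l, and the largest part l + 1 adds the remaining factor of the
  summand in \<open>eulerian_eq\<close> at u = 0.\<close>

theorem rank_gf_eq: "rank_gf = q1.eulerian"
proof -
  define b :: "nat \<Rightarrow> complex" where "b j = -1" for j
  have w: "ov_weight b p = (-1) ^ size (fst p)" if "p \<in> overpartitions n" for p n
    unfolding size_nonoverlined[OF that] by (simp add: ov_weight_def b_def power_add)
  have s: "sgn_int (op_rank p) = (-1) ^ Suc l * ov_weight b p"
    if "p \<in> ov_over (Suc l) n \<or> p \<in> ov_plain (Suc l) n" for p l n
  proof -
    have "p \<in> overpartitions n" using that sub_overpartitions by blast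
    then show ?thesis
      unfolding op_rank_def largest_part_ov[OF that] sgn_int_diff sgn_int_of_nat num_parts_def
      by (simp only: w)
  qed
  have so: "sgn_int (op_rank p) = (-1) ^ Suc l * ov_weight b p" if "p \<in> ov_over (Suc l) n" for p l n
    using s that by blast
  have st: "sgn_int (op_rank p) = (-1) ^ Suc l * ov_weight b p" if "p \<in> ov_plain (Suc l) n" for p l n
    using s that by blast
  have s0: "sgn_int (op_rank ({#}, {})) = 1"
    by (simp add: op_rank_def largest_part_def num_parts_def sgn_int_def)
  have cb: "fls_const (b l) = -1" for l by (simp add: b_def)
  have G: "fps_to_fls (ov_gf b m) = q1.qp m / q1.qm m" for m
  proof (induction m)
    case (Suc m)
    have "1 - fls_const (b (Suc m)) * qX ^ Suc m \<noteq> 0"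
      using q1.one_plus_Q_power(1)[of "Suc m"] by (simp add: cb)
    from ov_gf_fls(3)[where b = b and l = m, OF this] show ?case
      unfolding Suc cb by (simp add: q1.qp_Suc q1.qm_Suc mult.commute)
  qed (simp add: ov_gf_0)
  define T where "T l = fls_const ((-1) ^ Suc l) * fps_to_fls (ov_over_gf b (Suc l)) + fls_const ((-1) ^ Suc l) * fps_to_fls (ov_plain_gf b (Suc l))" for l
  have *: "fsummable T UNIV" "fps_to_fls (Abs_fps (\<lambda>n. \<Sum>p\<in>overpartitions n. sgn_int (op_rank p))) = 1 + fsum T UNIV"
    unfolding T_def
    by (rule overpartition_gf[where s = "\<lambda>p. sgn_int (op_rank p)" and b = b
          and \<sigma> = "\<lambda>l. (-1) ^ l" and \<tau> = "\<lambda>l. (-1) ^ l"]; fact so st s0)+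
  have Tl: "T l = 2 * ((-1) ^ l * (q1.qp l / q1.qm (Suc l)) * (qX ^ l * (qX + 0) / (1 - 0 * qX ^ l)))" for l
  proof -
    have nz: "1 - fls_const (b (Suc l)) * qX ^ Suc l \<noteq> 0"
      using q1.one_plus_Q_power(1)[of "Suc l"] by (simp add: cb)
    have c: "fls_const ((-1 :: complex) ^ Suc l) = - ((-1) ^ l)" by (cases "even l") auto
    show ?thesis
      unfolding T_def ov_gf_fls(1,2)[where b = b and l = l, OF nz] G cb c
      by (simp add: q1.qm_Suc mult_ac)
  qed
  have "fsummable (\<lambda>l. (1 / 2) * T l) UNIV" by (rule fsummable_cmult[OF *(1)])
  then have "fsum T UNIV = 2 * fsum (\<lambda>l. (-1) ^ l * (q1.qp l / q1.qm (Suc l)) * (qX ^ l * (qX + 0) / (1 - 0 * qX ^ l))) UNIV"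
    unfolding Tl by (subst fsum_cmult[symmetric]) simp_all
  then show ?thesis
    unfolding q1.eulerian_eq rank_gf_def alpha_bar_def p_even_def p_odd_def sum_sgn_int *(2) by simp
qed

lemma fsum_nat_pairs:
  fixes f :: "nat \<Rightarrow> complex fls"
  assumes "fsummable f UNIV"
  shows "fsummable (\<lambda>m. f (2 * m) + f (Suc (2 * m))) UNIV"
    "fsum f UNIV = fsum (\<lambda>m. f (2 * m) + f (Suc (2 * m))) UNIV"
proof -
  have e: "bij_betw (\<lambda>m::nat. 2 * m) UNIV {n. even n}" "bij_betw (\<lambda>m::nat. Suc (2 * m)) UNIV {n. odd n}"
    by (rule bij_betwI[where g = "\<lambda>n. n div 2"]; auto)+
  have U: "(UNIV :: nat set) = {n. even n} \<union> {n. odd n}" by auto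
  have s: "fsummable f B" for B using fsummable_subset[OF assms] by auto
  have se: "fsummable (\<lambda>m. f (2 * m)) UNIV" "fsummable (\<lambda>m. f (Suc (2 * m))) UNIV"
    using fsummable_reindex[OF e(1), of f] fsummable_reindex[OF e(2), of f] s by auto
  show "fsummable (\<lambda>m. f (2 * m) + f (Suc (2 * m))) UNIV" by (rule fsummable_add[OF se])
  have "fsum f ({n. even n} \<union> {n. odd n}) = fsum f {n. even n} + fsum f {n. odd n}"
    by (rule fsum_Un[OF s s]) auto
  then show "fsum f UNIV = fsum (\<lambda>m. f (2 * m) + f (Suc (2 * m))) UNIV"
    unfolding fsum_add[OF se] fsum_reindex[OF e(1), of f] fsum_reindex[OF e(2), of f] U[symmetric] .
qed

lemma ceiling_half: "\<lceil>real l / 2\<rceil> = int ((l + 1) div 2)"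
  by (cases "even l") (auto elim!: evenE oddE simp: ceiling_eq_iff)

text \<open>In the sign of the M2-rank an odd non-overlined part is counted twice and weighs 1, any
  other part weighs -1. The Euler factors of odd parts are then 1 and only even parts remain, whence
  the nome q^2; the largest parts 2m + 1 and 2m + 2 together form one summand of
  \<open>eulerian_eq\<close>.\<close>

theorem M2_rank_gf_eq: "M2_rank_gf = q2.eulerian"
proof -
  define b :: "nat \<Rightarrow> complex" where "b j = (if even j then -1 else 1)" for j
  have pw: "(\<Prod>j\<in>#N. b j) = (-1) ^ (size N + size (filter_mset odd N))" for N
    by (induction N) (auto simp: b_def)
  define \<sigma> :: "nat \<Rightarrow> complex" where "\<sigma> l = (-1) ^ ((l + 1) div 2)" for l
  \<comment> \<open>The additional sign is that of \<open>op_chi\<close>, which is 1 exactly for an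
    odd largest part that is not overlined.\<close>
  define \<tau> :: "nat \<Rightarrow> complex" where "\<tau> l = (-1) ^ ((l + 1) div 2) * (if odd l then -1 else 1)" for l
  have s: "sgn_int (M2_rank p) = (-1) ^ ((l + 1) div 2) * (-1) ^ op_chi p * ov_weight b p"
    if "p \<in> ov_over l n \<or> p \<in> ov_plain l n" for p l n
  proof -
    have p: "p \<in> overpartitions n" using that sub_overpartitions by blast
    show ?thesis
      unfolding M2_rank_def largest_part_ov[OF that] ceiling_half num_parts_def size_nonoverlined[OF p]
        ov_weight_def pw odd_nonoverlined_parts_def nonoverlined_parts_def
      by (simp add: sgn_int_add sgn_int_diff sgn_int_of_nat power_add)
  qed
  have so: "sgn_int (M2_rank p) = \<sigma> (Suc l) * ov_weight b p" if "p \<in> ov_over (Suc l) n" for p l n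
  proof -
    have "op_chi p = 0"
      using that largest_part_ov[of p "Suc l" n] by (simp add: op_chi_def ov_over_def)
    then show ?thesis using s[of p "Suc l" n] that by (simp add: \<sigma>_def)
  qed
  have st: "sgn_int (M2_rank p) = \<tau> (Suc l) * ov_weight b p" if "p \<in> ov_plain (Suc l) n" for p l n
  proof -
    have "op_chi p = (if odd (Suc l) then 1 else 0)"
      using that largest_part_ov[of p "Suc l" n] by (simp add: op_chi_def ov_plain_def)
    then show ?thesis using s[of p "Suc l" n] that by (simp add: \<tau>_def)
  qed
  have s0: "sgn_int (M2_rank ({#}, {})) = 1"
    by (simp add: M2_rank_def largest_part_def num_parts_def odd_nonoverlined_parts_def
        nonoverlined_parts_def op_chi_def sgn_int_def)
  define T where "T l = fls_const (\<sigma> (Suc l)) * fps_to_fls (ov_over_gf b (Suc l)) + fls_const (\<tau> (Suc l)) * fps_to_fls (ov_plain_gf b (Suc l))" for l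
  have *: "fsummable T UNIV" "fps_to_fls (Abs_fps (\<lambda>n. \<Sum>p\<in>overpartitions n. sgn_int (M2_rank p))) = 1 + fsum T UNIV"
    unfolding T_def
    by (rule overpartition_gf[where s = "\<lambda>p. sgn_int (M2_rank p)" and b = b and \<sigma> = \<sigma> and \<tau> = \<tau>];
        fact so st s0)+
  have cb: "fls_const (b (Suc (2 * m))) = 1" "fls_const (b (Suc (Suc (2 * m)))) = -1" for m
    by (simp_all add: b_def)
  have nz1: "1 - fls_const (b (Suc (2 * m))) * qX ^ Suc (2 * m) \<noteq> 0" for m
    unfolding cb mult_1 by (rule q1.one_minus_Q_power(1)) simp
  have nz2: "1 - fls_const (b (Suc (Suc (2 * m)))) * qX ^ Suc (Suc (2 * m)) \<noteq> 0" for m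
    using q1.one_plus_Q_power(1)[of "Suc (Suc (2 * m))"] unfolding cb by simp
  have odd_step: "fps_to_fls (ov_gf b (Suc (2 * m))) = fps_to_fls (ov_gf b (2 * m))" for m
    using nz1[of m] unfolding ov_gf_fls(3)[where b = b and l = "2 * m", OF nz1] cb by simp
  have qe: "qX ^ Suc (Suc (2 * m)) = (qX\<^sup>2) ^ Suc m" for m
    using power_mult[of qX 2 "Suc m"] by simp
  have G: "fps_to_fls (ov_gf b (2 * m)) = q2.qp m / q2.qm m" for m
  proof (induction m)
    case (Suc m)
    have "2 * Suc m = Suc (Suc (2 * m))" by simp
    then show ?case
      unfolding \<open>2 * Suc m = _\<close> ov_gf_fls(3)[where b = b and l = "Suc (2 * m)", OF nz2] odd_step Suc cb qe
      by (simp add: q2.qp_Suc q2.qm_Suc mult.commute del: power_Suc)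
  qed (simp add: ov_gf_0)
  have Tm: "T (2 * m) + T (Suc (2 * m))
      = 2 * ((-1) ^ m * (q2.qp m / q2.qm (Suc m)) * ((qX\<^sup>2) ^ m * (qX\<^sup>2 + qX) / (1 - qX * (qX\<^sup>2) ^ m)))" for m
  proof -
    define Y where "Y = (qX\<^sup>2) ^ m"
    define g where "g = q2.qp m / q2.qm m"
    have p1: "qX ^ Suc (2 * m) = qX * Y" by (simp add: Y_def power_mult)
    have p2: "qX ^ Suc (Suc (2 * m)) = qX\<^sup>2 * Y" unfolding qe by (simp add: Y_def)
    have nz: "1 - qX * Y \<noteq> 0" "1 + qX\<^sup>2 * Y \<noteq> 0"
      using nz1[of m] nz2[of m] unfolding cb p1 p2 by simp_all
    have c: "fls_const (\<sigma> (Suc (2 * m))) = - ((-1) ^ m)" "fls_const (\<tau> (Suc (2 * m))) = (-1) ^ m"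
      "fls_const (\<sigma> (Suc (Suc (2 * m)))) = - ((-1) ^ m)" "fls_const (\<tau> (Suc (Suc (2 * m)))) = - ((-1) ^ m)"
      by (cases "even m"; simp add: \<sigma>_def \<tau>_def)+
    have "T (2 * m) = 2 * (-1) ^ m * (qX * Y / (1 - qX * Y)) * g"
      unfolding T_def ov_gf_fls(1,2)[where b = b and l = "2 * m", OF nz1] G cb c p1 g_def[symmetric]
      by (simp add: algebra_simps)
    moreover have "T (Suc (2 * m)) = 2 * (-1) ^ m * (qX\<^sup>2 * Y / (1 + qX\<^sup>2 * Y)) * g"
      unfolding T_def ov_gf_fls(1,2)[where b = b and l = "Suc (2 * m)", OF nz2] odd_step G cb c p2 g_def[symmetric]
      by (simp add: algebra_simps)
    ultimately have "T (2 * m) + T (Suc (2 * m))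
        = 2 * (-1) ^ m * g * (qX * Y / (1 - qX * Y) + qX\<^sup>2 * Y / (1 + qX\<^sup>2 * Y))"
      by (simp add: algebra_simps)
    also have "qX * Y / (1 - qX * Y) + qX\<^sup>2 * Y / (1 + qX\<^sup>2 * Y)
        = Y * (qX\<^sup>2 + qX) / ((1 - qX * Y) * (1 + qX\<^sup>2 * Y))"
      using nz by (simp add: divide_simps) (simp add: algebra_simps power2_eq_square)
    finally show ?thesis
      by (simp add: g_def q2.qm_Suc Y_def[symmetric] mult_ac)
  qed
  note sp = fsum_nat_pairs[OF *(1)]
  have "fsummable (\<lambda>m. (1 / 2) * (T (2 * m) + T (Suc (2 * m)))) UNIV" by (rule fsummable_cmult[OF sp(1)])
  then have "fsum T UNIV = 2 * fsum (\<lambda>m. (-1) ^ m * (q2.qp m / q2.qm (Suc m)) * ((qX\<^sup>2) ^ m * (qX\<^sup>2 + qX) / (1 - qX * (qX\<^sup>2) ^ m))) UNIV"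
    unfolding sp(2) Tm by (subst fsum_cmult[symmetric]) simp_all
  then show ?thesis
    unfolding q2.eulerian_eq M2_rank_gf_def alpha2_bar_def M2_even_def M2_odd_def sum_sgn_int *(2) by simp
qed

section \<open>Hurwitz class numbers and obtuse superbases\<close>

text \<open>The triple \<open>(x, y, z)\<close> encodes the form \<open>Q\<close> with
  \<open>2 Q(u, v) = x (u + v)\<^sup>2 + y u\<^sup>2 + z v\<^sup>2\<close> (Selling parameters).\<close>

definition selling :: "nat \<times> nat \<times> nat \<Rightarrow> bqf" where
  "selling = (\<lambda>(x, y, z). (int (x + y) div 2, int x, int (x + z) div 2))"

text \<open>The parity conditions make the coefficients in \<open>selling\<close> integral; the
  discriminant is then -n.\<close>

definition selling_triples :: "nat \<Rightarrow> (nat \<times> nat \<times> nat) set" where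
  "selling_triples n = {(x, y, z). x * y + y * z + z * x = n \<and> even (x + y) \<and> even (y + z)}"

definition triple_weight :: "nat \<times> nat \<times> nat \<Rightarrow> real" where
  "triple_weight = (\<lambda>(x, y, z). if x * y * z = 0 then 1/2 else 1)"

lemma finite_selling_triples:
  assumes "n \<ge> 1"
  shows "finite (selling_triples n)"
proof (rule finite_subset)
  show "selling_triples n \<subseteq> {p \<in> tcone. cone_exp p \<le> n}"
    using assms by (auto simp: selling_triples_def tcone_def cone_exp_def)
qed (rule finite_cone_le)

lemma bqf_eval_selling:
  assumes "even (x + y)" "even (y + z)"
  shows "2 * bqf_eval (selling (x, y, z)) u v = int x * (u + v)\<^sup>2 + int y * u\<^sup>2 + int z * v\<^sup>2"
proof -
  have "2 * (int (x + y) div 2) = int x + int y" "2 * (int (x + z) div 2) = int x + int z"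
    using assms by auto
  then have "2 * bqf_eval (selling (x, y, z)) u v = (int x + int y) * u\<^sup>2 + 2 * int x * u * v + (int x + int z) * v\<^sup>2"
    unfolding selling_def prod.case bqf_eval.simps distrib_left mult.assoc[symmetric] by simp
  then show ?thesis by (simp add: algebra_simps power2_eq_square)
qed

lemma selling_pos_def_forms:
  assumes "n \<ge> 1" "t \<in> selling_triples n"
  shows "selling t \<in> pos_def_forms n"
proof -
  obtain x y z where t: "t = (x, y, z)" by (metis surj_pair)
  have par: "even (x + y)" "even (y + z)" and n: "x * y + y * z + z * x = n"
    using assms(2) by (auto simp: t selling_triples_def)
  have pos: "bqf_eval (selling t) u v > 0" if "(u, v) \<noteq> (0, 0)" for u v
  proof -
    have "int x * (u + v)\<^sup>2 + int y * u\<^sup>2 + int z * v\<^sup>2 > 0"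
    proof (rule ccontr)
      assume "\<not> ?thesis"
      moreover have nn: "int x * (u + v)\<^sup>2 \<ge> 0" "int y * u\<^sup>2 \<ge> 0" "int z * v\<^sup>2 \<ge> 0" by simp_all
      ultimately have "int x * (u + v)\<^sup>2 = 0" "int y * u\<^sup>2 = 0" "int z * v\<^sup>2 = 0" by linarith+
      then have "x = 0 \<or> u + v = 0" "y = 0 \<or> u = 0" "z = 0 \<or> v = 0" by auto
      then show False using that n assms(1) by auto
    qed
    then show ?thesis using bqf_eval_selling[OF par, of u v] by (simp add: t)
  qed
  have "2 * (int (x + y) div 2) = int x + int y" "2 * (int (x + z) div 2) = int x + int z"
    using par by auto
  then have "4 * (int (x + y) div 2) * (int (x + z) div 2) = (int x + int y) * (int x + int z)"
    by (metis mult.assoc mult.commute numeral_Bit0 numeral_One mult_2 distrib_left)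
  then have "bqf_disc (selling t) = - int n"
    unfolding t selling_def prod.case bqf_disc.simps n[symmetric]
    by (simp add: algebra_simps power2_eq_square)
  with pos show ?thesis by (simp add: pos_def_forms_def bqf_pos_def_def)
qed

lemma bqf_SL2_equiv_refl: "bqf_SL2_equiv Q Q"
  unfolding bqf_SL2_equiv_def by (intro exI[of _ 1] exI[of _ 0]) auto

lemma bqf_SL2_equiv_sym: "bqf_SL2_equiv Q Q' \<Longrightarrow> bqf_SL2_equiv Q' Q"
proof -
  assume "bqf_SL2_equiv Q Q'"
  then obtain r s t u where 1: "r * u - s * t = (1 :: int)"
    and e: "\<And>x y. bqf_eval Q' x y = bqf_eval Q (r * x + s * y) (t * x + u * y)"
    unfolding bqf_SL2_equiv_def by blast
  have "bqf_eval Q x y = bqf_eval Q' (u * x + (- s) * y) ((- t) * x + r * y)" for x y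
  proof -
    have "r * (u * x + (- s) * y) + s * ((- t) * x + r * y) = (r * u - s * t) * x"
      "t * (u * x + (- s) * y) + u * ((- t) * x + r * y) = (r * u - s * t) * y"
      by (simp_all add: algebra_simps)
    then show ?thesis by (simp add: e 1)
  qed
  moreover have "u * r - (- s) * (- t) = 1" using 1 by (simp add: mult.commute)
  ultimately show ?thesis unfolding bqf_SL2_equiv_def by blast
qed

lemma bqf_SL2_equiv_trans: "bqf_SL2_equiv Q Q' \<Longrightarrow> bqf_SL2_equiv Q' Q'' \<Longrightarrow> bqf_SL2_equiv Q Q''"
proof -
  assume "bqf_SL2_equiv Q Q'" "bqf_SL2_equiv Q' Q''"
  then obtain r s t u r' s' t' u' where 1: "r * u - s * t = (1 :: int)" "r' * u' - s' * t' = (1 :: int)"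
    and e: "\<And>x y. bqf_eval Q' x y = bqf_eval Q (r * x + s * y) (t * x + u * y)"
      "\<And>x y. bqf_eval Q'' x y = bqf_eval Q' (r' * x + s' * y) (t' * x + u' * y)"
    unfolding bqf_SL2_equiv_def by blast
  have "bqf_eval Q'' x y = bqf_eval Q ((r * r' + s * t') * x + (r * s' + s * u') * y)
      ((t * r' + u * t') * x + (t * s' + u * u') * y)" for x y
    unfolding e by (intro arg_cong2[of _ _ _ _ "bqf_eval Q"]) (simp_all add: algebra_simps)
  moreover have "(r * r' + s * t') * (t * s' + u * u') - (r * s' + s * u') * (t * r' + u * t')
      = (r * u - s * t) * (r' * u' - s' * t')" by (simp add: algebra_simps)
  ultimately show ?thesis unfolding bqf_SL2_equiv_def using 1 by (metis mult_1)
qed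

definition form_rel :: "nat \<Rightarrow> (bqf \<times> bqf) set" where
  "form_rel n = {(Q, Q'). Q \<in> pos_def_forms n \<and> Q' \<in> pos_def_forms n \<and> bqf_SL2_equiv Q Q'}"

lemma equiv_form_rel: "equiv (pos_def_forms n) (form_rel n)"
proof (rule equivI)
  show "form_rel n \<subseteq> pos_def_forms n \<times> pos_def_forms n" by (auto simp: form_rel_def)
  show "refl_on (pos_def_forms n) (form_rel n)"
    by (auto simp: refl_on_def form_rel_def bqf_SL2_equiv_refl)
  show "sym (form_rel n)" by (auto simp: sym_def form_rel_def bqf_SL2_equiv_sym)
  show "trans (form_rel n)" using bqf_SL2_equiv_trans by (fastforce simp: trans_def form_rel_def)
qed

section \<open>Which Selling triples are equivalent\<close>

lemma odd_square_ge_1: "odd (u :: int) \<Longrightarrow> 1 \<le> u\<^sup>2"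
  by (cases "u = 0") (auto simp: int_one_le_iff_zero_less)

lemma mult_square_ge:
  assumes "odd (u :: int)"
  shows "int x \<le> int x * u\<^sup>2"
  using mult_left_mono[OF odd_square_ge_1[OF assms], of "int x"] by simp

lemma square_eq_1_if: "int x * u\<^sup>2 \<le> int x \<Longrightarrow> x > 0 \<Longrightarrow> odd u \<Longrightarrow> u = 1 \<or> u = -1"
proof -
  assume "int x * u\<^sup>2 \<le> int x" "x > 0" "odd u"
  then have "u\<^sup>2 \<le> 1" by simp
  then have "u\<^sup>2 = 1" using odd_square_ge_1[OF \<open>odd u\<close>] by simp
  then show ?thesis by (simp add: power2_eq_1_iff)
qed

context
  fixes x y z :: nat
begin

private definition E :: "int \<Rightarrow> int \<Rightarrow> int" where
  "E u v = int x * (u + v)\<^sup>2 + int y * u\<^sup>2 + int z * v\<^sup>2"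

text \<open>\<open>\<beta> u v\<close> is the minimum of \<open>E\<close> over the coset of \<open>(u, v)\<close> modulo \<open>2\<close>. The three nonzero cosets are
  permuted by equivalences, and their minima \<open>x + y\<close>, \<open>x + z\<close>, \<open>y + z\<close> determine the triple up to order.\<close>

private definition \<beta> :: "int \<Rightarrow> int \<Rightarrow> int" where
  "\<beta> u v = (if even v then int x + int y else if even u then int x + int z else int y + int z)"

text \<open>Two of u, v, u + v are odd, and their squares are at least 1.\<close>

private lemma E_ge:
  assumes "odd u \<or> odd v"
  shows "E u v \<ge> \<beta> u v"
proof -
  have nn: "0 \<le> int x * (u + v)\<^sup>2" "0 \<le> int y * u\<^sup>2" "0 \<le> int z * v\<^sup>2" by simp_all
  consider "odd u" "even v" | "even u" "odd v" | "odd u" "odd v" using assms by blast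
  then show ?thesis
  proof cases
    case 1
    then have "odd u" "odd (u + v)" and b: "\<beta> u v = int x + int y" by (simp_all add: \<beta>_def)
    then show ?thesis
      using nn mult_square_ge[of u y] mult_square_ge[of "u + v" x] unfolding E_def b by linarith
  next
    case 2
    then have "odd v" "odd (u + v)" and b: "\<beta> u v = int x + int z" by (simp_all add: \<beta>_def)
    then show ?thesis
      using nn mult_square_ge[of v z] mult_square_ge[of "u + v" x] unfolding E_def b by linarith
  next
    case 3
    then have "odd u" "odd v" and b: "\<beta> u v = int y + int z" by (simp_all add: \<beta>_def)
    then show ?thesis
      using nn mult_square_ge[of u y] mult_square_ge[of v z] unfolding E_def b by linarith
  qed
qed

text \<open>As all three coefficients are positive, equality forces the even one among u, v, u + v
  to be 0 and the odd ones to be 1 or -1.\<close>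

private lemma E_eq:
  assumes pos: "x > 0" "y > 0" "z > 0" and "odd u \<or> odd v" "E u v \<le> \<beta> u v"
  shows "even v \<Longrightarrow> v = 0 \<and> (u = 1 \<or> u = -1)" "even u \<Longrightarrow> u = 0 \<and> (v = 1 \<or> v = -1)"
    "odd u \<Longrightarrow> odd v \<Longrightarrow> v = - u \<and> (u = 1 \<or> u = -1)"
proof -
  have nn: "0 \<le> int x * (u + v)\<^sup>2" "0 \<le> int y * u\<^sup>2" "0 \<le> int z * v\<^sup>2" by simp_all
  show "v = 0 \<and> (u = 1 \<or> u = -1)" if "even v"
  proof -
    have u: "odd u" "odd (u + v)" using assms(4) that by auto
    have b: "\<beta> u v = int x + int y" using that by (simp add: \<beta>_def)
    have a: "int z * v\<^sup>2 \<le> 0" "int y * u\<^sup>2 \<le> int y"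
      using assms(5) mult_square_ge[OF u(1), of y] mult_square_ge[OF u(2), of x] nn
      unfolding E_def b by linarith+
    then have "v = 0" using pos(3) by (simp add: mult_le_0_iff)
    then show ?thesis using square_eq_1_if[OF a(2) pos(2) u(1)] by simp
  qed
  show "u = 0 \<and> (v = 1 \<or> v = -1)" if "even u"
  proof -
    have v: "odd v" "odd (u + v)" using assms(4) that by auto
    have b: "\<beta> u v = int x + int z" using that v by (simp add: \<beta>_def)
    have a: "int y * u\<^sup>2 \<le> 0" "int z * v\<^sup>2 \<le> int z"
      using assms(5) mult_square_ge[OF v(1), of z] mult_square_ge[OF v(2), of x] nn
      unfolding E_def b by linarith+
    then have "u = 0" using pos(2) by (simp add: mult_le_0_iff)
    then show ?thesis using square_eq_1_if[OF a(2) pos(3) v(1)] by simp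
  qed
  show "v = - u \<and> (u = 1 \<or> u = -1)" if "odd u" "odd v"
  proof -
    have b: "\<beta> u v = int y + int z" using that by (simp add: \<beta>_def)
    have a: "int x * (u + v)\<^sup>2 \<le> 0" "int y * u\<^sup>2 \<le> int y"
      using assms(5) mult_square_ge[OF that(1), of y] mult_square_ge[OF that(2), of z] nn
      unfolding E_def b by linarith+
    then have "u + v = 0" using pos(1) by (simp add: mult_le_0_iff)
    then show ?thesis using square_eq_1_if[OF a(2) pos(2) that(1)] by auto
  qed
qed

text \<open>A unimodular matrix permutes the three nonzero cosets modulo 2, so its columns and their
  difference meet each coset once.\<close>

private lemma \<beta>_sum:
  assumes "r * p - s * t = (1 :: int)"
  shows "odd r \<or> odd t" "odd s \<or> odd p" "odd (r - s) \<or> odd (t - p)"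
    "\<beta> r t + \<beta> s p + \<beta> (r - s) (t - p) = 2 * (int x + int y + int z)"
proof -
  have "odd (r * p - s * t)" using assms by simp
  then have o: "odd (r * p) \<noteq> odd (s * t)" by auto
  show "odd r \<or> odd t" "odd s \<or> odd p" "odd (r - s) \<or> odd (t - p)"
    using o by auto
  show "\<beta> r t + \<beta> s p + \<beta> (r - s) (t - p) = 2 * (int x + int y + int z)"
    using o by (auto simp: \<beta>_def)
qed

text \<open>The pairwise sums of x', y', z' are values of E at the columns of the matrix and at
  their difference, hence bounded below by the three minima. Equal totals make each value a minimum,
  which permutes the pairwise sums; for positive entries the vectors are then known up to sign, and
  determinant 1 excludes transpositions.\<close>

lemma selling_equiv_sum_le:
  assumes "even (x + y)" "even (y + z)" "even (x' + y')" "even (y' + z')"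
    and "bqf_SL2_equiv (selling (x, y, z)) (selling (x', y', z'))"
  shows "x + y + z \<le> x' + y' + z'"
    and "x + y + z = x' + y' + z' \<Longrightarrow>
      (x', y', z') \<in> {(x, y, z), (x, z, y), (y, z, x), (y, x, z), (z, x, y), (z, y, x)}"
    and "x + y + z = x' + y' + z' \<Longrightarrow> x > 0 \<Longrightarrow> y > 0 \<Longrightarrow> z > 0 \<Longrightarrow>
      (x', y', z') \<in> {(x, y, z), (y, z, x), (z, x, y)}"
proof -
  obtain r s t p where det: "r * p - s * t = (1 :: int)"
    and e: "\<And>u v. bqf_eval (selling (x', y', z')) u v = bqf_eval (selling (x, y, z)) (r * u + s * v) (t * u + p * v)"
    using assms(5) unfolding bqf_SL2_equiv_def by blast
  have E: "int x' * (u + v)\<^sup>2 + int y' * u\<^sup>2 + int z' * v\<^sup>2 = E (r * u + s * v) (t * u + p * v)" for u v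
    unfolding E_def bqf_eval_selling[OF assms(1,2), symmetric] bqf_eval_selling[OF assms(3,4), symmetric] e ..
  have 1: "int x' + int y' = E r t" using E[of 1 0] by simp
  have 2: "int x' + int z' = E s p" using E[of 0 1] by simp
  have 3: "int y' + int z' = E (r - s) (t - p)" using E[of 1 "-1"] by simp
  note odds = \<beta>_sum(1-3)[OF det] and sum = \<beta>_sum(4)[OF det]
  note ge = E_ge[OF odds(1)] E_ge[OF odds(2)] E_ge[OF odds(3)]
  have ar: "S \<le> X + Y + Z" "S = X + Y + Z \<Longrightarrow> e1 \<le> b1 \<and> e2 \<le> b2 \<and> e3 \<le> b3"
    if "X + Y = e1" "X + Z = e2" "Y + Z = e3" "b1 \<le> e1" "b2 \<le> e2" "b3 \<le> e3" "b1 + b2 + b3 = 2 * S"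
    for S X Y Z e1 e2 e3 b1 b2 b3 :: int
    using that by linarith+
  note ar = ar[OF 1 2 3 ge sum]
  have "int x + int y + int z \<le> int x' + int y' + int z'" by (rule ar(1))
  then show "x + y + z \<le> x' + y' + z'" by linarith
  assume eq: "x + y + z = x' + y' + z'"
  then have eqi: "int x + int y + int z = int x' + int y' + int z'" by linarith
  have le: "E r t \<le> \<beta> r t" "E s p \<le> \<beta> s p" "E (r - s) (t - p) \<le> \<beta> (r - s) (t - p)"
    using ar(2)[OF eqi] by simp_all
  have "odd (r * p - s * t)" using det by simp
  then have o: "odd (r * p) \<noteq> odd (s * t)" by auto
  have b: "int x' + int y' = \<beta> r t" "int x' + int z' = \<beta> s p" "int y' + int z' = \<beta> (r - s) (t - p)"
    unfolding 1 2 3 using antisym[OF le(1) ge(1)] antisym[OF le(2) ge(2)] antisym[OF le(3) ge(3)] by simp_all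
  show "(x', y', z') \<in> {(x, y, z), (x, z, y), (y, z, x), (y, x, z), (z, x, y), (z, y, x)}"
    using b o by (auto simp: \<beta>_def split: if_splits)
  assume pos: "x > 0" "y > 0" "z > 0"
  note q = E_eq[OF pos odds(1) le(1)] E_eq[OF pos odds(2) le(2)] E_eq[OF pos odds(3) le(3)]
  \<comment> \<open>The six invertible matrices modulo 2. Cases 1, 4 and 5 are the cyclic
    permutations; in cases 2, 3 and 6 the entries found in \<open>q\<close> give determinant
    -1.\<close>
  consider "odd r" "even t" "even s" "odd p" | "odd r" "even t" "odd s" "odd p"
    | "even r" "odd t" "odd s" "even p" | "even r" "odd t" "odd s" "odd p"
    | "odd r" "odd t" "odd s" "even p" | "odd r" "odd t" "even s" "odd p"
    using o by auto
  then show "(x', y', z') \<in> {(x, y, z), (y, z, x), (z, x, y)}"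
  proof cases
    case 1
    then show ?thesis using b by (auto simp: \<beta>_def)
  next
    case 2
    then have "t = 0" "r = 1 \<or> r = -1" "p = - s" "r - s = 0" using q by auto
    then show ?thesis using det by auto
  next
    case 3
    then have "r = 0" "t = 1 \<or> t = -1" "p = 0" "t - p = - (r - s)" using q by auto
    then show ?thesis using det by auto
  next
    case 4
    then show ?thesis using b by (auto simp: \<beta>_def)
  next
    case 5
    then show ?thesis using b by (auto simp: \<beta>_def)
  next
    case 6
    then have "t = - r" "r = 1 \<or> r = -1" "s = 0" "t - p = 0" using q by auto
    then show ?thesis using det by auto
  qed
qed

end

text \<open>The substitution (u, v) -> (u + v, -u) permutes the squares of u, v, u + v
  cyclically.\<close>

lemma selling_rotate:
  assumes "even (x + y)" "even (y + z)"
  shows "bqf_SL2_equiv (selling (x, y, z)) (selling (y, z, x))"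
proof -
  have "even (y + z)" "even (z + x)" using assms by auto
  have "bqf_eval (selling (y, z, x)) u v = bqf_eval (selling (x, y, z)) (1 * u + 1 * v) ((-1) * u + 0 * v)" for u v
  proof -
    have "2 * bqf_eval (selling (y, z, x)) u v = 2 * bqf_eval (selling (x, y, z)) (1 * u + 1 * v) ((-1) * u + 0 * v)"
      unfolding bqf_eval_selling[OF assms] bqf_eval_selling[OF \<open>even (y + z)\<close> \<open>even (z + x)\<close>]
      by (simp add: algebra_simps power2_eq_square)
    then show ?thesis by simp
  qed
  then show ?thesis unfolding bqf_SL2_equiv_def
    by (intro exI[of _ 1] exI[of _ "-1"] exI[of _ 0]) auto
qed

text \<open>For x = 0 the square of u + v is absent, and the quarter turn (u, v) -> (v, -u)
  exchanges the other two.\<close>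

lemma selling_swap:
  assumes "even y" "even z"
  shows "bqf_SL2_equiv (selling (0, y, z)) (selling (0, z, y))"
proof -
  have p: "even (0 + y)" "even (y + z)" "even (0 + z)" "even (z + y)" using assms by auto
  have "bqf_eval (selling (0, z, y)) u v = bqf_eval (selling (0, y, z)) (0 * u + 1 * v) ((-1) * u + 0 * v)" for u v
  proof -
    have "2 * bqf_eval (selling (0, z, y)) u v = 2 * bqf_eval (selling (0, y, z)) (0 * u + 1 * v) ((-1) * u + 0 * v)"
      unfolding bqf_eval_selling[OF p(1,2)] bqf_eval_selling[OF p(3,4)]
      by (simp add: algebra_simps power2_eq_square)
    then show ?thesis by simp
  qed
  then show ?thesis unfolding bqf_SL2_equiv_def
    by (intro exI[of _ 0] exI[of _ 1] exI[of _ "-1"]) auto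
qed

section \<open>Every form has a Selling triple\<close>

lemma pos_def_coeffs:
  assumes "(a, b, c) \<in> pos_def_forms n"
  shows "a > 0" "c > 0" "4 * a * c - b\<^sup>2 = int n"
proof -
  have pos: "(x, y) \<noteq> (0, 0) \<Longrightarrow> bqf_eval (a, b, c) x y > 0" for x y
    using assms by (simp add: pos_def_forms_def bqf_pos_def_def del: bqf_eval.simps)
  have "bqf_eval (a, b, c) 1 0 > 0" "bqf_eval (a, b, c) 0 1 > 0"
    by (rule pos; simp)+
  then show "a > 0" "c > 0" by simp_all
  show "4 * a * c - b\<^sup>2 = int n" using assms by (simp add: pos_def_forms_def)
qed

lemma pos_def_forms_equiv:
  assumes "Q \<in> pos_def_forms n" "bqf_disc Q' = bqf_disc Q" "bqf_SL2_equiv Q Q'"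
  shows "Q' \<in> pos_def_forms n"
proof -
  obtain r s t p where det: "r * p - s * t = (1 :: int)"
    and e: "\<And>u v. bqf_eval Q' u v = bqf_eval Q (r * u + s * v) (t * u + p * v)"
    using assms(3) unfolding bqf_SL2_equiv_def by blast
  have "bqf_eval Q' u v > 0" if "(u, v) \<noteq> (0, 0)" for u v
  proof -
    have "(r * u + s * v, t * u + p * v) \<noteq> (0, 0)"
    proof
      assume "(r * u + s * v, t * u + p * v) = (0, 0)"
      then have *: "r * u + s * v = 0" "t * u + p * v = 0" by auto
      have "(r * p - s * t) * u = p * (r * u + s * v) - s * (t * u + p * v)"
        "(r * p - s * t) * v = r * (t * u + p * v) - t * (r * u + s * v)" by (simp_all add: algebra_simps)
      then show False using that unfolding * det by simp
    qed
    moreover have "(x, y) \<noteq> (0, 0) \<Longrightarrow> bqf_eval Q x y > 0" for x y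
      using assms(1) by (simp add: pos_def_forms_def bqf_pos_def_def)
    ultimately show ?thesis unfolding e by blast
  qed
  then show ?thesis using assms(1,2) by (simp add: pos_def_forms_def bqf_pos_def_def)
qed

lemma bqf_shift:
  shows "bqf_SL2_equiv (a, b, c) (a, b + 2 * a * k, c + b * k + a * k\<^sup>2)"
    "bqf_SL2_equiv (a, b, c) (a + b * k + c * k\<^sup>2, b + 2 * c * k, c)"
    "bqf_disc (a, b + 2 * a * k, c + b * k + a * k\<^sup>2) = bqf_disc (a, b, c)"
    "bqf_disc (a + b * k + c * k\<^sup>2, b + 2 * c * k, c) = bqf_disc (a, b, c)"
proof -
  show "bqf_SL2_equiv (a, b, c) (a, b + 2 * a * k, c + b * k + a * k\<^sup>2)"
    unfolding bqf_SL2_equiv_def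
    by (rule exI[of _ 1], rule exI[of _ k], rule exI[of _ 0], rule exI[of _ 1])
      (simp add: algebra_simps power2_eq_square)
  show "bqf_SL2_equiv (a, b, c) (a + b * k + c * k\<^sup>2, b + 2 * c * k, c)"
    unfolding bqf_SL2_equiv_def
    by (rule exI[of _ 1], rule exI[of _ 0], rule exI[of _ k], rule exI[of _ 1])
      (simp add: algebra_simps power2_eq_square)
qed (simp_all add: algebra_simps power2_eq_square)

text \<open>A form with \<open>\<bar>b\<bar>\<close> minimal in its class satisfies \<open>\<bar>b\<bar> \<le> a, c\<close>.\<close>

lemma selling_exists:
  assumes n: "n \<ge> 1" and Q: "Q \<in> pos_def_forms n"
  shows "\<exists>t\<in>selling_triples n. bqf_SL2_equiv Q (selling t)"
proof -
  define P where "P Q' \<longleftrightarrow> Q' \<in> pos_def_forms n \<and> bqf_SL2_equiv Q Q'" for Q'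
  have "P Q" using Q by (simp add: P_def bqf_SL2_equiv_refl)
  then obtain Q' where Q': "P Q'" and min: "\<And>R. P R \<Longrightarrow> nat \<bar>fst (snd Q')\<bar> \<le> nat \<bar>fst (snd R)\<bar>"
    using ex_has_least_nat[of P Q "\<lambda>R. nat \<bar>fst (snd R)\<bar>"] by blast
  obtain a b c where abc: "Q' = (a, b, c)" by (metis surj_pair)
  have Pabc: "(a, b, c) \<in> pos_def_forms n" "bqf_SL2_equiv Q (a, b, c)" using Q' by (simp_all add: P_def abc)
  note co = pos_def_coeffs[OF Pabc(1)]
  have Pstep: "P R" if "bqf_SL2_equiv (a, b, c) R" "bqf_disc R = bqf_disc (a, b, c)" for R
    using that pos_def_forms_equiv[OF Pabc(1)] bqf_SL2_equiv_trans[OF Pabc(2)] by (simp add: P_def)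
  have le: "\<bar>b\<bar> \<le> \<bar>b + 2 * a * k\<bar>" "\<bar>b\<bar> \<le> \<bar>b + 2 * c * k\<bar>" for k
    using min[OF Pstep[OF bqf_shift(1) bqf_shift(3), of k]] min[OF Pstep[OF bqf_shift(2) bqf_shift(4), of k]]
    by (simp_all add: abc nat_le_eq_zle)
  have ba: "\<bar>b\<bar> \<le> a" using le(1)[of 1] le(1)[of "-1"] co(1) by linarith
  have bc: "\<bar>b\<bar> \<le> c" using le(2)[of 1] le(2)[of "-1"] co(2) by linarith
  show ?thesis
  proof (cases "b \<ge> 0")
    case True
    \<comment> \<open>The solution of \<open>selling t = (a, b, c)\<close>; its entries are
      nonnegative by \<open>ba\<close> and \<open>bc\<close>.\<close>
    define t where "t = (nat b, nat (2 * a - b), nat (2 * c - b))"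
    have i: "int (nat b) = b" "int (nat (2 * a - b)) = 2 * a - b" "int (nat (2 * c - b)) = 2 * c - b"
      using True ba bc co by auto
    have "int (nat b * nat (2 * a - b) + nat (2 * a - b) * nat (2 * c - b) + nat (2 * c - b) * nat b) = int n"
      unfolding of_nat_add of_nat_mult i co(3)[symmetric] by (simp add: algebra_simps power2_eq_square)
    then have sum: "nat b * nat (2 * a - b) + nat (2 * a - b) * nat (2 * c - b) + nat (2 * c - b) * nat b = n"
      by (simp only: of_nat_eq_iff)
    have "even (int (nat b + nat (2 * a - b)))" "even (int (nat (2 * a - b) + nat (2 * c - b)))"
      unfolding of_nat_add i by simp_all
    then have "t \<in> selling_triples n"
      unfolding t_def selling_triples_def using sum by (simp only: mem_Collect_eq prod.case even_of_nat simp_thms)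
    moreover have "selling t = (a, b, c)"
      unfolding t_def selling_def prod.case of_nat_add i by simp
    ultimately show ?thesis using Pabc(2) by metis
  next
    case False
    \<comment> \<open>The same solution for the form (a, b + 2a, a + b + c), the shift of (a, b, c)
      by k = 1.\<close>
    define t where "t = (nat (2 * a + b), nat (- b), nat (2 * c + b))"
    have i: "int (nat (2 * a + b)) = 2 * a + b" "int (nat (- b)) = - b" "int (nat (2 * c + b)) = 2 * c + b"
      using False ba bc co by auto
    have "int (nat (2 * a + b) * nat (- b) + nat (- b) * nat (2 * c + b) + nat (2 * c + b) * nat (2 * a + b)) = int n"
      unfolding of_nat_add of_nat_mult i co(3)[symmetric] by (simp add: algebra_simps power2_eq_square)
    then have sum: "nat (2 * a + b) * nat (- b) + nat (- b) * nat (2 * c + b) + nat (2 * c + b) * nat (2 * a + b) = n"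
      by (simp only: of_nat_eq_iff)
    have "even (int (nat (2 * a + b) + nat (- b)))" "even (int (nat (- b) + nat (2 * c + b)))"
      unfolding of_nat_add i by simp_all
    then have "t \<in> selling_triples n"
      unfolding t_def selling_triples_def using sum by (simp only: mem_Collect_eq prod.case even_of_nat simp_thms)
    moreover have "selling t = (a, b + 2 * a * 1, c + b * 1 + a * 1\<^sup>2)"
      unfolding t_def selling_def prod.case of_nat_add i by simp
    then have "bqf_SL2_equiv Q (selling t)"
      using bqf_SL2_equiv_trans[OF Pabc(2) bqf_shift(1)] by metis
    ultimately show ?thesis by blast
  qed
qed

section \<open>Weighted count of the triples belonging to a class\<close>

definition selling_fiber :: "nat \<Rightarrow> nat \<times> nat \<times> nat \<Rightarrow> (nat \<times> nat \<times> nat) set" where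
  "selling_fiber n t = {t' \<in> selling_triples n. bqf_SL2_equiv (selling t) (selling t')}"

lemma selling_triples_rotate:
  "(x, y, z) \<in> selling_triples n \<Longrightarrow> (y, z, x) \<in> selling_triples n"
  by (auto simp: selling_triples_def algebra_simps)

lemma selling_fiber_rotate:
  "(x, y, z) \<in> selling_triples n \<Longrightarrow> (y, z, x) \<in> selling_fiber n (x, y, z)"
  using selling_triples_rotate[of x y z n] selling_rotate[of x y z]
  by (simp add: selling_fiber_def selling_triples_def)

lemma selling_fiber_trans:
  "t' \<in> selling_fiber n t \<Longrightarrow> t'' \<in> selling_fiber n t' \<Longrightarrow> t'' \<in> selling_fiber n t"
  using bqf_SL2_equiv_trans unfolding selling_fiber_def by blast

lemma selling_fiber_refl: "t \<in> selling_triples n \<Longrightarrow> t \<in> selling_fiber n t"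
  by (simp add: selling_fiber_def bqf_SL2_equiv_refl)

lemma selling_fiber_D: "t' \<in> selling_fiber n t \<Longrightarrow> t' \<in> selling_triples n"
  by (simp add: selling_fiber_def)

lemma selling_fiber_sum_eq:
  assumes "(x, y, z) \<in> selling_triples n" "(x', y', z') \<in> selling_fiber n (x, y, z)"
  shows "x + y + z = x' + y' + z'"
proof (rule antisym)
  have p: "even (x + y)" "even (y + z)" "even (x' + y')" "even (y' + z')"
    and e: "bqf_SL2_equiv (selling (x, y, z)) (selling (x', y', z'))"
    using assms by (simp_all add: selling_triples_def selling_fiber_def)
  show "x + y + z \<le> x' + y' + z'" by (rule selling_equiv_sum_le(1)[OF p e])
  show "x' + y' + z' \<le> x + y + z"
    by (rule selling_equiv_sum_le(1)[OF p(3,4,1,2) bqf_SL2_equiv_sym[OF e]])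
qed

lemma selling_fiber_pos:
  assumes "(x, y, z) \<in> selling_triples n" "x > 0" "y > 0" "z > 0"
  shows "selling_fiber n (x, y, z) = {(x, y, z), (y, z, x), (z, x, y)}"
proof (intro antisym subsetI)
  fix t assume t: "t \<in> selling_fiber n (x, y, z)"
  obtain x' y' z' where t': "t = (x', y', z')" by (metis surj_pair)
  have p: "even (x + y)" "even (y + z)" "even (x' + y')" "even (y' + z')"
    and e: "bqf_SL2_equiv (selling (x, y, z)) (selling (x', y', z'))"
    using assms(1) t by (simp_all add: t' selling_triples_def selling_fiber_def)
  show "t \<in> {(x, y, z), (y, z, x), (z, x, y)}" unfolding t'
    by (rule selling_equiv_sum_le(3)[OF p e selling_fiber_sum_eq assms(2-4)])
      (use assms(1) t in \<open>simp_all add: t'\<close>)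
next
  fix t assume "t \<in> {(x, y, z), (y, z, x), (z, x, y)}"
  moreover have 1: "(y, z, x) \<in> selling_fiber n (x, y, z)" by (rule selling_fiber_rotate[OF assms(1)])
  moreover have "(z, x, y) \<in> selling_fiber n (x, y, z)"
    using selling_fiber_trans[OF 1 selling_fiber_rotate[OF selling_fiber_D[OF 1]]] .
  ultimately show "t \<in> selling_fiber n (x, y, z)"
    using selling_fiber_refl[OF assms(1)] by auto
qed

lemma selling_fiber_zero:
  assumes "(0, y, z) \<in> selling_triples n"
  shows "selling_fiber n (0, y, z) = {(0, y, z), (0, z, y), (y, z, 0), (y, 0, z), (z, 0, y), (z, y, 0)}"
proof (intro antisym subsetI)
  fix t assume t: "t \<in> selling_fiber n (0, y, z)"
  obtain x' y' z' where t': "t = (x', y', z')" by (metis surj_pair)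
  have p: "even (0 + y)" "even (y + z)" "even (x' + y')" "even (y' + z')"
    and e: "bqf_SL2_equiv (selling (0, y, z)) (selling (x', y', z'))"
    using assms(1) t by (auto simp: t' selling_triples_def selling_fiber_def)
  show "t \<in> {(0, y, z), (0, z, y), (y, z, 0), (y, 0, z), (z, 0, y), (z, y, 0)}" unfolding t'
    by (rule selling_equiv_sum_le(2)[OF p e selling_fiber_sum_eq])
      (use assms(1) t in \<open>simp_all add: t'\<close>)
next
  fix t assume t: "t \<in> {(0, y, z), (0, z, y), (y, z, 0), (y, 0, z), (z, 0, y), (z, y, 0)}"
  have rot: "(0, y, z) \<in> selling_triples n \<Longrightarrow> (y, z, 0) \<in> selling_fiber n (0, y, z) \<and> (z, 0, y) \<in> selling_fiber n (0, y, z)"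
    for y z
    using selling_fiber_rotate[of 0 y z n] selling_fiber_trans[OF _ selling_fiber_rotate, of y z 0 n] selling_fiber_D
    by blast
  have "even y" "even z" using assms by (auto simp: selling_triples_def)
  then have s: "(0, z, y) \<in> selling_fiber n (0, y, z)"
    using assms selling_swap[of y z] by (simp add: selling_fiber_def selling_triples_def mult.commute)
  show "t \<in> selling_fiber n (0, y, z)"
    using t rot[OF assms] rot[OF selling_fiber_D[OF s]] s selling_fiber_trans[OF s] selling_fiber_refl[OF assms]
    by (elim insertE) (simp_all only: simp_thms empty_iff)
qed

lemma square_form_triple:
  assumes "(a, 0, a) \<in> pos_def_forms n"
  shows "a > 0" "(0, nat (2 * a), nat (2 * a)) \<in> selling_triples n" "selling (0, nat (2 * a), nat (2 * a)) = (a, 0, a)"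
proof -
  note co = pos_def_coeffs[OF assms]
  show "a > 0" by (rule co)
  have "int (nat (2 * a)) = 2 * a" using co by simp
  have "int (nat (2 * a) * nat (2 * a)) = int n" using co by simp
  then have "nat (2 * a) * nat (2 * a) = n" by (simp only: of_nat_eq_iff)
  moreover have "nat (2 * a) = 2 * nat a" by simp
  ultimately show "(0, nat (2 * a), nat (2 * a)) \<in> selling_triples n"
    by (simp add: selling_triples_def)
  show "selling (0, nat (2 * a), nat (2 * a)) = (a, 0, a)" using co by (simp add: selling_def)
qed

lemma hexagonal_form_triple:
  assumes "(a, a, a) \<in> pos_def_forms n"
  shows "a > 0" "(nat a, nat a, nat a) \<in> selling_triples n" "selling (nat a, nat a, nat a) = (a, a, a)"
proof -
  note co = pos_def_coeffs[OF assms]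
  show "a > 0" by (rule co)
  have "int (nat a * nat a + nat a * nat a + nat a * nat a) = int n"
    using co by (simp add: power2_eq_square)
  then have "nat a * nat a + nat a * nat a + nat a * nat a = n" by (simp only: of_nat_eq_iff)
  then show "(nat a, nat a, nat a) \<in> selling_triples n" by (simp add: selling_triples_def)
  show "selling (nat a, nat a, nat a) = (a, a, a)" using co by (simp add: selling_def)
qed

definition selling_class :: "nat \<Rightarrow> nat \<times> nat \<times> nat \<Rightarrow> bqf set" where
  "selling_class n t = form_rel n `` {selling t}"

lemma selling_class_eq_iff:
  assumes "n \<ge> 1" "t \<in> selling_triples n" "t' \<in> selling_triples n"
  shows "selling_class n t = selling_class n t' \<longleftrightarrow> bqf_SL2_equiv (selling t) (selling t')"
  unfolding selling_class_def
  using eq_equiv_class_iff[OF equiv_form_rel] selling_pos_def_forms[OF assms(1)] assms(2,3)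
  by (simp add: form_rel_def)

text \<open>The forms with weights 1/2 and 1/3 have the Selling triples (0, 2a, 2a) and (a, a, a),
  so the weight of a class can be read off its fibre.\<close>

lemma class_weight_selling:
  assumes n: "n \<ge> 1" and t: "t \<in> selling_triples n"
  shows "class_weight (selling_class n t) =
    (if \<exists>a>0. (0, 2 * a, 2 * a) \<in> selling_fiber n t then 1 / 2
     else if \<exists>a>0. (a, a, a) \<in> selling_fiber n t then 1 / 3 else 1)"
proof -
  have mem: "Q \<in> selling_class n t \<longleftrightarrow> Q \<in> pos_def_forms n \<and> bqf_SL2_equiv (selling t) Q" for Q
    using selling_pos_def_forms[OF n t] by (simp add: selling_class_def form_rel_def)
  have fib: "selling t' \<in> selling_class n t" if "t' \<in> selling_fiber n t" for t'
    using that selling_pos_def_forms[OF n] by (simp add: mem selling_fiber_def)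
  have 1: "(\<exists>a. (a, 0, a) \<in> selling_class n t) \<longleftrightarrow> (\<exists>a>0. (0, 2 * a, 2 * a) \<in> selling_fiber n t)"
  proof
    assume "\<exists>a. (a, 0, a) \<in> selling_class n t"
    then obtain a where a: "(a, 0, a) \<in> selling_class n t" ..
    then have "(a, 0, a) \<in> pos_def_forms n" by (simp add: mem)
    from square_form_triple[OF this] a
    have "a > 0" "(0, nat (2 * a), nat (2 * a)) \<in> selling_fiber n t"
      by (simp_all add: mem selling_fiber_def del: nat_mult_distrib)
    then have "nat a > 0" "(0, 2 * nat a, 2 * nat a) \<in> selling_fiber n t" by (simp_all add: nat_mult_distrib)
    then show "\<exists>a>0. (0, 2 * a, 2 * a) \<in> selling_fiber n t" by (intro exI[of _ "nat a"] conjI)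
  next
    assume "\<exists>a>0. (0, 2 * a, 2 * a) \<in> selling_fiber n t"
    then obtain a where "(0, 2 * a, 2 * a) \<in> selling_fiber n t" by blast
    from fib[OF this] have "(int a, 0, int a) \<in> selling_class n t" by (simp add: selling_def)
    then show "\<exists>a. (a, 0, a) \<in> selling_class n t" ..
  qed
  have 2: "(\<exists>a. (a, a, a) \<in> selling_class n t) \<longleftrightarrow> (\<exists>a>0. (a, a, a) \<in> selling_fiber n t)"
  proof
    assume "\<exists>a. (a, a, a) \<in> selling_class n t"
    then obtain a where a: "(a, a, a) \<in> selling_class n t" ..
    then have "(a, a, a) \<in> pos_def_forms n" by (simp add: mem)
    from hexagonal_form_triple[OF this] a
    have "nat a > 0" "(nat a, nat a, nat a) \<in> selling_fiber n t"
      by (simp_all add: mem selling_fiber_def)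
    then show "\<exists>a>0. (a, a, a) \<in> selling_fiber n t" by (intro exI[of _ "nat a"] conjI)
  next
    assume "\<exists>a>0. (a, a, a) \<in> selling_fiber n t"
    then obtain a where "(a, a, a) \<in> selling_fiber n t" by blast
    from fib[OF this] have "(int a, int a, int a) \<in> selling_class n t" by (simp add: selling_def)
    then show "\<exists>a. (a, a, a) \<in> selling_class n t" ..
  qed
  show ?thesis unfolding class_weight_def 1 2 ..
qed

text \<open>Three rotations of weight 1, or the single triple (x, x, x), whose class has weight
  1/3.\<close>

lemma sum_selling_fiber_pos:
  assumes n: "n \<ge> 1" and t: "(x, y, z) \<in> selling_triples n" and pos: "x > 0" "y > 0" "z > 0"
  shows "3 * class_weight (selling_class n (x, y, z)) = sum triple_weight (selling_fiber n (x, y, z))"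
proof (cases "x = y \<and> y = z")
  case True
  then have f: "selling_fiber n (x, y, z) = {(x, x, x)}" using selling_fiber_pos[OF t pos] by simp
  have "(\<exists>a>0. (0, 2 * a, 2 * a) \<in> selling_fiber n (x, y, z)) = False"
    "(\<exists>a>0. (a, a, a) \<in> selling_fiber n (x, y, z)) = True" unfolding f using pos by auto
  then have "class_weight (selling_class n (x, y, z)) = 1 / 3"
    unfolding class_weight_selling[OF n t] by simp
  then show ?thesis unfolding f using pos by (simp add: triple_weight_def)
next
  case False
  note f = selling_fiber_pos[OF t pos]
  have "(\<exists>a>0. (0, 2 * a, 2 * a) \<in> selling_fiber n (x, y, z)) = False"
    "(\<exists>a>0. (a, a, a) \<in> selling_fiber n (x, y, z)) = False" unfolding f using pos False by auto
  then have "class_weight (selling_class n (x, y, z)) = 1"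
    unfolding class_weight_selling[OF n t] by simp
  moreover have "(x, y, z) \<noteq> (y, z, x)" "(x, y, z) \<noteq> (z, x, y)" "(y, z, x) \<noteq> (z, x, y)" using False by auto
  ultimately show ?thesis unfolding f using pos by (simp add: triple_weight_def)
qed

text \<open>Six permutations of weight 1/2, or three of them if y = z, in which case the class has
  weight 1/2.\<close>

lemma sum_selling_fiber_zero:
  assumes n: "n \<ge> 1" and t: "(0, y, z) \<in> selling_triples n"
  shows "3 * class_weight (selling_class n (0, y, z)) = sum triple_weight (selling_fiber n (0, y, z))"
proof -
  note f = selling_fiber_zero[OF t]
  have pos: "y > 0" "z > 0" and ev: "even y" using n t by (auto simp: selling_triples_def intro!: Nat.gr0I)
  have no: "(\<exists>a>0. (a, a, a) \<in> selling_fiber n (0, y, z)) = False" unfolding f by auto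
  show ?thesis
  proof (cases "y = z")
    case True
    have "y = 2 * (y div 2)" "y div 2 > 0" using ev pos by auto
    then have "\<exists>a>0. (0, 2 * a, 2 * a) \<in> selling_fiber n (0, y, z)"
      using selling_fiber_refl[OF t] True by (intro exI[of _ "y div 2"]) auto
    then have "class_weight (selling_class n (0, y, z)) = 1 / 2"
      unfolding class_weight_selling[OF n t] by simp
    moreover have "selling_fiber n (0, y, z) = {(0, y, y), (y, y, 0), (y, 0, y)}"
      by (subst f) (use True in auto)
    ultimately show ?thesis using pos by (simp add: triple_weight_def)
  next
    case False
    then have "(\<exists>a>0. (0, 2 * a, 2 * a) \<in> selling_fiber n (0, y, z)) = False" unfolding f by auto
    with no have "class_weight (selling_class n (0, y, z)) = 1"
      unfolding class_weight_selling[OF n t] by simp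
    then show ?thesis unfolding f using pos False by (simp add: triple_weight_def)
  qed
qed

lemma sum_selling_fiber:
  assumes n: "n \<ge> 1" and t: "t \<in> selling_triples n"
  shows "3 * class_weight (selling_class n t) =
    sum triple_weight {t' \<in> selling_triples n. selling_class n t' = selling_class n t}"
proof -
  have fib: "{t' \<in> selling_triples n. selling_class n t' = selling_class n s} = selling_fiber n s"
    if "s \<in> selling_triples n" for s
    using selling_class_eq_iff[OF n that] unfolding selling_fiber_def by auto
  obtain x y z where xyz: "t = (x, y, z)" by (metis surj_pair)
  have cls: "selling_class n t = selling_class n s" if "s \<in> selling_fiber n t" for s
    using selling_class_eq_iff[OF n t] that by (simp add: selling_fiber_def)
  note r1 = selling_fiber_rotate[OF t[unfolded xyz]]
  note r2 = selling_fiber_trans[OF r1 selling_fiber_rotate[OF selling_fiber_D[OF r1]]]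
  consider "x > 0" "y > 0" "z > 0" | "x = 0" | "y = 0" | "z = 0" by blast
  then show ?thesis
  proof cases
    case 1
    then show ?thesis using sum_selling_fiber_pos[OF n t[unfolded xyz]] fib[OF t] by (simp add: xyz)
  next
    case 2
    then show ?thesis using sum_selling_fiber_zero[OF n] t fib[OF t] by (simp add: xyz)
  next
    case 3
    then have s: "(0, z, x) \<in> selling_fiber n t" using r1 by (simp add: xyz)
    show ?thesis unfolding cls[OF s] fib[OF selling_fiber_D[OF s]]
      by (rule sum_selling_fiber_zero[OF n selling_fiber_D[OF s]])
  next
    case 4
    then have s: "(0, x, y) \<in> selling_fiber n t" using r2 by (simp add: xyz)
    show ?thesis unfolding cls[OF s] fib[OF selling_fiber_D[OF s]]
      by (rule sum_selling_fiber_zero[OF n selling_fiber_D[OF s]])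
  qed
qed

lemma form_classes_selling:
  assumes n: "n \<ge> 1"
  shows "form_classes n = selling_class n ` selling_triples n"
proof (intro antisym subsetI)
  fix C assume "C \<in> form_classes n"
  then obtain Q where Q: "Q \<in> pos_def_forms n" "C = form_rel n `` {Q}"
    unfolding form_classes_def form_rel_def[symmetric] by (elim quotientE)
  obtain t where t: "t \<in> selling_triples n" "bqf_SL2_equiv Q (selling t)"
    using selling_exists[OF n Q(1)] by blast
  then have "(Q, selling t) \<in> form_rel n"
    using Q(1) selling_pos_def_forms[OF n] by (simp add: form_rel_def)
  then have "C = selling_class n t"
    unfolding Q(2) selling_class_def by (rule equiv_class_eq[OF equiv_form_rel])
  then show "C \<in> selling_class n ` selling_triples n" using t(1) by simp
next
  fix C assume "C \<in> selling_class n ` selling_triples n"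
  then show "C \<in> form_classes n"
    unfolding form_classes_def form_rel_def[symmetric] selling_class_def
    using selling_pos_def_forms[OF n] by (auto intro!: quotientI)
qed

lemma hurwitz_class_number_selling:
  assumes n: "n \<ge> 1"
  shows "3 * hurwitz_class_number n = sum triple_weight (selling_triples n)"
proof -
  have "sum triple_weight (selling_triples n) = (\<Sum>C\<in>selling_class n ` selling_triples n.
      sum triple_weight {t \<in> selling_triples n. selling_class n t = C})"
    by (rule sum.image_gen[OF finite_selling_triples[OF n]])
  also have "\<dots> = (\<Sum>C\<in>selling_class n ` selling_triples n. 3 * class_weight C)"
    by (rule sum.cong) (use sum_selling_fiber[OF n] in auto)
  finally show ?thesis
    by (simp add: hurwitz_class_number_def form_classes_selling[OF n] sum_distrib_left)
qed

section \<open>Comparing coefficients\<close>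

definition cone_set :: "nat \<Rightarrow> (nat \<times> nat \<times> nat) set" where
  "cone_set n = {p \<in> tcone. cone_exp p = n}"

definition cone_coeff :: "(nat \<times> nat \<times> nat \<Rightarrow> int) \<Rightarrow> nat \<Rightarrow> real" where
  "cone_coeff s n = (\<Sum>p\<in>cone_set n. of_int (s p) * triple_weight p)"

lemma finite_cone_set: "finite (cone_set n)"
  by (rule finite_subset[OF _ finite_cone_le[of n]]) (auto simp: cone_set_def)

lemma cone_sum_nth:
  "cone_sum (\<lambda>p. of_int (s p)) $$ k = (if k < 0 then 0 else of_real (cone_coeff s (nat k)))"
proof -
  have nth: "(of_int (s p) * cone_term p) $$ k = (if k = int (cone_exp p) then of_int (s p) * of_real (triple_weight p) else 0)"
    for p
  proof -
    obtain x y z where p: "p = (x, y, z)" by (metis surj_pair)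
    have h: "(1 / 2 :: complex fls) = fls_const (1 / 2)"
      using fls_const_divide_const[of 1 "2 :: complex"] by (simp add: fls_const_numeral)
    have "cone_term p = fls_const (of_real (triple_weight p)) * fls_X ^ cone_exp p"
      unfolding p cone_term_def cone_exp_def triple_weight_def prod.case qX_def h
      by simp
    then have "of_int (s p) * cone_term p = fls_const (of_int (s p) * of_real (triple_weight p)) * fls_X ^ cone_exp p"
      unfolding fls_of_int by (simp add: fls_const_mult_const mult.assoc[symmetric])
    then show ?thesis by (simp add: fls_X_power_nth)
  qed
  have vge: "vge (of_int (s p)) 0" for p
    by (simp add: vge_def fls_of_int)
  have F: "cone_sum (\<lambda>p. of_int (s p)) $$ k = (\<Sum>p\<in>F. (of_int (s p) * cone_term p) $$ k)"
    if "finite F" "F \<subseteq> tcone" "\<And>p. p \<in> tcone - F \<Longrightarrow> k \<noteq> int (cone_exp p)" for F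
    unfolding cone_sum_def
    by (rule fsum_nth[OF fsummable_cone[OF vge] that(1,2)]) (use that(3) nth in auto)
  show ?thesis
  proof (cases "k < 0")
    case True
    then show ?thesis using F[of "{}"] by simp
  next
    case False
    then have "cone_sum (\<lambda>p. of_int (s p)) $$ k = (\<Sum>p\<in>cone_set (nat k). (of_int (s p) * cone_term p) $$ k)"
      by (intro F finite_cone_set) (auto simp: cone_set_def)
    also have "\<dots> = (\<Sum>p\<in>cone_set (nat k). of_int (s p) * of_real (triple_weight p))"
      by (rule sum.cong) (use False nth in \<open>auto simp: cone_set_def\<close>)
    finally show ?thesis using False by (simp add: cone_coeff_def)
  qed
qed

lemma cone_coeff_rotate: "cone_coeff (\<lambda>(x, y, z). s (y, z, x)) n = cone_coeff s n"
  unfolding cone_coeff_def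
  by (rule sum.reindex_bij_witness[where i = "\<lambda>(x, y, z). (z, x, y)" and j = "\<lambda>(x, y, z). (y, z, x)"])
    (auto simp: cone_set_def tcone_def cone_exp_def triple_weight_def algebra_simps)

lemma cone_coeff_add: "cone_coeff s n + cone_coeff s' n = cone_coeff (\<lambda>p. s p + s' p) n"
  by (simp add: cone_coeff_def sum.distrib algebra_simps)

lemma cone_coeff_cmult: "of_int c * cone_coeff s n = cone_coeff (\<lambda>p. c * s p) n"
  by (simp add: cone_coeff_def sum_distrib_left algebra_simps)

lemma cone_coeff_cong: "(\<And>x y z. x * y + y * z + z * x = n \<Longrightarrow> s (x, y, z) = s' (x, y, z)) \<Longrightarrow> cone_coeff s n = cone_coeff s' n"
  unfolding cone_coeff_def by (rule sum.cong) (auto simp: cone_set_def cone_exp_def)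

lemma cone_coeff_symmetrize:
  "3 * cone_coeff s n = cone_coeff (\<lambda>(x, y, z). s (x, y, z) + s (y, z, x) + s (z, x, y)) n"
proof -
  have "cone_coeff (\<lambda>(x, y, z). s (z, x, y)) n = cone_coeff s n"
    using cone_coeff_rotate[of "\<lambda>(x, y, z). s (y, z, x)" n] cone_coeff_rotate[of s n] by simp
  then have "3 * cone_coeff s n = cone_coeff s n + cone_coeff (\<lambda>(x, y, z). s (y, z, x)) n
      + cone_coeff (\<lambda>(x, y, z). s (z, x, y)) n"
    using cone_coeff_rotate[of s n] by simp
  also have "\<dots> = cone_coeff (\<lambda>(x, y, z). s (x, y, z) + s (y, z, x) + s (z, x, y)) n"
    unfolding cone_coeff_add by (rule cone_coeff_cong) simp
  finally show ?thesis .
qed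

definition \<sigma>1 :: "nat \<times> nat \<times> nat \<Rightarrow> int" where "\<sigma>1 = (\<lambda>(x, y, z). (-1) ^ (x + y))"
definition \<sigma>2 :: "nat \<times> nat \<times> nat \<Rightarrow> int" where "\<sigma>2 = (\<lambda>(x, y, z). (-1) ^ y)"

lemma T0_nth: "T0 $$ int n = of_real (cone_coeff (\<lambda>p. 1) n)"
  using cone_sum_nth[of "\<lambda>p. 1" "int n"] by (simp add: T0_def)

lemma T1_nth: "T1 $$ int n = of_real (cone_coeff \<sigma>1 n)"
proof -
  have "T1 = cone_sum (\<lambda>p. of_int (\<sigma>1 p))"
    unfolding T1_def by (rule arg_cong[of _ _ cone_sum]) (auto simp: \<sigma>1_def)
  then show ?thesis using cone_sum_nth[of \<sigma>1 "int n"] by simp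
qed

lemma T2_nth: "T2 $$ int n = of_real (cone_coeff \<sigma>2 n)"
proof -
  have "T2 = cone_sum (\<lambda>p. of_int (\<sigma>2 p))"
    unfolding T2_def by (rule arg_cong[of _ _ cone_sum]) (auto simp: \<sigma>2_def)
  then show ?thesis using cone_sum_nth[of \<sigma>2 "int n"] by simp
qed

lemma cone_coeff_0: "cone_coeff s 0 = 0"
proof -
  have "cone_set 0 = {}" by (auto simp: cone_set_def cone_exp_def tcone_def)
  then show ?thesis by (simp add: cone_coeff_def)
qed

text \<open>After averaging over rotations this is a statement about parities. With n = x y + y z +
  z x, the expressions 2 (-1)^n ((-1)^x + (-1)^y + (-1)^z) and 3 + (-1)^(x+y) + (-1)^(y+z) +
  (-1)^(z+x) are both 6 if the three parities agree and both 2 otherwise.\<close>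

lemma cone_coeff_\<sigma>2: "2 * ((-1) ^ n * cone_coeff \<sigma>2 n) = cone_coeff (\<lambda>p. 1) n + cone_coeff \<sigma>1 n"
proof -
  have "6 * ((-1) ^ n * cone_coeff \<sigma>2 n) = 3 * (2 * ((-1) ^ n * cone_coeff \<sigma>2 n))" by simp
  also have "2 * ((-1) ^ n * cone_coeff \<sigma>2 n) = cone_coeff (\<lambda>p. 2 * (-1) ^ n * \<sigma>2 p) n"
    using cone_coeff_cmult[of "2 * (-1) ^ n" \<sigma>2 n] by simp
  also have "3 * \<dots> = cone_coeff (\<lambda>(x, y, z). 2 * (-1) ^ n * \<sigma>2 (x, y, z) + 2 * (-1) ^ n * \<sigma>2 (y, z, x)
      + 2 * (-1) ^ n * \<sigma>2 (z, x, y)) n"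
    by (rule cone_coeff_symmetrize)
  also have "\<dots> = cone_coeff (\<lambda>(x, y, z). (1 + \<sigma>1 (x, y, z)) + (1 + \<sigma>1 (y, z, x)) + (1 + \<sigma>1 (z, x, y))) n"
  proof (rule cone_coeff_cong)
    fix x y z assume n: "x * y + y * z + z * x = n"
    show "(case (x, y, z) of (x, y, z) \<Rightarrow> 2 * (-1) ^ n * \<sigma>2 (x, y, z) + 2 * (-1) ^ n * \<sigma>2 (y, z, x)
      + 2 * (-1) ^ n * \<sigma>2 (z, x, y)) =
      (case (x, y, z) of (x, y, z) \<Rightarrow> (1 + \<sigma>1 (x, y, z)) + (1 + \<sigma>1 (y, z, x)) + (1 + \<sigma>1 (z, x, y)))"
      unfolding prod.case \<sigma>1_def \<sigma>2_def n[symmetric]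
      by (cases "even x"; cases "even y"; cases "even z") simp_all
  qed
  also have "\<dots> = 3 * cone_coeff (\<lambda>p. 1 + \<sigma>1 p) n"
    by (rule cone_coeff_symmetrize[symmetric])
  also have "cone_coeff (\<lambda>p. 1 + \<sigma>1 p) n = cone_coeff (\<lambda>p. 1) n + cone_coeff \<sigma>1 n"
    by (rule cone_coeff_add[symmetric])
  finally show ?thesis by simp
qed

text \<open>1 + (-1)^(x+y) + (-1)^(y+z) + (-1)^(z+x) is 4 if the three parities agree and 0
  otherwise.\<close>

lemma cone_coeff_selling:
  assumes "n \<ge> 1"
  shows "4 * sum triple_weight (selling_triples n) = cone_coeff (\<lambda>p. 1) n + 3 * cone_coeff \<sigma>1 n"
proof -
  define s :: "nat \<times> nat \<times> nat \<Rightarrow> int" where "s = (\<lambda>(x, y, z). if even (x + y) \<and> even (y + z) then 1 else 0)"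
  have "sum triple_weight (selling_triples n) = cone_coeff s n"
    unfolding cone_coeff_def
    by (rule sum.mono_neutral_cong_left[OF finite_cone_set])
      (use assms in \<open>auto simp: selling_triples_def cone_set_def cone_exp_def tcone_def s_def split: if_splits\<close>)
  then have "4 * sum triple_weight (selling_triples n) = cone_coeff (\<lambda>p. 4 * s p) n"
    using cone_coeff_cmult[of 4 s n] by simp
  also have "\<dots> = cone_coeff (\<lambda>p. 1 + (case p of (x, y, z) \<Rightarrow> \<sigma>1 (x, y, z) + \<sigma>1 (y, z, x) + \<sigma>1 (z, x, y))) n"
    unfolding s_def \<sigma>1_def prod.case
    by (intro cone_coeff_cong, unfold prod.case, rename_tac x y z,
        case_tac "even x"; case_tac "even y"; case_tac "even z"; simp)
  also have "\<dots> = cone_coeff (\<lambda>p. 1) n + 3 * cone_coeff \<sigma>1 n"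
    unfolding cone_coeff_symmetrize cone_coeff_add ..
  finally show ?thesis .
qed

text \<open>In the other residue classes \<open>hurwitz_coeff\<close> is 0 by definition; this shows
  that the weighted count of triples is 0 there as well.\<close>

lemma selling_triples_mod_4:
  assumes "t \<in> selling_triples n"
  shows "n mod 4 \<in> {0, 3}"
proof -
  obtain x y z where t: "t = (x, y, z)" by (metis surj_pair)
  then have n: "x * y + y * z + z * x = n" and par: "even x = even y" "even y = even z"
    using assms by (auto simp: selling_triples_def)
  show ?thesis
  proof (cases "even y")
    case True
    then have "even x" "even z" using par by simp_all
    obtain a where "x = 2 * a" using \<open>even x\<close> by (rule evenE)
    moreover obtain b where "y = 2 * b" using True by (rule evenE)
    moreover obtain c where "z = 2 * c" using \<open>even z\<close> by (rule evenE)
    ultimately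
    have "n = 4 * (a * b + b * c + c * a)" unfolding n[symmetric] by (simp add: algebra_simps)
    then show ?thesis by simp
  next
    case False
    then have "odd x" "odd z" using par by simp_all
    obtain a where "x = 2 * a + 1" using \<open>odd x\<close> by (rule oddE)
    moreover obtain b where "y = 2 * b + 1" using False by (rule oddE)
    moreover obtain c where "z = 2 * c + 1" using \<open>odd z\<close> by (rule oddE)
    ultimately have "n = 3 + 4 * (a * b + b * c + c * a + a + b + c)" unfolding n[symmetric] by (simp add: algebra_simps)
    moreover have "(3 + 4 * k) mod 4 = 3" for k :: nat by presburger
    ultimately show ?thesis by (metis insertCI)
  qed
qed

definition hurwitz_coeff :: "nat \<Rightarrow> real" where
  "hurwitz_coeff n = (if n = 0 then - 1 / 12 else if n mod 4 \<in> {0, 3} then hurwitz_class_number n else 0)"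

lemma hurwitz_coeff_eq:
  "12 * hurwitz_coeff n = cone_coeff (\<lambda>p. 1) n + 3 * cone_coeff \<sigma>1 n - (if n = 0 then 1 else 0)"
proof (cases "n = 0")
  case True
  then show ?thesis by (simp add: hurwitz_coeff_def cone_coeff_0)
next
  case False
  then have n: "n \<ge> 1" by simp
  show ?thesis
  proof (cases "n mod 4 \<in> {0, 3}")
    case True
    then have "hurwitz_coeff n = hurwitz_class_number n" using False unfolding hurwitz_coeff_def by (simp only: if_True if_False)
    then show ?thesis using cone_coeff_selling[OF n] hurwitz_class_number_selling[OF n] False by simp
  next
    case nmod: False
    then have "selling_triples n = {}" using selling_triples_mod_4 by blast
    moreover have "hurwitz_coeff n = 0" using False nmod unfolding hurwitz_coeff_def by (simp only: if_False)
    ultimately show ?thesis using cone_coeff_selling[OF n] False by simp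
  qed
qed

section \<open>The cube of theta and the elimination of the ternary sums\<close>

definition theta_fps :: "complex fps" where
  "theta_fps = Abs_fps (\<lambda>n. of_nat (card {k :: int. k\<^sup>2 = int n}))"

lemma square_eq_subset: "{k :: int. k\<^sup>2 = int n} \<subseteq> {\<lfloor>sqrt n\<rfloor>, - \<lfloor>sqrt n\<rfloor>}"
proof
  fix k :: int assume "k \<in> {k. k\<^sup>2 = int n}"
  then have "k\<^sup>2 = int n" by simp
  from arg_cong[OF this, of real_of_int] have "real n = (real_of_int k)\<^sup>2" by simp
  then have "sqrt n = \<bar>real_of_int k\<bar>" by simp
  then show "k \<in> {\<lfloor>sqrt n\<rfloor>, - \<lfloor>sqrt n\<rfloor>}" by (auto simp: abs_if)
qed

lemma finite_square_eq: "finite {k :: int. k\<^sup>2 = int n}"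
  by (rule finite_subset[OF square_eq_subset]) simp

lemma card_square_eq: "card {k :: int. k\<^sup>2 = int n} \<le> 2"
proof -
  have "card {k :: int. k\<^sup>2 = int n} \<le> card {\<lfloor>sqrt n\<rfloor>, - \<lfloor>sqrt n\<rfloor>}"
    by (rule card_mono[OF _ square_eq_subset]) simp
  also have "\<dots> \<le> 2" by (simp add: card_insert_if)
  finally show ?thesis .
qed

lemma theta_pos_fps: "theta_pos = fps_to_fls theta_fps"
proof (rule fls_eqI)
  fix m
  have nth: "(qX powi (l\<^sup>2)) $$ m = (if m = l\<^sup>2 then 1 else 0)" for l :: int
    by (simp add: qX_def)
  have s: "fsummable (\<lambda>l. qX powi (l\<^sup>2)) UNIV"
    by (rule fsummable_abs) (rule vge_mono[OF q1.vge_Q_powi q1.abs_le_square_int], simp)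
  have F: "theta_pos $$ m = (\<Sum>l\<in>F. (qX powi (l\<^sup>2)) $$ m)" if "finite F" "{l. l\<^sup>2 = m} \<subseteq> F" for F
    unfolding theta_pos_def
    by (rule fsum_nth[OF s that(1)]) (use that(2) nth in auto)
  show "theta_pos $$ m = fps_to_fls theta_fps $$ m"
  proof (cases "m < 0")
    case True
    then have "l\<^sup>2 \<noteq> m" for l :: int using zero_le_power2[of l] by linarith
    then have "{l :: int. l\<^sup>2 = m} = {}" by simp
    then show ?thesis using F[of "{}"] True by simp
  next
    case False
    then have m: "m = int (nat m)" by simp
    have "theta_pos $$ m = (\<Sum>l\<in>{l. l\<^sup>2 = int (nat m)}. (qX powi (l\<^sup>2)) $$ m)"
      using m by (intro F finite_square_eq) auto
    also have "\<dots> = (\<Sum>l\<in>{l. l\<^sup>2 = int (nat m)}. 1)" by (rule sum.cong) (use m nth in auto)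
    also have "\<dots> = of_nat (card {l :: int. l\<^sup>2 = int (nat m)})" by simp
    finally show ?thesis using False by (simp add: theta_fps_def)
  qed
qed

lemma theta_fps_cubed_nth:
  "fps_nth (theta_fps ^ 3) n = of_real ((if n = 0 then 1 else 0) + 2 * cone_coeff (\<lambda>p. 1) n - 6 * cone_coeff \<sigma>1 n)"
proof -
  have "fps_nth (theta_fps ^ 3) n = (theta_pos ^ 3) $$ int n"
    by (simp add: theta_pos_fps fps_to_fls_power[symmetric])
  then show ?thesis unfolding theta_cubed by (simp add: T0_nth T1_nth)
qed

text \<open>Both sides are the coefficient of 1 - 2 T0 - 2 T1; on the left
  \<open>cone_coeff_\<sigma>2\<close> replaces T2(-q).\<close>

lemma alpha_bar_eq:
  "(-1) ^ n * of_int (alpha_bar n) = of_real (- 16 * hurwitz_coeff n) - 1 / 3 * fps_nth (theta_fps ^ 3) n"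
proof -
  have "of_int (alpha_bar n) = rank_gf $$ int n" by (simp add: rank_gf_def)
  also have "\<dots> = of_real ((if n = 0 then 1 else 0) - 4 * cone_coeff \<sigma>2 n)"
    unfolding rank_gf_eq eulerian1_eq by (simp add: T2_nth)
  finally have "(-1) ^ n * of_int (alpha_bar n)
      = complex_of_real ((-1) ^ n * ((if n = 0 then 1 else 0) - 4 * cone_coeff \<sigma>2 n))" by simp
  also have "(-1) ^ n * ((if n = 0 then 1 else 0) - 4 * cone_coeff \<sigma>2 n)
      = (if n = 0 then 1 else 0) - 2 * (2 * ((-1) ^ n * cone_coeff \<sigma>2 n))" by (simp add: algebra_simps)
  also have "\<dots> = - 16 * hurwitz_coeff n
      - 1 / 3 * ((if n = 0 then 1 else 0) + 2 * cone_coeff (\<lambda>p. 1) n - 6 * cone_coeff \<sigma>1 n)"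
    unfolding cone_coeff_\<sigma>2 using hurwitz_coeff_eq[of n] by (simp add: algebra_simps)
  finally show ?thesis unfolding theta_fps_cubed_nth by simp
qed

text \<open>On the right T0 cancels: the Hurwitz part contributes (2/3) (1 - T0 - 3 T1) and the cube
  (1/3) (1 + 2 T0 - 6 T1), which add up to 1 - 4 T1.\<close>

lemma alpha2_bar_eq:
  "of_int (alpha2_bar n) = of_real (- 8 * hurwitz_coeff n) + 1 / 3 * fps_nth (theta_fps ^ 3) n"
proof -
  have "of_int (alpha2_bar n) = M2_rank_gf $$ int n" by (simp add: M2_rank_gf_def)
  also have "\<dots> = of_real ((if n = 0 then 1 else 0) - 4 * cone_coeff \<sigma>1 n)"
    unfolding M2_rank_gf_eq eulerian2_eq by (simp add: T1_nth)
  also have "(if n = 0 then 1 else 0) - 4 * cone_coeff \<sigma>1 n = - 8 * hurwitz_coeff n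
      + 1 / 3 * ((if n = 0 then 1 else 0) + 2 * cone_coeff (\<lambda>p. 1) n - 6 * cone_coeff \<sigma>1 n)"
    using hurwitz_coeff_eq[of n] by (simp add: algebra_simps)
  finally show ?thesis unfolding theta_fps_cubed_nth by simp
qed

section \<open>Convergence in the unit disc\<close>

text \<open>The entries of a triple with exponent n are at most n, so a cube of side n + 1 contains
  them all. Any polynomial bound is enough for convergence in the disc.\<close>

lemma norm_cone_coeff_le:
  assumes "\<And>p. \<bar>s p\<bar> \<le> 1"
  shows "\<bar>cone_coeff s n\<bar> \<le> (real n + 1) ^ 3"
proof -
  have "\<bar>cone_coeff s n\<bar> \<le> (\<Sum>p\<in>cone_set n. \<bar>of_int (s p) * triple_weight p\<bar>)"
    unfolding cone_coeff_def by (rule sum_abs)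
  also have "\<dots> \<le> (\<Sum>p\<in>cone_set n. 1)"
  proof (rule sum_mono)
    fix p
    have "\<bar>real_of_int (s p)\<bar> \<le> 1" using assms[of p] by linarith
    moreover have "\<bar>triple_weight p\<bar> \<le> 1" by (cases p) (simp add: triple_weight_def)
    ultimately show "\<bar>of_int (s p) * triple_weight p\<bar> \<le> 1" unfolding abs_mult by (intro mult_le_one) auto
  qed
  also have "\<dots> = real (card (cone_set n))" by simp
  also have "\<dots> \<le> real (card ({..n} \<times> {..n} \<times> {..n}))"
  proof (intro of_nat_mono card_mono subsetI)
    fix p assume "p \<in> cone_set n"
    then show "p \<in> {..n} \<times> {..n} \<times> {..n}"
      using cone_le_exp by (cases p) (auto simp: cone_set_def)
  qed simp
  also have "\<dots> = (real n + 1) ^ 3" by (simp add: power3_eq_cube algebra_simps)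
  finally show ?thesis .
qed

lemma summable_cube_powser:
  fixes x :: real
  assumes "0 \<le> x" "x < 1"
  shows "summable (\<lambda>n. (real n + 1) ^ 3 * x ^ n)"
proof -
  have "(\<lambda>n. 1 + inverse (real (Suc n))) \<longlonglongrightarrow> 1 + 0"
    by (intro tendsto_add tendsto_const LIMSEQ_inverse_real_of_nat)
  then have "(\<lambda>n. inverse ((1 + inverse (real (Suc n))) ^ 3)) \<longlonglongrightarrow> inverse ((1 + 0) ^ 3)"
    by (intro tendsto_inverse tendsto_power) auto
  moreover have "inverse ((1 + inverse (real (Suc n))) ^ 3) = norm ((real n + 1) ^ 3) / norm ((real (Suc n) + 1) ^ 3)" for n
  proof -
    have "1 + inverse (real (Suc n)) = (real n + 2) / (real n + 1)" by (simp add: field_simps)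
    then show ?thesis by (simp add: power_divide abs_if add.commute)
  qed
  ultimately have "conv_radius (\<lambda>n. (real n + 1) ^ 3) = ereal 1"
    by (intro conv_radius_ratio_limit_nonzero[where c = 1]) simp_all
  then show ?thesis using assms by (intro summable_in_conv_radius) auto
qed

lemma summable_hurwitz_coeff:
  fixes q :: complex
  assumes "norm q < 1"
  shows "summable (\<lambda>n. of_real (hurwitz_coeff n) * q ^ n)"
proof (rule summable_comparison_test')
  show "summable (\<lambda>n. (real n + 1) ^ 3 * norm q ^ n)"
    using assms by (intro summable_cube_powser) auto
  fix n
  have "\<bar>cone_coeff (\<lambda>p. 1) n\<bar> \<le> (real n + 1) ^ 3" "\<bar>cone_coeff \<sigma>1 n\<bar> \<le> (real n + 1) ^ 3"
    by (intro norm_cone_coeff_le; auto simp: \<sigma>1_def)+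
  moreover have "1 \<le> (real n + 1) ^ 3" by simp
  ultimately have "\<bar>hurwitz_coeff n\<bar> \<le> (real n + 1) ^ 3"
    using hurwitz_coeff_eq[of n] by (simp split: if_splits)
  then show "norm (complex_of_real (hurwitz_coeff n) * q ^ n) \<le> (real n + 1) ^ 3 * norm q ^ n"
    by (simp add: norm_mult norm_power mult_right_mono)
qed

text \<open>In \<open>hurwitz_gf\<close> the constant -1/12 stands outside a series whose term at 0
  is 0; here it is put back as the term at 0.\<close>

lemma hurwitz_gf_sums:
  assumes "norm q < 1"
  shows "(\<lambda>n. of_real (hurwitz_coeff n) * q ^ n) sums hurwitz_gf q"
proof -
  define f where "f n = complex_of_real (hurwitz_coeff n) * q ^ n" for n
  define g where "g n = (if n \<ge> 1 \<and> n mod 4 \<in> {0, 3} then of_real (hurwitz_class_number n) * q ^ n else 0)" for n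
  have sf: "summable f" unfolding f_def by (rule summable_hurwitz_coeff[OF assms])
  have "g = (\<lambda>n. f n - (if n = 0 then - (1/12) else 0))"
    by (rule ext) (auto simp: f_def g_def hurwitz_coeff_def)
  moreover have c: "(\<lambda>n. if n = 0 then - (1/12) else 0 :: complex) sums (- (1/12))"
    using sums_single[of 0 "\<lambda>_. - (1/12) :: complex"] by simp
  ultimately have "g sums (suminf f - (- (1/12)))"
    using sums_diff[OF summable_sums[OF sf] c] by (simp only:)
  then have "hurwitz_gf q = suminf f"
    unfolding hurwitz_gf_def g_def[symmetric] by (simp add: sums_iff)
  then show ?thesis using summable_sums[OF sf] unfolding f_def by simp
qed

lemma summable_theta_fps:
  fixes q :: complex
  assumes "norm q < 1"
  shows "summable (\<lambda>n. norm (fps_nth theta_fps n * q ^ n))"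
proof (rule summable_comparison_test')
  show "summable (\<lambda>n. 2 * norm q ^ n)" using assms by (intro summable_mult summable_geometric) simp
  show "norm (norm (fps_nth theta_fps n * q ^ n)) \<le> 2 * norm q ^ n" for n
    using card_square_eq[of n] by (simp add: theta_fps_def norm_mult norm_power mult_right_mono)
qed

text \<open>\<open>theta\<close> is an unordered sum over the integers. Grouping k by n = k^2 turns
  it into a power series, justified by absolute summability over the pairs (n, k).\<close>

lemma theta_eval_fps:
  assumes "norm (exp (2 * of_real pi * \<i> * z)) < 1"
  shows "theta z = eval_fps theta_fps (exp (2 * of_real pi * \<i> * z))"
proof -
  define q where "q = exp (2 * of_real pi * \<i> * z)"
  define B where "B n = {k :: int. k\<^sup>2 = int n}" for n
  have sum: "(\<lambda>n. norm (fps_nth theta_fps n * q ^ n)) summable_on UNIV"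
    using summable_theta_fps[of q] assms by (intro norm_summable_imp_summable_on) (auto simp: q_def)
  have inner: "infsum (\<lambda>k. norm (q ^ n)) (B n) = norm (fps_nth theta_fps n * q ^ n)"
    "infsum (\<lambda>k. q ^ n) (B n) = fps_nth theta_fps n * q ^ n" for n
    using finite_square_eq[of n] by (simp_all add: B_def theta_fps_def norm_mult)
  have abs: "(\<lambda>p. norm (case p of (n, k :: int) \<Rightarrow> q ^ n)) summable_on Sigma UNIV B"
    unfolding Infinite_Sum.abs_summable_on_Sigma_iff prod.case inner
    using finite_square_eq sum by (simp add: B_def)
  have "theta z = infsum (\<lambda>n. q powi (n\<^sup>2)) UNIV" unfolding theta_def q_def ..
  also have "\<dots> = infsum (\<lambda>(n, k). q ^ n) (Sigma UNIV B)"
    by (rule infsum_reindex_bij_witness[where i = snd and j = "\<lambda>k. (nat (k\<^sup>2), k)"])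
      (auto simp: B_def power_int_def)
  also have "\<dots> = infsum (\<lambda>n. infsum (\<lambda>k. q ^ n) (B n)) UNIV"
    using infsum_Sigma_banach[OF Infinite_Sum.abs_summable_summable[OF abs]] by simp
  also have "\<dots> = infsum (\<lambda>n. fps_nth theta_fps n * q ^ n) UNIV" unfolding inner ..
  also have "\<dots> = suminf (\<lambda>n. fps_nth theta_fps n * q ^ n)"
    using has_sum_imp_sums[OF has_sum_infsum[OF Infinite_Sum.abs_summable_summable[OF sum]]] by (rule sums_unique)
  finally show ?thesis by (simp add: eval_fps_def q_def)
qed

lemma theta_cubed_sums:
  assumes q: "q = exp (2 * of_real pi * \<i> * z)" "norm q < 1"
  shows "(\<lambda>n. fps_nth (theta_fps ^ 3) n * q ^ n) sums (theta z ^ 3)"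
proof -
  have c: "fps_conv_radius theta_fps \<ge> 1" unfolding fps_conv_radius_def
  proof (rule conv_radius_geI_ex')
    fix r :: real assume "0 < r" "ereal r < 1"
    then have "norm (complex_of_real r) < 1" by simp
    then show "summable (\<lambda>n. fps_nth theta_fps n * of_real r ^ n)"
      by (rule summable_norm_cancel[OF summable_theta_fps])
  qed
  have "ereal (norm q) < 1" using q(2) by simp
  then have r: "norm q < fps_conv_radius theta_fps" using c by (rule less_le_trans)
  then have "norm q < fps_conv_radius (theta_fps ^ 3)"
    using fps_conv_radius_power by (rule less_le_trans)
  from sums_eval_fps[OF this] show ?thesis
    unfolding eval_fps_power[OF r] using theta_eval_fps[of z] q by simp
qed

theorem theorem1p1:
  fixes z q :: complex
  assumes "Im z > 0"
    and "q = exp (2 * of_real pi * \<i> * z)"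
  shows "f_bar (- q) = - 16 * hurwitz_gf q - 1 / 3 * theta z ^ 3 \<and>
         f2_bar q = - 8 * hurwitz_gf q + 1 / 3 * theta z ^ 3"
proof
  have q: "norm q < 1" using assms by simp
  note h = hurwitz_gf_sums[OF q] and t = theta_cubed_sums[OF assms(2) q]
  have "(\<lambda>n. - 16 * (of_real (hurwitz_coeff n) * q ^ n) - 1 / 3 * (fps_nth (theta_fps ^ 3) n * q ^ n))
      sums (- 16 * hurwitz_gf q - 1 / 3 * theta z ^ 3)"
    by (intro sums_diff sums_mult h t)
  moreover have "of_int (alpha_bar n) * (- q) ^ n =
      - 16 * (of_real (hurwitz_coeff n) * q ^ n) - 1 / 3 * (fps_nth (theta_fps ^ 3) n * q ^ n)" for n
  proof -
    have "of_int (alpha_bar n) * (- q) ^ n = ((-1) ^ n * of_int (alpha_bar n)) * q ^ n"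
      by (simp add: power_minus[of q])
    then show ?thesis unfolding alpha_bar_eq by (simp add: algebra_simps)
  qed
  ultimately show "f_bar (- q) = - 16 * hurwitz_gf q - 1 / 3 * theta z ^ 3"
    unfolding f_bar_def by (simp add: sums_iff)
  have "(\<lambda>n. - 8 * (of_real (hurwitz_coeff n) * q ^ n) + 1 / 3 * (fps_nth (theta_fps ^ 3) n * q ^ n))
      sums (- 8 * hurwitz_gf q + 1 / 3 * theta z ^ 3)"
    by (intro sums_add sums_mult h t)
  moreover have "of_int (alpha2_bar n) * q ^ n =
      - 8 * (of_real (hurwitz_coeff n) * q ^ n) + 1 / 3 * (fps_nth (theta_fps ^ 3) n * q ^ n)" for n
    unfolding alpha2_bar_eq by (simp add: algebra_simps)
  ultimately show "f2_bar q = - 8 * hurwitz_gf q + 1 / 3 * theta z ^ 3"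
    unfolding f2_bar_def by (simp add: sums_iff)
qed

end
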